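(* Let $X,U,Y$ be Banach lattices, let $p\in[1,\infty)$, and let $(A,B,C)$ be an $L^p$-well-posed triplet on $(X,U,Y)$ with associated system $(\Sigma)$ and input-output map $\mathbb{F}$. Then $(\Sigma)$ is internally positive if and only if $A$ generates a positive $C_0$-semigroup $\mathbb{T}$ on $X$, $C$ is positive, $B$ is positive, and $\mathbb{F}$ is positive. If, in addition, $(A,B,C)$ is an $L^p$-well-posed strongly regular triplet with feedthrough operator $D$, then $(\Sigma)$ is internally positive if and only if $D$, $C$, $B$ and $\mathbb{T}$ are positive.
   Context: Setting. $A$ generates a $C_0$-semigroup $\mathbb{T}=(T(t))_{t\ge0}$ on $X$; $X_1$ is $D(A)$ with the norm $\Vert(\mu I-A)x\Vert$, and $X_{-1}$ is the completion of $X$ for $\Vert R(\mu,A)x\Vert$ ($\mu\in\rho(A)$); $\mathbb{T}_{-1}$ is the unique extension of $\mathbb{T}$ to a $C_0$-semigroup on $X_{-1}$, with generator $A_{-1}$; $X_{-1,+}$ is the closure of $X_+$ in $X_{-1}$. Let $B\in\mathcal{L}(U,X_{-1})$ and $\Phi_tu=\int_0^tT_{-1}(t-s)Bu(s)\,ds$. $B$ is an $L^p$-admissible control operator for $A$ if for some $\tau>0$, $\Phi_\tau u\in X$ for all $u\in L^p(\mathbb{R}_+;U)$. Put $Z=X_1+R(\mu,A_{-1})BU$ ($\mu\in\rho(A)$; independent of $\mu$), a Banach space with norm $\Vert z\Vert_Z^2=\inf\{\Vert x\Vert_{X_1}^2+\Vert u\Vert_U^2: z=x+R(\mu,A_{-1})Bu,\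 x\in X_1,\ u\in U\}$. Let $\Gamma\in\mathcal{L}(Z,Y)$, $D_\Sigma\in\mathcal{L}(U,Y)$ and $C:=\Gamma_{|D(A)}$. $C$ is an $L^p$-admissible observation operator for $A$ if for some (all) $\alpha>0$ there is $\gamma>0$ with $\int_0^\alpha\Vert CT(t)x\Vert^pdt\le\gamma^p\Vert x\Vert^p$ for all $x\in D(A)$. The system $(\Sigma)$ is $$\dot z(t)=A_{-1}z(t)+Bu(t),\quad z(0)=x,\qquad y(t)=\Gamma z(t)+D_\Sigma u(t),\qquad t>0.$$ Let $W^{1,p}_0([0,\tau];U)=\{u\in W^{1,p}([0,\tau];U):u(0)=0\}$; for such $u$ one has $\Phi_tu\in Z$ and one defines $(\mathbb{F}u)(t)=\Gamma\Phi_tu+D_\Sigma u(t)$. $(A,B,C)$ is an $L^p$-well-posed triplet on $(X,U,Y)$ if $B$ is an $L^p$-admissible control operator for $A$, $C$ is an $L^p$-admissible observation operator for $A$, and for every $\tau>0$ there is $\beta>0$ with $\Vert\mathbb{F}u\Vert_{L^p([0,\tau];Y)}\le\beta\Vert u\Vert_{L^p([0,\tau];U)}$ for all $u\in W^{1,p}_0([0,\tau];U)$. Then $\mathbb{F}$ extends uniquely by continuity to a map $L^p_{loc}(\mathbb{R}_+;U)\to L^p_{loc}(\mathbb{R}_+;Y)$ (the input-output map), $x\mapsto CT(\cdot)x$ extends uniquely by continuity to $\Psi:X\to L^p_{loc}(\mathbb{R}_+;Y)$, the state of $(\Sigma)$ is $z(t)=T(t)x+\Phi_tu$ and its output is $y=\Psi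 x+\mathbb{F}u$ for $(x,u)\in X\times L^p_{loc}(\mathbb{R}_+;U)$. Transfer function and regularity. The transfer function $\mathbf{H}$ is the $\mathcal{L}(U,Y)$-valued analytic function with $\widehat{\mathbb{F}u}(\mu)=\mathbf{H}(\mu)\hat u(\mu)$ (Laplace transforms) on some right half-plane; explicitly $\mathbf{H}(\mu)=\Gamma R(\mu,A_{-1})B+D_\Sigma$. The triplet is strongly regular if $Du:=\lim_{\mathbb{R}\ni\mu\to+\infty}\mathbf{H}(\mu)u$ exists in the norm of $Y$ for all $u\in U$; $D\in\mathcal{L}(U,Y)$ is the feedthrough operator. Positivity. An element of an $L^p$-type space is positive if it takes values in the positive cone almost everywhere; an operator between ordered spaces is positive if it maps positive elements to positive elements (so $B$ is positive if $BU_+\subset X_{-1,+}$, and $C$ is positive if $Cx\in Y_+$ for $x\in D(A)\cap X_+$); $\mathbb{T}$ is positive if every $T(t)$ is positive. $(\Sigma)$ is internally positive if for every $x\in X_+$ and every positive input $u\in L^p_{loc}(\mathbb{R}_+;U)$ the state satisfies $z(t)\in X_+$ for all $t\ge0$ and the output $y$ is positive. *)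

theory Defs
  imports "HOL-Analysis.Analysis"
begin

section \<open>Banach lattices\<close>

text \<open>\<open>sup x (- x)\<close> is the modulus of \<open>x\<close>.\<close>

class banach_lattice = banach + ordered_real_vector + lattice +
  assumes norm_mono_modulus: "sup x (- x) \<le> sup y (- y) \<Longrightarrow> norm x \<le> norm y"

instance real :: banach_lattice
  by standard (auto simp: sup_real_def max_def split: if_splits)

section \<open>Semigroups, generators, resolvents\<close>

text \<open>Unbounded operators are represented by their graphs, so that \<open>D(A)\<close> is \<open>Domain A\<close>.
  A semigroup is a function on \<open>real\<close> of which only the values at \<open>t \<ge> 0\<close> matter.\<close>

definition c0_semigroup :: "(real \<Rightarrow> 'a::banach \<Rightarrow>\<^sub>L 'a) \<Rightarrow> bool" where
  "c0_semigroup T \<longleftrightarrow>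
     T 0 = id_blinfun \<and>
     (\<forall>s\<ge>0. \<forall>t\<ge>0. T (s + t) = T s o\<^sub>L T t) \<and>
     (\<forall>x. ((\<lambda>t. T t x) \<longlongrightarrow> x) (at_right 0))"

definition generator :: "(real \<Rightarrow> 'a::banach \<Rightarrow>\<^sub>L 'a) \<Rightarrow> ('a \<times> 'a) set" where
  "generator T = {(x, y). ((\<lambda>h. (T h x - x) /\<^sub>R h) \<longlongrightarrow> y) (at_right 0)}"

definition generates :: "('a::banach \<times> 'a) set \<Rightarrow> (real \<Rightarrow> 'a \<Rightarrow>\<^sub>L 'a) \<Rightarrow> bool" where
  "generates A T \<longleftrightarrow> c0_semigroup T \<and> A = generator T"

definition is_resolvent :: "('a::banach \<times> 'a) set \<Rightarrow> real \<Rightarrow> ('a \<Rightarrow>\<^sub>L 'a) \<Rightarrow> bool" where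
  "is_resolvent A \<mu> R \<longleftrightarrow>
     (\<forall>x. (R x, \<mu> *\<^sub>R R x - x) \<in> A) \<and> (\<forall>(x, y)\<in>A. R (\<mu> *\<^sub>R x - y) = x)"

definition resolvent_set :: "('a::banach \<times> 'a) set \<Rightarrow> real set" where
  "resolvent_set A = {\<mu>. \<exists>R. is_resolvent A \<mu> R}"

definition resolvent :: "('a::banach \<times> 'a) set \<Rightarrow> real \<Rightarrow> ('a \<Rightarrow>\<^sub>L 'a)" where
  "resolvent A \<mu> = (THE R. is_resolvent A \<mu> R)"

section \<open>Extrapolation space\<close>

text \<open>The type \<open>'e\<close> together with \<open>J\<close> is a completion of \<open>X\<close> for the norm
  \<open>\<parallel>R(\<mu>,A)x\<parallel>\<close>; it is unique up to isometric isomorphism, and \<open>X\<close> is identified with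
  \<open>range J\<close>. (For any \<open>A\<close> the type of \<open>X\<close> itself with \<open>J = R(\<mu>,A)\<close> is such a completion.)\<close>

definition is_extrapolation_space ::
  "('a::banach \<times> 'a) set \<Rightarrow> real \<Rightarrow> ('a \<Rightarrow> 'e::banach) \<Rightarrow> bool" where
  "is_extrapolation_space A \<mu> J \<longleftrightarrow>
     linear J \<and> (\<forall>x. norm (J x) = norm (resolvent A \<mu> x)) \<and> closure (range J) = UNIV"

definition is_extrapolated_semigroup ::
  "('a::banach \<Rightarrow> 'e::banach) \<Rightarrow> (real \<Rightarrow> 'a \<Rightarrow>\<^sub>L 'a) \<Rightarrow> (real \<Rightarrow> 'e \<Rightarrow>\<^sub>L 'e) \<Rightarrow> bool" where
  "is_extrapolated_semigroup J T T\<^sub>e \<longleftrightarrow>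
     c0_semigroup T\<^sub>e \<and> (\<forall>t\<ge>0. \<forall>x. T\<^sub>e t (J x) = J (T t x))"

definition extrapolation_cone :: "('a::banach_lattice \<Rightarrow> 'e::banach) \<Rightarrow> 'e set" where
  "extrapolation_cone J = closure (J ` {x. 0 \<le> x})"

section \<open>Spaces of vector-valued functions on the half-line\<close>

text \<open>The Bochner integral of the library requires separable values. Here measurability is Bochner
  measurability (a.e. limit of simple functions), and vector-valued functions are integrated with
  the Henstock-Kurzweil integral, which agrees with the Bochner integral on every Bochner integrable
  function. Elements of \<open>L\<^sup>p\<close> are represented by functions; only their values on
  \<open>S \<subseteq> [0,\<infinity>)\<close> matter.\<close>

definition strongly_measurable :: "'s measure \<Rightarrow> ('s \<Rightarrow> 'b::banach) \<Rightarrow> bool" where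
  "strongly_measurable M f \<longleftrightarrow>
     (\<exists>s. (\<forall>n. simple_function M (s n)) \<and> (AE t in M. (\<lambda>n::nat. s n t) \<longlonglongrightarrow> f t))"

definition Lp :: "real \<Rightarrow> real set \<Rightarrow> (real \<Rightarrow> 'b::banach) set" where
  "Lp p S = {f. strongly_measurable (lebesgue_on S) f \<and>
                integrable (lebesgue_on S) (\<lambda>t. norm (f t) powr p)}"

definition Lp_norm :: "real \<Rightarrow> real set \<Rightarrow> (real \<Rightarrow> 'b::banach) \<Rightarrow> real" where
  "Lp_norm p S f = (LINT t|lebesgue_on S. norm (f t) powr p) powr (1 / p)"

definition Lp_loc :: "real \<Rightarrow> (real \<Rightarrow> 'b::banach) set" where
  "Lp_loc p = {f. \<forall>\<tau>>0. f \<in> Lp p {0..\<tau>}}"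

definition Lp_loc_tendsto ::
  "real \<Rightarrow> (nat \<Rightarrow> real \<Rightarrow> 'b::banach) \<Rightarrow> (real \<Rightarrow> 'b) \<Rightarrow> bool" where
  "Lp_loc_tendsto p f g \<longleftrightarrow> (\<forall>\<tau>>0. (\<lambda>n. Lp_norm p {0..\<tau>} (\<lambda>t. f n t - g t)) \<longlonglongrightarrow> 0)"

text \<open>\<open>W1p_0 p \<tau>\<close> consists of the continuous representatives \<open>u\<close> of the elements of
  \<open>W\<^sup>1\<^sup>,\<^sup>p([0,\<tau>])\<close>, i.e. of the primitives of \<open>L\<^sup>p\<close> functions, with \<open>u(0) = 0\<close>.\<close>

definition W1p_0 :: "real \<Rightarrow> real \<Rightarrow> (real \<Rightarrow> 'b::banach) set" where
  "W1p_0 p \<tau> = {u. u 0 = 0 \<and> (\<exists>v\<in>Lp p {0..\<tau>}. \<forall>t\<in>{0..\<tau>}. (v has_integral u t - u 0) {0..t})}"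

definition ae_nonneg :: "(real \<Rightarrow> 'b::banach_lattice) \<Rightarrow> bool" where
  "ae_nonneg f \<longleftrightarrow> (AE t in lebesgue_on {0..}. 0 \<le> f t)"

section \<open>The system\<close>

definition input_map ::
  "(real \<Rightarrow> 'e::banach \<Rightarrow>\<^sub>L 'e) \<Rightarrow> ('u::banach \<Rightarrow>\<^sub>L 'e) \<Rightarrow> real \<Rightarrow> (real \<Rightarrow> 'u) \<Rightarrow> 'e" where
  "input_map T\<^sub>e B t u = integral {0..t} (\<lambda>s. T\<^sub>e (t - s) (B (u s)))"

definition control_admissible ::
  "real \<Rightarrow> ('x::banach \<Rightarrow> 'e::banach) \<Rightarrow> (real \<Rightarrow> 'e \<Rightarrow>\<^sub>L 'e) \<Rightarrow> ('u::banach \<Rightarrow>\<^sub>L 'e) \<Rightarrow> bool" where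
  "control_admissible p J T\<^sub>e B \<longleftrightarrow>
     (\<exists>\<tau>>0. \<forall>u\<in>Lp p {0..}. input_map T\<^sub>e B \<tau> u \<in> range J)"

definition observation_admissible ::
  "real \<Rightarrow> ('x::banach \<times> 'x) set \<Rightarrow> (real \<Rightarrow> 'x \<Rightarrow>\<^sub>L 'x) \<Rightarrow> ('x \<Rightarrow> 'y::banach) \<Rightarrow> bool" where
  "observation_admissible p A T C \<longleftrightarrow>
     (\<exists>\<alpha>>0. \<exists>\<gamma>>0. \<forall>x\<in>Domain A.
        (\<lambda>t. C (T t x)) \<in> Lp p {0..\<alpha>} \<and>
        (LINT t|lebesgue_on {0..\<alpha>}. norm (C (T t x)) powr p) \<le> \<gamma> powr p * norm x powr p)"

text \<open>\<open>Z = X\<^sub>1 + R(\<mu>,A\<^sub>-\<^sub>1)BU\<close> as a subspace of the extrapolation space, with \<open>A\<^sub>-\<^sub>1\<close> the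
  generator of \<open>T\<^sub>e\<close>.\<close>

definition Z_space ::
  "('x::banach \<times> 'x) set \<Rightarrow> real \<Rightarrow> ('x \<Rightarrow> 'e::banach) \<Rightarrow> (real \<Rightarrow> 'e \<Rightarrow>\<^sub>L 'e) \<Rightarrow>
   ('u::banach \<Rightarrow>\<^sub>L 'e) \<Rightarrow> 'e set" where
  "Z_space A \<mu> J T\<^sub>e B = {J x + resolvent (generator T\<^sub>e) \<mu> (B u) | x u. x \<in> Domain A}"

definition Z_norm ::
  "('x::banach \<times> 'x) set \<Rightarrow> real \<Rightarrow> ('x \<Rightarrow> 'e::banach) \<Rightarrow> (real \<Rightarrow> 'e \<Rightarrow>\<^sub>L 'e) \<Rightarrow>
   ('u::banach \<Rightarrow>\<^sub>L 'e) \<Rightarrow> 'e \<Rightarrow> real" where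
  "Z_norm A \<mu> J T\<^sub>e B z =
     sqrt (Inf {(norm (\<mu> *\<^sub>R x - y))\<^sup>2 + (norm u)\<^sup>2 | x y u.
                  (x, y) \<in> A \<and> z = J x + resolvent (generator T\<^sub>e) \<mu> (B u)})"

definition bounded_linear_on_Z ::
  "('x::banach \<times> 'x) set \<Rightarrow> real \<Rightarrow> ('x \<Rightarrow> 'e::banach) \<Rightarrow> (real \<Rightarrow> 'e \<Rightarrow>\<^sub>L 'e) \<Rightarrow>
   ('u::banach \<Rightarrow>\<^sub>L 'e) \<Rightarrow> ('e \<Rightarrow> 'y::banach) \<Rightarrow> bool" where
  "bounded_linear_on_Z A \<mu> J T\<^sub>e B \<Gamma> \<longleftrightarrow>
     (\<forall>z\<in>Z_space A \<mu> J T\<^sub>e B. \<forall>w\<in>Z_space A \<mu> J T\<^sub>e B. \<Gamma> (z + w) = \<Gamma> z + \<Gamma> w) \<and>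
     (\<forall>c. \<forall>z\<in>Z_space A \<mu> J T\<^sub>e B. \<Gamma> (c *\<^sub>R z) = c *\<^sub>R \<Gamma> z) \<and>
     (\<exists>K. \<forall>z\<in>Z_space A \<mu> J T\<^sub>e B. norm (\<Gamma> z) \<le> K * Z_norm A \<mu> J T\<^sub>e B z)"

text \<open>The restriction of \<open>\<Gamma>\<close> to \<open>D(A)\<close>; only its values on \<open>Domain A\<close> matter.\<close>

definition observation_operator :: "('x \<Rightarrow> 'e) \<Rightarrow> ('e \<Rightarrow> 'y) \<Rightarrow> 'x \<Rightarrow> 'y" where
  "observation_operator J \<Gamma> x = \<Gamma> (J x)"

text \<open>\<open>(\<F>u)(t) = \<Gamma> \<Phi>\<^sub>t u + D\<^sub>\<Sigma> u(t)\<close>, meaningful for inputs in \<open>W1p_0\<close>.\<close>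

definition input_output_formula ::
  "(real \<Rightarrow> 'e::banach \<Rightarrow>\<^sub>L 'e) \<Rightarrow> ('u::banach \<Rightarrow>\<^sub>L 'e) \<Rightarrow> ('e \<Rightarrow> 'y::banach) \<Rightarrow> ('u \<Rightarrow>\<^sub>L 'y) \<Rightarrow>
   (real \<Rightarrow> 'u) \<Rightarrow> real \<Rightarrow> 'y" where
  "input_output_formula T\<^sub>e B \<Gamma> D\<^sub>\<Sigma> u t = \<Gamma> (input_map T\<^sub>e B t u) + D\<^sub>\<Sigma> (u t)"

definition well_posed ::
  "real \<Rightarrow> ('x::banach \<times> 'x) set \<Rightarrow> (real \<Rightarrow> 'x \<Rightarrow>\<^sub>L 'x) \<Rightarrow> ('x \<Rightarrow> 'e::banach) \<Rightarrow>
   (real \<Rightarrow> 'e \<Rightarrow>\<^sub>L 'e) \<Rightarrow> ('u::banach \<Rightarrow>\<^sub>L 'e) \<Rightarrow> ('e \<Rightarrow> 'y::banach) \<Rightarrow> ('u \<Rightarrow>\<^sub>L 'y) \<Rightarrow> bool" where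
  "well_posed p A T J T\<^sub>e B \<Gamma> D\<^sub>\<Sigma> \<longleftrightarrow>
     control_admissible p J T\<^sub>e B \<and>
     observation_admissible p A T (observation_operator J \<Gamma>) \<and>
     (\<forall>\<tau>>0. \<exists>\<beta>>0. \<forall>u\<in>W1p_0 p \<tau>.
        input_output_formula T\<^sub>e B \<Gamma> D\<^sub>\<Sigma> u \<in> Lp p {0..\<tau>} \<and>
        Lp_norm p {0..\<tau>} (input_output_formula T\<^sub>e B \<Gamma> D\<^sub>\<Sigma> u) \<le> \<beta> * Lp_norm p {0..\<tau>} u)"

text \<open>The continuous extensions defining the extended output map \<open>\<Psi>\<close> and the input-output map
  \<open>\<F>\<close>. Both values are determined up to null sets. The topology of \<open>L\<^sup>p\<close>-loc is metrizable,
  so continuity is stated with sequences.\<close>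

definition is_output_map ::
  "real \<Rightarrow> ('x::banach \<times> 'x) set \<Rightarrow> (real \<Rightarrow> 'x \<Rightarrow>\<^sub>L 'x) \<Rightarrow> ('x \<Rightarrow> 'y::banach) \<Rightarrow>
   ('x \<Rightarrow> real \<Rightarrow> 'y) \<Rightarrow> bool" where
  "is_output_map p A T C \<Psi> \<longleftrightarrow>
     (\<forall>x. \<Psi> x \<in> Lp_loc p) \<and>
     (\<forall>x\<in>Domain A. AE t in lebesgue_on {0..}. \<Psi> x t = C (T t x)) \<and>
     (\<forall>\<xi> x. \<xi> \<longlonglongrightarrow> x \<longrightarrow> Lp_loc_tendsto p (\<lambda>n. \<Psi> (\<xi> n)) (\<Psi> x))"

definition is_input_output_map ::
  "real \<Rightarrow> (real \<Rightarrow> 'e::banach \<Rightarrow>\<^sub>L 'e) \<Rightarrow> ('u::banach \<Rightarrow>\<^sub>L 'e) \<Rightarrow> ('e \<Rightarrow> 'y::banach) \<Rightarrow>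
   ('u \<Rightarrow>\<^sub>L 'y) \<Rightarrow> ((real \<Rightarrow> 'u) \<Rightarrow> real \<Rightarrow> 'y) \<Rightarrow> bool" where
  "is_input_output_map p T\<^sub>e B \<Gamma> D\<^sub>\<Sigma> \<F> \<longleftrightarrow>
     (\<forall>u\<in>Lp_loc p. \<F> u \<in> Lp_loc p) \<and>
     (\<forall>u\<in>(\<Inter>\<tau>\<in>{0<..}. W1p_0 p \<tau>).
        AE t in lebesgue_on {0..}. \<F> u t = input_output_formula T\<^sub>e B \<Gamma> D\<^sub>\<Sigma> u t) \<and>
     (\<forall>v u. (\<forall>n. v n \<in> Lp_loc p) \<longrightarrow> u \<in> Lp_loc p \<longrightarrow> Lp_loc_tendsto p v u \<longrightarrow>
        Lp_loc_tendsto p (\<lambda>n. \<F> (v n)) (\<F> u))"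

text \<open>\<open>\<H>(\<mu>) = \<Gamma> R(\<mu>,A\<^sub>-\<^sub>1) B + D\<^sub>\<Sigma>\<close>, on the real part of the resolvent set.\<close>

definition transfer_function ::
  "(real \<Rightarrow> 'e::banach \<Rightarrow>\<^sub>L 'e) \<Rightarrow> ('u::banach \<Rightarrow>\<^sub>L 'e) \<Rightarrow> ('e \<Rightarrow> 'y::banach) \<Rightarrow> ('u \<Rightarrow>\<^sub>L 'y) \<Rightarrow>
   real \<Rightarrow> 'u \<Rightarrow> 'y" where
  "transfer_function T\<^sub>e B \<Gamma> D\<^sub>\<Sigma> \<mu> u = \<Gamma> (resolvent (generator T\<^sub>e) \<mu> (B u)) + D\<^sub>\<Sigma> u"

definition strongly_regular ::
  "(real \<Rightarrow> 'e::banach \<Rightarrow>\<^sub>L 'e) \<Rightarrow> ('u::banach \<Rightarrow>\<^sub>L 'e) \<Rightarrow> ('e \<Rightarrow> 'y::banach) \<Rightarrow> ('u \<Rightarrow>\<^sub>L 'y) \<Rightarrow> bool"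
  where
  "strongly_regular T\<^sub>e B \<Gamma> D\<^sub>\<Sigma> \<longleftrightarrow>
     (\<forall>u. \<exists>l. ((\<lambda>\<mu>. transfer_function T\<^sub>e B \<Gamma> D\<^sub>\<Sigma> \<mu> u) \<longlongrightarrow> l) at_top)"

definition feedthrough ::
  "(real \<Rightarrow> 'e::banach \<Rightarrow>\<^sub>L 'e) \<Rightarrow> ('u::banach \<Rightarrow>\<^sub>L 'e) \<Rightarrow> ('e \<Rightarrow> 'y::banach) \<Rightarrow> ('u \<Rightarrow>\<^sub>L 'y) \<Rightarrow>
   'u \<Rightarrow> 'y" where
  "feedthrough T\<^sub>e B \<Gamma> D\<^sub>\<Sigma> u = Lim at_top (\<lambda>\<mu>. transfer_function T\<^sub>e B \<Gamma> D\<^sub>\<Sigma> \<mu> u)"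

section \<open>Positivity\<close>

definition positive_semigroup :: "(real \<Rightarrow> 'x::banach_lattice \<Rightarrow>\<^sub>L 'x) \<Rightarrow> bool" where
  "positive_semigroup T \<longleftrightarrow> (\<forall>t\<ge>0. \<forall>x\<ge>0. 0 \<le> T t x)"

definition positive_control ::
  "('x::banach_lattice \<Rightarrow> 'e::banach) \<Rightarrow> ('u::banach_lattice \<Rightarrow>\<^sub>L 'e) \<Rightarrow> bool" where
  "positive_control J B \<longleftrightarrow> (\<forall>u\<ge>0. B u \<in> extrapolation_cone J)"

definition positive_observation ::
  "('x::banach_lattice \<times> 'x) set \<Rightarrow> ('x \<Rightarrow> 'y::banach_lattice) \<Rightarrow> bool" where
  "positive_observation A C \<longleftrightarrow> (\<forall>x\<in>Domain A. 0 \<le> x \<longrightarrow> 0 \<le> C x)"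

definition positive_input_output ::
  "real \<Rightarrow> ((real \<Rightarrow> 'u::banach_lattice) \<Rightarrow> real \<Rightarrow> 'y::banach_lattice) \<Rightarrow> bool" where
  "positive_input_output p \<F> \<longleftrightarrow> (\<forall>u\<in>Lp_loc p. ae_nonneg u \<longrightarrow> ae_nonneg (\<F> u))"

definition positive_feedthrough :: "('u::banach_lattice \<Rightarrow> 'y::banach_lattice) \<Rightarrow> bool" where
  "positive_feedthrough D \<longleftrightarrow> (\<forall>u\<ge>0. 0 \<le> D u)"

text \<open>The state \<open>T(t)x + \<Phi>\<^sub>t u\<close> is formed in the extrapolation space.\<close>

definition internally_positive ::
  "real \<Rightarrow> (real \<Rightarrow> 'x::banach_lattice \<Rightarrow>\<^sub>L 'x) \<Rightarrow> ('x \<Rightarrow> 'e::banach) \<Rightarrow> (real \<Rightarrow> 'e \<Rightarrow>\<^sub>L 'e) \<Rightarrow>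
   ('u::banach_lattice \<Rightarrow>\<^sub>L 'e) \<Rightarrow> ('x \<Rightarrow> real \<Rightarrow> 'y::banach_lattice) \<Rightarrow>
   ((real \<Rightarrow> 'u) \<Rightarrow> real \<Rightarrow> 'y) \<Rightarrow> bool" where
  "internally_positive p T J T\<^sub>e B \<Psi> \<F> \<longleftrightarrow>
     (\<forall>x\<ge>0. \<forall>u\<in>Lp_loc p. ae_nonneg u \<longrightarrow>
        (\<forall>t\<ge>0. J (T t x) + input_map T\<^sub>e B t u \<in> J ` {z. 0 \<le> z}) \<and>
        ae_nonneg (\<lambda>t. \<Psi> x t + \<F> u t))"

end

theory Submission
  imports Defs
begin

text \<open>
  Internal positivity is a statement on the pairs consisting of an initial state and an input. Taking
  one of the two to be zero splits it into four separate statements: \<open>T(t) x \<ge> 0\<close>, \<open>\<Psi> x \<ge> 0\<close>,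
  \<open>\<Phi>\<^sub>t u \<ge> 0\<close> and \<open>\<F> u \<ge> 0\<close>. The second is equivalent to positivity of \<open>C\<close> once \<open>T\<close> is positive: \<open>\<Psi>\<close> is
  the continuous extension of \<open>C T(\<cdot>) x\<close>, and \<open>C T(t) x \<longrightarrow> C x\<close> as \<open>t \<longrightarrow> 0\<close> on the domain
  (\<open>output_map_nonneg\<close>, \<open>observation_nonneg\<close>). The third is likewise equivalent to positivity of \<open>B\<close>. In one
  direction \<open>\<Phi>\<^sub>t u / t \<longrightarrow> B u\<close> for a constant input (\<open>control_nonneg\<close>). In the other direction \<open>\<Phi>\<^sub>t u\<close>
  is an integral in the closed convex cone \<open>X\<^sub>-\<^sub>1\<^sub>,\<^sub>+\<close>, it lies in \<open>X\<close> by admissibility, and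
  \<open>X\<^sub>-\<^sub>1\<^sub>,\<^sub>+ \<inter> X = X\<^sub>+\<close> (\<open>extrapolation_cone_Int_state_space\<close>). The last fact holds because the integral of an orbit
  over \<open>[0, h]\<close> is bounded from the norm of \<open>X\<^sub>-\<^sub>1\<close> to that of \<open>X\<close>.

  For a regular system, positivity of \<open>\<F>\<close> can be traded for that of \<open>D\<close>. On finite sums \<open>v\<close> of
  inputs \<open>\<phi> a\<close> with \<open>\<phi>\<close> continuously differentiable and \<open>\<phi>(0) = 0\<close> the state lies in \<open>Z\<close>, and comparing the decomposition of the state in
  \<open>Z\<close> (\<open>input_map_smooth\<close>) with the limit of \<open>C \<nu> R(\<nu>, A)\<close> on \<open>Z\<close> (\<open>yosida_limit\<close>) gives
  \<open>(\<F> v)(t) = lim C \<nu> R(\<nu>, A) \<Phi>\<^sub>t v + D v(t)\<close> as \<open>\<nu> \<longrightarrow> \<infinity>\<close>. Both terms are positive if \<open>T\<close>, \<open>B\<close>, \<open>C\<close>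
  and \<open>D\<close> are, and such inputs are dense among the positive ones
  (\<open>smooth_positive_inputs_dense\<close>). Conversely the response to \<open>(exp (\<nu> s) - 1) u\<close> is
  \<open>(exp (\<nu> t) - 1) H(\<nu>) u\<close> up to a term of order \<open>\<nu>\<close>, so at a fixed time \<open>t\<close> the normalized responses have
  the same limit \<open>D u\<close> as \<open>H(\<nu>) u\<close> (\<open>feedthrough_nonneg\<close>).

  The extrapolation space is handled through the isometry \<open>S\<close> of \<open>X\<^sub>-\<^sub>1\<close> into \<open>X\<close> that extends \<open>R(\<mu>, A)\<close>:
  it carries \<open>T\<^sub>-\<^sub>1\<close> to \<open>T\<close>, and \<open>J \<circ> S\<close> is the resolvent of \<open>A\<^sub>-\<^sub>1\<close> at \<open>\<mu>\<close>.\<close>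

section \<open>Strongly continuous semigroups\<close>

text \<open>The Banach-Steinhaus theorem for a sequence: by Baire's theorem one of the closed sets
  \<open>F k\<close> contains a ball, and differences of its points fill a ball around \<open>0\<close>.\<close>

lemma uniform_boundedness:
  fixes T :: "nat \<Rightarrow> 'a::banach \<Rightarrow>\<^sub>L 'b::real_normed_vector"
  assumes "\<And>x. \<exists>K. \<forall>n. norm (T n x) \<le> K"
  shows "\<exists>M. \<forall>n. norm (T n) \<le> M"
proof -
  define F where "F k = {x. \<forall>n. norm (T n x) \<le> real k}" for k :: nat
  have closed: "closed (F k)" for k
  proof -
    have "F k = (\<Inter>n. {x. norm (T n x) \<le> real k})" by (auto simp: F_def)
    moreover have "closed {x. norm (T n x) \<le> real k}" for n
      by (intro closed_Collect_le continuous_intros)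
    ultimately show ?thesis by auto
  qed
  have cover: "(\<Union>k. F k) = UNIV"
  proof -
    have "\<exists>k. x \<in> F k" for x
    proof -
      obtain K where K: "\<And>n. norm (T n x) \<le> K" using assms by blast
      obtain k :: nat where "K \<le> real k" using real_arch_simple by blast
      then have "x \<in> F k" unfolding F_def using K order_trans by blast
      then show ?thesis ..
    qed
    then show ?thesis by auto
  qed
  have "\<exists>k. interior (F k) \<noteq> {}"
  proof (rule ccontr)
    assume "\<not> ?thesis"
    then have "euclidean interior_of \<Union>(range F) = {}"
      using closed by (intro Baire_category_alt disjI1 completely_metrizable_space_euclidean) auto
    then show False using cover by simp
  qed
  then obtain k x0 where "x0 \<in> interior (F k)" by auto
  then obtain e where e: "e > 0" "cball x0 e \<subseteq> F k" by (meson mem_interior_cball)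
  have "norm (T n) \<le> 2 * real k / e" for n
  proof (rule norm_blinfun_bound)
    show "0 \<le> 2 * real k / e" using e by simp
    fix x
    show "norm (T n x) \<le> 2 * real k / e * norm x"
    proof (cases "x = 0")
      case False
      define c where "c = e / norm x"
      have c: "c > 0" "norm (c *\<^sub>R x) = e" using False e by (auto simp: c_def)
      have "x0 \<in> F k" "x0 + c *\<^sub>R x \<in> F k" using e c by (auto simp: subset_iff dist_norm)
      then have "norm (T n x0) \<le> k" "norm (T n (x0 + c *\<^sub>R x)) \<le> k" unfolding F_def by auto
      moreover have "c *\<^sub>R T n x = T n (x0 + c *\<^sub>R x) - T n x0"
        by (simp add: blinfun.add_right blinfun.scaleR_right)
      ultimately have "norm (c *\<^sub>R T n x) \<le> 2 * real k"
        using norm_triangle_ineq4[of "T n (x0 + c *\<^sub>R x)" "T n x0"] by simp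
      then show ?thesis using c e False by (simp add: c_def field_simps)
    qed simp
  qed
  then show ?thesis by blast
qed

lemma average_tendsto:
  fixes f :: "real \<Rightarrow> 'a::banach"
  assumes "continuous_on {a..} f"
  shows "((\<lambda>h. integral {a..a + h} f /\<^sub>R h) \<longlongrightarrow> f a) (at_right 0)"
proof (rule tendstoI)
  fix e :: real assume e: "e > 0"
  obtain d where d: "d > 0" "\<And>s. s \<in> {a..} \<Longrightarrow> dist s a < d \<Longrightarrow> dist (f s) (f a) < e / 2"
    using assms e unfolding continuous_on_iff by (metis atLeast_iff half_gt_zero order_refl)
  have "dist (integral {a..a + h} f /\<^sub>R h) (f a) < e" if h: "h > 0" "h < d" for h
  proof -
    have i: "f integrable_on {a..a + h}"
      by (rule integrable_continuous_real) (rule continuous_on_subset[OF assms], auto)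
    have "integral {a..a + h} f - h *\<^sub>R f a = integral {a..a + h} (\<lambda>s. f s - f a)"
      using h i by (subst integral_diff) auto
    moreover have "norm \<dots> \<le> e / 2 * (a + h - a)"
    proof (rule integral_bound)
      show "continuous_on {a..a + h} (\<lambda>s. f s - f a)"
        by (intro continuous_intros continuous_on_subset[OF assms]) auto
      show "norm (f s - f a) \<le> e / 2" if "s \<in> {a..a + h}" for s
        using d(2)[of s] that h by (auto simp: dist_norm less_imp_le)
    qed (use h in auto)
    ultimately have 1: "norm (integral {a..a + h} f - h *\<^sub>R f a) \<le> e / 2 * h" by simp
    have "integral {a..a + h} f /\<^sub>R h - f a = (integral {a..a + h} f - h *\<^sub>R f a) /\<^sub>R h"
      using h by (simp add: scaleR_diff_right)
    then have "norm (integral {a..a + h} f /\<^sub>R h - f a) \<le> (e / 2 * h) / h"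
      using 1 h by (simp add: divide_simps mult.commute)
    then show ?thesis using h e by (simp add: dist_norm)
  qed
  then show "\<forall>\<^sub>F h in at_right 0. dist (integral {a..a + h} f /\<^sub>R h) (f a) < e"
    unfolding eventually_at_right_field using d by blast
qed

locale c0 =
  fixes T :: "real \<Rightarrow> 'a::banach \<Rightarrow>\<^sub>L 'a"
  assumes c0: "c0_semigroup T"
begin

abbreviation A where "A \<equiv> generator T"

lemma T_0 [simp]: "T 0 x = x"
  using c0 by (simp add: c0_semigroup_def)

lemma T_add: "s \<ge> 0 \<Longrightarrow> t \<ge> 0 \<Longrightarrow> T (s + t) x = T s (T t x)"
  using c0 by (simp add: c0_semigroup_def)

lemma T_commute: "s \<ge> 0 \<Longrightarrow> t \<ge> 0 \<Longrightarrow> T s (T t x) = T t (T s x)"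
  by (metis T_add add.commute)

lemma T_tendsto_0: "((\<lambda>t. T t x) \<longlongrightarrow> x) (at_right 0)"
  using c0 by (simp add: c0_semigroup_def)

text \<open>Otherwise some \<open>t n \<longrightarrow> 0\<close> has \<open>norm (T (t n))\<close> unbounded although every
  \<open>T (t n) x\<close> converges, against uniform boundedness.\<close>

lemma bounded_near_0: "\<exists>\<delta>>0. \<exists>M. \<forall>t\<in>{0..\<delta>}. norm (T t) \<le> M"
proof (rule ccontr)
  assume "\<not> ?thesis"
  then have *: "\<exists>t\<in>{0..\<delta>}. norm (T t) > M" if "\<delta> > 0" for \<delta> M
    using that by (metis linorder_not_less)
  have "\<forall>n::nat. \<exists>t. t \<in> {0..1 / (real n + 1)} \<and> norm (T t) > norm (T 0) + real n"
  proof
    fix n :: nat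
    show "\<exists>t. t \<in> {0..1 / (real n + 1)} \<and> norm (T t) > norm (T 0) + real n"
      using *[of "1 / (real n + 1)" "norm (T 0) + real n"] by (auto simp: Bex_def)
  qed
  from choice[OF this] obtain t where t: "\<And>n::nat. t n \<in> {0..1 / (real n + 1)}"
    and big: "\<And>n::nat. norm (T (t n)) > norm (T 0) + real n" by blast
  have pos: "t n > 0" for n
    using t[of n] big[of n] by (cases "t n = 0") auto
  have "t \<longlonglongrightarrow> 0"
  proof (rule tendsto_sandwich[of "\<lambda>_. 0" _ _ "\<lambda>n. 1 / (real n + 1)"])
    show "(\<lambda>n. 1 / (real n + 1)) \<longlonglongrightarrow> 0"
      using LIMSEQ_inverse_real_of_nat by (simp add: inverse_eq_divide add.commute)
  qed (use t in auto)
  then have t0: "filterlim t (at_right 0) sequentially"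
    using pos by (auto simp: filterlim_at less_imp_neq[THEN not_sym] intro!: always_eventually)
  have "\<exists>K. \<forall>n. norm (T (t n) x) \<le> K" for x
  proof -
    have "(\<lambda>n. T (t n) x) \<longlonglongrightarrow> x" by (rule filterlim_compose[OF T_tendsto_0 t0])
    then have "Bseq (\<lambda>n. T (t n) x)" by (intro convergent_imp_Bseq convergentI)
    then show ?thesis by (auto simp: Bseq_def)
  qed
  from uniform_boundedness[OF this] obtain M where M: "\<And>n. norm (T (t n)) \<le> M" by blast
  obtain n :: nat where "M < real n" using reals_Archimedean2 by blast
  then show False using M[of n] big[of n] norm_ge_zero[of "T 0"] by linarith
qed

lemma bounded_on_compact: "\<exists>M\<ge>1. \<forall>t\<in>{0..\<tau>}. norm (T t) \<le> M"
proof -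
  obtain \<delta> M where d: "\<delta> > 0" and M: "\<And>t. t \<in> {0..\<delta>} \<Longrightarrow> norm (T t) \<le> M"
    using bounded_near_0 by blast
  define M' where "M' = max M 1"
  have step: "norm (T t) \<le> M' ^ Suc n" if "t \<in> {0..real (Suc n) * \<delta>}" for n t
    using that
  proof (induction n arbitrary: t)
    case 0
    then show ?case using M[of t] by (auto simp: M'_def)
  next
    case (Suc n)
    have M'1: "M' \<ge> 1" by (simp add: M'_def)
    show ?case
    proof (cases "t \<le> \<delta>")
      case True
      then have "norm (T t) \<le> M'" using M[of t] Suc.prems by (auto simp: M'_def)
      also have "\<dots> = M' ^ 1" by simp
      also have "\<dots> \<le> M' ^ Suc (Suc n)" by (rule power_increasing) (use M'1 in auto)
      finally show ?thesis .
    next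
      case False
      then have "T t = T \<delta> o\<^sub>L T (t - \<delta>)"
        using T_add[of \<delta> "t - \<delta>"] d by (intro blinfun_eqI) auto
      then have "norm (T t) \<le> norm (T \<delta>) * norm (T (t - \<delta>))"
        by (simp add: norm_blinfun_compose)
      also have "\<dots> \<le> M' * M' ^ Suc n"
      proof (rule mult_mono)
        show "norm (T \<delta>) \<le> M'" using M[of \<delta>] d by (auto simp: M'_def)
        show "norm (T (t - \<delta>)) \<le> M' ^ Suc n"
          by (rule Suc.IH) (use False Suc.prems in \<open>auto simp: algebra_simps\<close>)
      qed (use M'1 in auto)
      finally show ?thesis by simp
    qed
  qed
  obtain n :: nat where "\<tau> / \<delta> < real n" using reals_Archimedean2 by blast
  then have "\<tau> \<le> real (Suc n) * \<delta>" using d by (simp add: field_simps)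
  then have "\<forall>t\<in>{0..\<tau>}. norm (T t) \<le> M' ^ Suc n" using step by auto
  moreover have "M' ^ Suc n \<ge> 1" by (rule one_le_power) (simp add: M'_def)
  ultimately show ?thesis by blast
qed

text \<open>Right continuity at \<open>0\<close> is transported by \<open>T s\<close>. The smaller of the two
  times is taken out as a factor, so that limits from the left are covered by the same estimate.\<close>

lemma continuous_orbit: "continuous_on {0..} (\<lambda>t. T t x)"
proof -
  have "continuous (at t within {0..}) (\<lambda>t. T t x)" if t: "t \<ge> 0" for t
    unfolding continuous_within_eps_delta
  proof (intro allI impI)
    fix e :: real assume e: "e > 0"
    obtain M where M: "M \<ge> 1" "\<And>s. s \<in> {0..t + 1} \<Longrightarrow> norm (T s) \<le> M"
      using bounded_on_compact by blast
    have "\<forall>\<^sub>F h in at_right 0. dist (T h x) x < e / M"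
      using tendstoD[OF T_tendsto_0] e M by simp
    then obtain d where d: "d > 0" "\<And>h. 0 < h \<Longrightarrow> h < d \<Longrightarrow> norm (T h x - x) < e / M"
      unfolding eventually_at_right_field dist_norm by blast
    have main: "norm (T (s + h) x - T s x) < e" if "s \<in> {0..t + 1}" "0 \<le> h" "h < d" for s h
    proof (cases "h = 0")
      case False
      have "T (s + h) x - T s x = T s (T h x - x)"
        using that by (simp add: T_add blinfun.diff_right)
      then have "norm (T (s + h) x - T s x) \<le> norm (T s) * norm (T h x - x)"
        by (simp add: norm_blinfun)
      also have "\<dots> \<le> M * norm (T h x - x)" using M(2)[OF that(1)] by (simp add: mult_right_mono)
      also have "\<dots> < M * (e / M)"
        using d(2)[of h] that False M by (intro mult_strict_left_mono) auto
      finally show ?thesis using M by simp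
    qed (use e in simp)
    have "dist (T s x) (T t x) < e" if "s \<ge> 0" "dist s t < min d 1" for s
    proof (cases "s \<ge> t")
      case True
      then show ?thesis using main[of t "s - t"] that t by (simp add: dist_norm)
    next
      case False
      then show ?thesis using main[of s "t - s"] that t
        by (simp add: dist_norm norm_minus_commute)
    qed
    then show "\<exists>d>0. \<forall>s\<in>{0..}. dist s t < d \<longrightarrow> dist (T s x) (T t x) < e"
      using d by (intro exI[of _ "min d 1"]) auto
  qed
  then show ?thesis by (simp add: continuous_on_eq_continuous_within)
qed

lemma integrable_orbit: "0 \<le> a \<Longrightarrow> (\<lambda>s. T s x) integrable_on {a..b}"
  by (intro integrable_continuous_real continuous_on_subset[OF continuous_orbit]) auto

definition Q :: "real \<Rightarrow> 'a \<Rightarrow> 'a" where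
  "Q t x = integral {0..t} (\<lambda>s. T s x)"

lemma bounded_linear_Q: "bounded_linear (Q t)"
proof -
  obtain M where M: "M \<ge> 1" "\<And>s. s \<in> {0..t} \<Longrightarrow> norm (T s) \<le> M"
    using bounded_on_compact by blast
  show ?thesis
  proof (rule bounded_linear_intro[where K = "M * \<bar>t\<bar>"])
    show "Q t (x + y) = Q t x + Q t y" for x y
      by (simp add: Q_def blinfun.add_right integral_add integrable_orbit)
    show "Q t (r *\<^sub>R x) = r *\<^sub>R Q t x" for r x
      by (simp add: Q_def blinfun.scaleR_right)
    show "norm (Q t x) \<le> norm x * (M * \<bar>t\<bar>)" for x
    proof (cases "t \<ge> 0")
      case True
      have "norm (Q t x) \<le> (M * norm x) * (t - 0)"
        unfolding Q_def
      proof (rule integral_bound[OF True])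
        show "continuous_on {0..t} (\<lambda>s. T s x)"
          by (rule continuous_on_subset[OF continuous_orbit]) auto
        show "norm (T s x) \<le> M * norm x" if "s \<in> {0..t}" for s
          using norm_blinfun[of "T s" x] M(2)[OF that] by (meson mult_right_mono norm_ge_zero order_trans)
      qed
      then show ?thesis using True by (simp add: algebra_simps)
    next
      case False
      then show ?thesis using M by (simp add: Q_def mult_nonneg_nonpos)
    qed
  qed
qed

lemma T_Q: "T h (Q t x) = integral {0..t} (\<lambda>s. T h (T s x))"
  unfolding Q_def
  by (subst integral_linear[symmetric]) (auto simp: integrable_orbit blinfun.bounded_linear_right comp_def)

lemma T_Q_commute: "h \<ge> 0 \<Longrightarrow> T h (Q t x) = Q t (T h x)"
  unfolding T_Q unfolding Q_def by (intro integral_cong) (auto simp: T_commute)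

lemma T_Q_shift:
  assumes "h \<ge> 0" shows "T h (Q t x) = integral {h..h + t} (\<lambda>s. T s x)"
proof -
  have "T h (Q t x) = integral {0..t} ((\<lambda>s. T s x) \<circ> (+) h)"
    unfolding T_Q using assms by (intro integral_cong) (auto simp: T_add)
  also have "\<dots> = integral {h..h + t} (\<lambda>s. T s x)"
    by (simp add: integral_shift_Icc_real add.commute)
  finally show ?thesis .
qed

lemma Q_tendsto: "((\<lambda>h. Q h x /\<^sub>R h) \<longlongrightarrow> x) (at_right 0)"
  using average_tendsto[OF continuous_orbit, of x] by (simp add: Q_def)

text \<open>The difference quotient of \<open>Q t x\<close> telescopes to the averages of the orbit over
  \<open>[t, t + h]\<close> and over \<open>[0, h]\<close>.\<close>

lemma generator_Q:
  assumes "t \<ge> 0" shows "(Q t x, T t x - x) \<in> A"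
proof -
  have "(T h (Q t x) - Q t x) /\<^sub>R h = integral {t..t + h} (\<lambda>s. T s x) /\<^sub>R h - Q h x /\<^sub>R h"
    if "h > 0" for h
  proof -
    have "Q t x + integral {t..t + h} (\<lambda>s. T s x) = Q h x + T h (Q t x)"
      unfolding T_Q_shift[OF less_imp_le[OF that]] unfolding Q_def
      using Henstock_Kurzweil_Integration.integral_combine[OF assms _ integrable_orbit, of "t + h" x]
        Henstock_Kurzweil_Integration.integral_combine[OF less_imp_le[OF that] _ integrable_orbit, of "h + t" x] assms that
      by (simp add: add.commute)
    then have "T h (Q t x) - Q t x = integral {t..t + h} (\<lambda>s. T s x) - Q h x"
      by (simp add: algebra_simps)
    then show ?thesis by (simp add: scaleR_diff_right)
  qed
  then have ev: "\<forall>\<^sub>F h in at_right 0. integral {t..t + h} (\<lambda>s. T s x) /\<^sub>R h - Q h x /\<^sub>R h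
      = (T h (Q t x) - Q t x) /\<^sub>R h"
    by (auto simp: eventually_at_right_field intro!: exI[of _ 1])
  have "((\<lambda>h. integral {t..t + h} (\<lambda>s. T s x) /\<^sub>R h - Q h x /\<^sub>R h) \<longlongrightarrow> T t x - x) (at_right 0)"
    by (intro tendsto_diff Q_tendsto average_tendsto continuous_on_subset[OF continuous_orbit])
      (use assms in auto)
  then show ?thesis unfolding generator_def using Lim_transform_eventually[OF _ ev] by simp
qed

text \<open>The bounded operator \<open>Q t\<close> commutes with the semigroup and hence with difference
  quotients; this replaces a differentiation under the integral sign.\<close>

lemma Q_generator:
  assumes "(x, y) \<in> A" "t \<ge> 0" shows "Q t y = T t x - x"
proof -
  have "((\<lambda>h. Q t ((T h x - x) /\<^sub>R h)) \<longlongrightarrow> Q t y) (at_right 0)"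
    using assms(1) by (intro bounded_linear.tendsto[OF bounded_linear_Q]) (simp add: generator_def)
  moreover have "\<forall>\<^sub>F h in at_right 0. Q t ((T h x - x) /\<^sub>R h) = (T h (Q t x) - Q t x) /\<^sub>R h"
    by (auto simp: eventually_at_right_field T_Q_commute linear_diff linear_scale
        bounded_linear.linear[OF bounded_linear_Q] intro!: exI[of _ 1])
  ultimately have "((\<lambda>h. (T h (Q t x) - Q t x) /\<^sub>R h) \<longlongrightarrow> Q t y) (at_right 0)"
    by (rule Lim_transform_eventually)
  moreover have "((\<lambda>h. (T h (Q t x) - Q t x) /\<^sub>R h) \<longlongrightarrow> T t x - x) (at_right 0)"
    using generator_Q[OF assms(2), of x] by (simp add: generator_def)
  ultimately show ?thesis by (rule tendsto_unique[rotated]) simp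
qed

lemma generator_T:
  assumes "(x, y) \<in> A" "t \<ge> 0" shows "(T t x, T t y) \<in> A"
proof -
  have "((\<lambda>h. T t ((T h x - x) /\<^sub>R h)) \<longlongrightarrow> T t y) (at_right 0)"
    using assms(1) by (intro tendsto_intros) (simp add: generator_def)
  moreover have "\<forall>\<^sub>F h in at_right 0. T t ((T h x - x) /\<^sub>R h) = (T h (T t x) - T t x) /\<^sub>R h"
    using assms(2) by (auto simp: eventually_at_right_field T_commute blinfun.diff_right
        blinfun.scaleR_right intro!: exI[of _ 1])
  ultimately show ?thesis
    unfolding generator_def by (auto intro: Lim_transform_eventually)
qed

text \<open>The identity \<open>Q t (y n) = T t (x n) - x n\<close> survives the limit, and dividing it by
  \<open>t\<close> gives back the generator.\<close>

lemma generator_closed: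
  assumes "\<And>n. (x n, y n) \<in> A" "x \<longlonglongrightarrow> a" "y \<longlonglongrightarrow> b"
  shows "(a, b) \<in> A"
proof -
  have "Q t b = T t a - a" if "t \<ge> 0" for t
  proof (rule LIMSEQ_unique)
    show "(\<lambda>n. Q t (y n)) \<longlonglongrightarrow> Q t b"
      by (rule bounded_linear.tendsto[OF bounded_linear_Q assms(3)])
    show "(\<lambda>n. Q t (y n)) \<longlonglongrightarrow> T t a - a"
      using Q_generator[OF assms(1) that] assms(2) by (auto intro!: tendsto_intros)
  qed
  then have "\<forall>\<^sub>F h in at_right 0. Q h b /\<^sub>R h = (T h a - a) /\<^sub>R h"
    by (auto simp: eventually_at_right_field intro!: exI[of _ 1])
  then show ?thesis
    unfolding generator_def using Lim_transform_eventually[OF Q_tendsto] by simp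
qed

lemma generator_add:
  assumes "(x, y) \<in> A" "(x', y') \<in> A"
  shows "(x + x', y + y') \<in> A"
  using tendsto_add[of "\<lambda>h. (T h x - x) /\<^sub>R h" y _ "\<lambda>h. (T h x' - x') /\<^sub>R h" y'] assms
  by (simp add: generator_def blinfun.add_right algebra_simps)

lemma generator_scaleR:
  assumes "(x, y) \<in> A" shows "(c *\<^sub>R x, c *\<^sub>R y) \<in> A"
  using tendsto_scaleR[OF tendsto_const[of c], of "\<lambda>h. (T h x - x) /\<^sub>R h" y "at_right 0"] assms
  by (simp add: generator_def blinfun.scaleR_right algebra_simps)

lemma generator_unique: "(x, y) \<in> A \<Longrightarrow> (x, z) \<in> A \<Longrightarrow> y = z"
  unfolding generator_def using tendsto_unique[of "at_right (0::real)"] by fastforce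

end

section \<open>Integrals with values in a cone\<close>

lemma convex_cone_sum:
  assumes "convex_cone K" "\<And>i. i \<in> I \<Longrightarrow> f i \<in> K" shows "sum f I \<in> K"
  using assms(2)
  by (induction I rule: infinite_finite_induct)
    (auto intro: convex_cone_add[OF assms(1)] convex_cone_contains_0[OF assms(1)])

text \<open>Riemann sums of \<open>f\<close> lie in the cone. Changing \<open>f\<close> to \<open>0\<close> on the null
  set makes this true for all tags.\<close>

lemma integral_in_closed_cone:
  fixes f :: "real \<Rightarrow> 'a::banach"
  assumes K: "closed K" "convex_cone K" and f: "(f has_integral I) {a..b}"
    and N: "negligible N" "\<And>s. s \<in> {a..b} - N \<Longrightarrow> f s \<in> K"
  shows "I \<in> K"
proof -
  define g where "g s = (if s \<in> {a..b} - N then f s else 0)" for s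
  have g: "(g has_integral I) {a..b}"
    by (rule has_integral_spike[OF N(1) _ f]) (auto simp: g_def)
  have gK: "g s \<in> K" for s
    using N(2) K(2) by (auto simp: g_def convex_cone_contains_0)
  have "\<exists>J\<in>K. dist J I < e" if e: "e > 0" for e
  proof -
    obtain \<gamma> where \<gamma>: "gauge \<gamma>" "\<And>D. D tagged_division_of {a..b} \<Longrightarrow> \<gamma> fine D \<Longrightarrow>
        norm ((\<Sum>(x, k)\<in>D. measure lborel k *\<^sub>R g x) - I) < e"
      using g[unfolded has_integral_real, rule_format, OF e] by auto
    obtain D where D: "D tagged_division_of {a..b}" "\<gamma> fine D"
      using fine_division_exists_real[OF \<gamma>(1)] .
    have "(\<Sum>(x, k)\<in>D. measure lborel k *\<^sub>R g x) \<in> K"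
    proof (rule convex_cone_sum[OF K(2)])
      show "(case i of (x, k) \<Rightarrow> measure lborel k *\<^sub>R g x) \<in> K" if "i \<in> D" for i
        by (simp add: split_beta convex_cone_scaleR[OF K(2)] gK)
    qed
    then show ?thesis using \<gamma>(2)[OF D] by (auto simp: dist_norm)
  qed
  then have "I \<in> closure K" by (auto simp: closure_approachable)
  then show ?thesis using K(1) by simp
qed

section \<open>Resolvents\<close>

lemma is_resolvent_unique:
  assumes "is_resolvent A \<nu> R" "is_resolvent A \<nu> R'" shows "R = R'"
proof (rule blinfun_eqI)
  fix x
  have "(R' x, \<nu> *\<^sub>R R' x - x) \<in> A" using assms(2) by (simp add: is_resolvent_def)
  then have "R (\<nu> *\<^sub>R R' x - (\<nu> *\<^sub>R R' x - x)) = R' x" using assms(1) by (auto simp: is_resolvent_def)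
  then show "R x = R' x" by simp
qed

lemma resolvent_eq: "is_resolvent A \<nu> R \<Longrightarrow> resolvent A \<nu> = R"
  unfolding resolvent_def by (blast intro: is_resolvent_unique)

lemma resolvent_in: "is_resolvent A \<nu> R \<Longrightarrow> (R x, \<nu> *\<^sub>R R x - x) \<in> A"
  by (simp add: is_resolvent_def)

lemma resolvent_left: "is_resolvent A \<nu> R \<Longrightarrow> (x, y) \<in> A \<Longrightarrow> R (\<nu> *\<^sub>R x - y) = x"
  by (auto simp: is_resolvent_def)

lemma resolvent_identity:
  assumes "is_resolvent A \<nu> R" "is_resolvent A \<mu> R'"
  shows "R x = R' (x + (\<mu> - \<nu>) *\<^sub>R R x)"
  using resolvent_left[OF assms(2) resolvent_in[OF assms(1)], of x] by (simp add: algebra_simps)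

lemma resolvent_commute:
  assumes "is_resolvent A \<nu> R" "is_resolvent A \<mu> R'"
  shows "R (R' x) = R' (R x)"
proof (cases "\<nu> = \<mu>")
  case True
  then show ?thesis using is_resolvent_unique assms by metis
next
  case False
  have diff: "S' x - S x = (b - a) *\<^sub>R S' (S x)"
    if "is_resolvent A b S" "is_resolvent A a S'" for a b S S'
  proof -
    have "S' x = S' (x + (a - b) *\<^sub>R S x) - (a - b) *\<^sub>R S' (S x)"
      by (simp add: blinfun.add_right blinfun.scaleR_right)
    then show ?thesis
      unfolding resolvent_identity[OF that, symmetric] by (simp add: scaleR_diff_left)
  qed
  have "R' x - R x = (\<nu> - \<mu>) *\<^sub>R R' (R x)" by (rule diff[OF assms])
  moreover have "R' x - R x = (\<nu> - \<mu>) *\<^sub>R R (R' x)"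
    using diff[OF assms(2,1)] by (metis minus_diff_eq scaleR_minus_left)
  ultimately have "(\<nu> - \<mu>) *\<^sub>R (R' (R x)) = (\<nu> - \<mu>) *\<^sub>R R (R' x)" by argo
  then show ?thesis using False by (metis right_minus_eq scaleR_cancel_left)
qed

lemma (in c0) T_resolvent:
  assumes "is_resolvent A \<nu> R" "t \<ge> 0"
  shows "T t (R x) = R (T t x)"
  using resolvent_left[OF assms(1) generator_T[OF resolvent_in[OF assms(1)] assms(2)], of x]
  by (simp add: blinfun.diff_right blinfun.scaleR_right)

lemma (in c0) resolvent_inj:
  assumes "is_resolvent A \<nu> R" "R x = R y" shows "x = y"
proof -
  have "\<nu> *\<^sub>R R x - x = \<nu> *\<^sub>R R x - y"
    by (rule generator_unique[OF resolvent_in[OF assms(1)]])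
      (use resolvent_in[OF assms(1), of y] assms(2) in simp)
  then show ?thesis by simp
qed

text \<open>The semigroup generated by \<open>A - \<nu>\<close>. Applied to it, the lemmas on \<open>Q\<close> become
  statements on finite pieces of the Laplace transform.\<close>

definition rescaled :: "real \<Rightarrow> (real \<Rightarrow> 'a::banach \<Rightarrow>\<^sub>L 'a) \<Rightarrow> real \<Rightarrow> 'a \<Rightarrow>\<^sub>L 'a" where
  "rescaled \<nu> T t = exp (- \<nu> * t) *\<^sub>R T t"

lemma rescaled_apply: "rescaled \<nu> T t x = exp (- \<nu> * t) *\<^sub>R T t x"
  by (simp add: rescaled_def blinfun.scaleR_left)

lemma rescaled_inverse: "rescaled (- \<nu>) (rescaled \<nu> T) = T"
  by (simp add: rescaled_def fun_eq_iff flip: exp_add)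

lemma (in c0) c0_rescaled: "c0 (rescaled \<nu> T)"
proof
  have "((\<lambda>t. exp (- \<nu> * t) *\<^sub>R T t x) \<longlongrightarrow> exp (- \<nu> * 0) *\<^sub>R x) (at_right 0)" for x
    by (intro tendsto_intros T_tendsto_0)
  moreover have "rescaled \<nu> T (s + t) = rescaled \<nu> T s o\<^sub>L rescaled \<nu> T t" if "s \<ge> 0" "t \<ge> 0" for s t
    using that
    by (intro blinfun_eqI)
      (simp add: rescaled_apply T_add blinfun.scaleR_right exp_add[symmetric] algebra_simps)
  moreover have "rescaled \<nu> T 0 = id_blinfun"
    by (intro blinfun_eqI) (simp add: rescaled_apply)
  ultimately show "c0_semigroup (rescaled \<nu> T)"
    by (simp add: c0_semigroup_def rescaled_apply)
qed

lemma (in c0) generator_rescaledI: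
  assumes "(x, y) \<in> A"
  shows "(x, y - \<nu> *\<^sub>R x) \<in> generator (rescaled \<nu> T)"
proof -
  have "((\<lambda>h. exp (- \<nu> * h)) has_real_derivative - \<nu>) (at 0)"
    by (auto intro!: derivative_eq_intros)
  then have "((\<lambda>h. (exp (- \<nu> * h) - 1) / h) \<longlongrightarrow> - \<nu>) (at 0)"
    by (simp add: has_field_derivative_iff)
  then have d: "((\<lambda>h. (exp (- \<nu> * h) - 1) / h) \<longlongrightarrow> - \<nu>) (at_right 0)"
    by (rule tendsto_mono[rotated]) (simp add: at_le)
  have "((\<lambda>h. exp (- \<nu> * h) *\<^sub>R ((T h x - x) /\<^sub>R h) + ((exp (- \<nu> * h) - 1) / h) *\<^sub>R x)
      \<longlongrightarrow> exp (- \<nu> * 0) *\<^sub>R y + (- \<nu>) *\<^sub>R x) (at_right 0)"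
    using assms by (intro tendsto_intros d) (simp add: generator_def)
  moreover have "exp (- \<nu> * h) *\<^sub>R ((T h x - x) /\<^sub>R h) + ((exp (- \<nu> * h) - 1) / h) *\<^sub>R x
      = (rescaled \<nu> T h x - x) /\<^sub>R h" for h
    by (simp add: rescaled_apply scaleR_diff_right scaleR_diff_left divide_inverse algebra_simps)
  ultimately show ?thesis by (simp add: generator_def)
qed

lemma (in c0) generator_rescaledD:
  assumes "(x, y) \<in> generator (rescaled \<nu> T)"
  shows "(x, y + \<nu> *\<^sub>R x) \<in> A"
  using c0.generator_rescaledI[OF c0_rescaled assms, of "- \<nu>"] by (simp add: rescaled_inverse)

lemma (in c0) Q_rescaled_bound:
  assumes "\<nu> > 0" "\<And>t. t \<in> {0..1} \<Longrightarrow> norm (T t) \<le> M"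
  shows "norm (c0.Q (rescaled \<nu> T) 1 x) \<le> M / \<nu> * norm x"
proof -
  interpret r: c0 "rescaled \<nu> T" by (rule c0_rescaled)
  have M: "M \<ge> 0" using order_trans[OF norm_ge_zero assms(2)[of 0]] by simp
  define F where "F s = - exp (- \<nu> * s) * (M * norm x) / \<nu>" for s
  have F: "((\<lambda>s. exp (- \<nu> * s) * (M * norm x)) has_integral F 1 - F 0) {0..1}"
    using assms(1)
    by (intro fundamental_theorem_of_calculus)
      (auto simp: F_def has_real_derivative_iff_has_vector_derivative[symmetric]
        intro!: derivative_eq_intros)
  have "norm (r.Q 1 x) \<le> integral {0..1} (\<lambda>s. exp (- \<nu> * s) * (M * norm x))"
    unfolding r.Q_def
  proof (rule integral_norm_bound_integral)
    show "norm (rescaled \<nu> T s x) \<le> exp (- \<nu> * s) * (M * norm x)" if "s \<in> {0..1}" for s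
    proof -
      have "norm (T s x) \<le> M * norm x"
        using norm_blinfun[of "T s" x] assms(2)[OF that] by (meson mult_right_mono norm_ge_zero order_trans)
      then show ?thesis by (simp add: rescaled_apply mult_left_mono)
    qed
  qed (use F r.integrable_orbit in \<open>auto simp: has_integral_integrable\<close>)
  also have "\<dots> = F 1 - F 0" using F by (rule integral_unique)
  also have "\<dots> \<le> M / \<nu> * norm x"
    using assms(1) M by (simp add: F_def field_simps mult_nonneg_nonneg)
  finally show ?thesis .
qed

text \<open>With \<open>P = exp (- \<nu>) T 1\<close> and \<open>Q 1\<close> the integral of the rescaled semigroup over
  \<open>[0, 1]\<close>, one has \<open>Q 1 (\<nu> - A) = 1 - P\<close>, so the resolvent is the Neumann series
  \<open>\<Sum>n. P\<^sup>n Q 1\<close>. This avoids improper integrals, and every closed convex cone that is invariant under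
  the semigroup is visibly invariant under the series.\<close>

lemma (in c0) resolvent_series:
  assumes lam: "\<nu> > 0" and M: "\<And>t. t \<in> {0..1} \<Longrightarrow> norm (T t) \<le> M" and small: "exp (- \<nu>) * M \<le> 1 / 2"
  obtains R where "is_resolvent A \<nu> R"
    "\<And>x. norm (R x) \<le> 2 * M / \<nu> * norm x"
    "\<And>K x. closed K \<Longrightarrow> convex_cone K \<Longrightarrow> (\<And>t x. t \<ge> 0 \<Longrightarrow> x \<in> K \<Longrightarrow> T t x \<in> K) \<Longrightarrow> x \<in> K \<Longrightarrow> R x \<in> K"
proof -
  interpret r: c0 "rescaled \<nu> T" by (rule c0_rescaled)
  define P where "P = blinfun_apply (rescaled \<nu> T 1)"
  have M0: "M \<ge> 0" using order_trans[OF norm_ge_zero M[of 0]] by simp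
  have P: "norm (P y) \<le> 1 / 2 * norm y" for y
  proof -
    have "norm (rescaled \<nu> T 1) \<le> exp (- \<nu>) * M" using M[of 1] by (simp add: rescaled_def)
    then have "norm (rescaled \<nu> T 1) \<le> 1 / 2" using small by simp
    then show ?thesis
      unfolding P_def by (rule order_trans[OF norm_blinfun mult_right_mono]) simp
  qed
  define s where "s n x = (P ^^ n) (r.Q 1 x)" for n :: nat and x
  have Pn: "norm ((P ^^ n) y) \<le> (1 / 2) ^ n * norm y" for n :: nat and y
  proof (induction n)
    case (Suc n)
    then show ?case using P[of "(P ^^ n) y"] by simp
  qed simp
  have P_linear: "linear P"
    unfolding P_def by (rule bounded_linear.linear[OF blinfun.bounded_linear_right])
  have Plin: "linear (P ^^ n)" for n :: nat
  proof (induction n)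
    case (Suc n)
    then show ?case using linear_compose[OF Suc P_linear] by (simp add: comp_def)
  qed (simp add: linear_iff)
  have Q1: "norm (r.Q 1 x) \<le> M / \<nu> * norm x" for x
    using Q_rescaled_bound[OF lam M] .
  have sn: "norm (s n x) \<le> (1 / 2) ^ n * (M / \<nu> * norm x)" for n x
    using Pn[of n "r.Q 1 x"] Q1[of x] unfolding s_def
    by (meson mult_left_mono order_trans zero_le_divide_1_iff zero_le_numeral zero_le_power)
  have geo: "summable (\<lambda>n. (1 / 2) ^ n * (M / \<nu> * norm x))" for x
    by (intro summable_mult2 summable_geometric) auto
  have summ: "summable (\<lambda>n. s n x)" for x
    by (rule summable_comparison_test[OF _ geo]) (use sn in auto)
  define R0 where "R0 x = (\<Sum>n. s n x)" for x
  have R0_bound: "norm (R0 x) \<le> 2 * M / \<nu> * norm x" for x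
  proof -
    have "summable (\<lambda>n. norm (s n x))"
      by (rule summable_comparison_test[OF _ geo]) (use sn in auto)
    then have "norm (R0 x) \<le> (\<Sum>n. norm (s n x))" unfolding R0_def by (rule summable_norm)
    also have "\<dots> \<le> (\<Sum>n. (1 / 2) ^ n * (M / \<nu> * norm x))"
      by (rule suminf_le[OF sn _ geo]) fact
    also have "\<dots> = 2 * (M / \<nu> * norm x)"
      by (subst suminf_mult2[symmetric]) (auto simp: suminf_geometric)
    finally show ?thesis by simp
  qed
  have "bounded_linear R0"
  proof (rule bounded_linear_intro[where K = "2 * M / \<nu>"])
    have Qlin: "linear (r.Q 1)" by (rule bounded_linear.linear[OF r.bounded_linear_Q])
    show "R0 (x + y) = R0 x + R0 y" for x y
      unfolding R0_def by (subst suminf_add[OF summ summ])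
        (simp add: s_def linear_add[OF Plin] linear_add[OF Qlin])
    show "R0 (c *\<^sub>R x) = c *\<^sub>R R0 x" for c x
      unfolding R0_def by (subst suminf_scaleR_right[OF summ])
        (simp add: s_def linear_scale[OF Plin] linear_scale[OF Qlin])
    show "norm (R0 x) \<le> norm x * (2 * M / \<nu>)" for x
      using R0_bound[of x] by (simp add: mult.commute)
  qed
  then have R0: "blinfun_apply (Blinfun R0) = R0" by (rule bounded_linear_Blinfun_apply)
  have P_to_0: "(\<lambda>n. (P ^^ n) y) \<longlonglongrightarrow> 0" for y
  proof (rule Lim_null_comparison[of _ "\<lambda>n. (1 / 2) ^ n * norm y"])
    show "(\<lambda>n. (1 / 2) ^ n * norm y) \<longlonglongrightarrow> 0"
      by (intro tendsto_mult_left_zero LIMSEQ_power_zero) auto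
  qed (use Pn in auto)
  have PQ: "(P ^^ n) (r.Q 1 x) = r.Q 1 ((P ^^ n) x)" for n x
    by (induction n) (auto simp: P_def r.T_Q_commute)
  have res: "is_resolvent A \<nu> (Blinfun R0)"
    unfolding is_resolvent_def R0
  proof (intro conjI allI ballI; clarify?)
    fix x
    have "((\<Sum>k<n. s k x), (P ^^ n) x - x) \<in> generator (rescaled \<nu> T)" for n
    proof (induction n)
      case 0
      then show ?case using r.generator_Q[of 0 0] by (simp add: r.Q_def)
    next
      case (Suc n)
      have "(s n x, P ((P ^^ n) x) - (P ^^ n) x) \<in> generator (rescaled \<nu> T)"
        using r.generator_Q[of 1 "(P ^^ n) x"] by (simp add: s_def PQ flip: P_def)
      from r.generator_add[OF Suc this] show ?case by simp
    qed
    moreover have "(\<lambda>n. \<Sum>k<n. s k x) \<longlonglongrightarrow> R0 x"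
      unfolding R0_def by (rule summable_LIMSEQ[OF summ])
    moreover have "(\<lambda>n. (P ^^ n) x - x) \<longlonglongrightarrow> 0 - x" by (intro tendsto_intros P_to_0)
    ultimately have "(R0 x, 0 - x) \<in> generator (rescaled \<nu> T)" by (rule r.generator_closed)
    from generator_rescaledD[OF this] show "(R0 x, \<nu> *\<^sub>R R0 x - x) \<in> A"
      by (simp add: algebra_simps)
  next
    fix x y assume "(x, y) \<in> A"
    from r.Q_generator[OF generator_rescaledI[OF this, of \<nu>], of 1]
    have "r.Q 1 (y - \<nu> *\<^sub>R x) = P x - x" by (simp add: P_def)
    then have "r.Q 1 (\<nu> *\<^sub>R x - y) = x - P x"
      using linear_neg[OF bounded_linear.linear[OF r.bounded_linear_Q], of 1 "y - \<nu> *\<^sub>R x"] by simp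
    then have "s n (\<nu> *\<^sub>R x - y) = (P ^^ n) x - (P ^^ Suc n) x" for n
      unfolding s_def by (simp add: linear_diff[OF Plin] funpow_swap1)
    then have "(\<Sum>k<n. s k (\<nu> *\<^sub>R x - y)) = x - (P ^^ n) x" for n
      by (induction n) auto
    moreover have "(\<lambda>n. x - (P ^^ n) x) \<longlonglongrightarrow> x - 0" by (intro tendsto_intros P_to_0)
    ultimately have "(\<lambda>n. \<Sum>k<n. s k (\<nu> *\<^sub>R x - y)) \<longlonglongrightarrow> x" by simp
    then show "R0 (\<nu> *\<^sub>R x - y) = x"
      unfolding R0_def using LIMSEQ_unique summable_LIMSEQ[OF summ] by blast
  qed
  moreover have "R0 x \<in> K" if K: "closed K" "convex_cone K"
    and inv: "\<And>t x. t \<ge> 0 \<Longrightarrow> x \<in> K \<Longrightarrow> T t x \<in> K" and x: "x \<in> K" for K x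
  proof -
    have r_inv: "rescaled \<nu> T t y \<in> K" if "t \<ge> 0" "y \<in> K" for t y
      unfolding rescaled_apply by (rule convex_cone_scaleR[OF K(2)]) (use inv that in auto)
    have "r.Q 1 x \<in> K"
      unfolding r.Q_def
      by (rule integral_in_closed_cone[OF K integrable_integral[OF r.integrable_orbit] negligible_empty])
        (use r_inv x in auto)
    then have "(P ^^ n) (r.Q 1 x) \<in> K" for n :: nat
      by (induction n) (use r_inv in \<open>auto simp: P_def\<close>)
    then have "(\<Sum>k<n. s k x) \<in> K" for n
      unfolding s_def by (intro convex_cone_sum[OF K(2)]) auto
    then show ?thesis
      unfolding R0_def by (rule closed_sequentially[OF K(1) _ summable_LIMSEQ[OF summ]])
  qed
  ultimately show ?thesis
    using that[of "Blinfun R0"] R0_bound unfolding R0 by blast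
qed

lemma (in c0) resolvent_at_infinity:
  obtains M \<nu>0 R where "M \<ge> 0" "\<nu>0 > 0" "\<And>\<nu>. \<nu> \<ge> \<nu>0 \<Longrightarrow> is_resolvent A \<nu> (R \<nu>)"
    "\<And>\<nu> x. \<nu> \<ge> \<nu>0 \<Longrightarrow> norm (\<nu> *\<^sub>R R \<nu> x) \<le> M * norm x"
    "\<And>\<nu> K x. \<nu> \<ge> \<nu>0 \<Longrightarrow> closed K \<Longrightarrow> convex_cone K \<Longrightarrow>
      (\<And>t x. t \<ge> 0 \<Longrightarrow> x \<in> K \<Longrightarrow> T t x \<in> K) \<Longrightarrow> x \<in> K \<Longrightarrow> R \<nu> x \<in> K"
proof -
  obtain M where M: "M \<ge> 1" "\<And>t. t \<in> {0..1} \<Longrightarrow> norm (T t) \<le> M"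
    using bounded_on_compact by blast
  \<comment> \<open>the least value with \<open>exp (- \<nu>0) * M \<le> 1 / 2\<close>\<close>
  define \<nu>0 where "\<nu>0 = ln (2 * M)"
  have l0: "\<nu>0 > 0" using M by (simp add: \<nu>0_def)
  let ?P = "\<lambda>\<nu> R. is_resolvent A \<nu> R \<and> (\<forall>x. norm (\<nu> *\<^sub>R R x) \<le> 2 * M * norm x) \<and>
     (\<forall>K x. closed K \<longrightarrow> convex_cone K \<longrightarrow> (\<forall>t x. t \<ge> 0 \<longrightarrow> x \<in> K \<longrightarrow> T t x \<in> K) \<longrightarrow> x \<in> K \<longrightarrow> R x \<in> K)"
  have "\<exists>R. ?P \<nu> R"
    if l: "\<nu> \<ge> \<nu>0" for \<nu>
  proof -
    have "exp (- \<nu>) * M \<le> exp (- \<nu>0) * M" using l M by (intro mult_right_mono) auto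
    also have "\<dots> = 1 / 2" using M by (simp add: \<nu>0_def exp_minus)
    finally have small: "exp (- \<nu>) * M \<le> 1 / 2" .
    have pos: "\<nu> > 0" using l l0 by simp
    show ?thesis
    proof (rule resolvent_series[OF pos M(2) small])
      fix R assume R: "is_resolvent A \<nu> R" "\<And>x. norm (R x) \<le> 2 * M / \<nu> * norm x"
        "\<And>K x. closed K \<Longrightarrow> convex_cone K \<Longrightarrow> (\<And>t x. t \<ge> 0 \<Longrightarrow> x \<in> K \<Longrightarrow> T t x \<in> K) \<Longrightarrow> x \<in> K \<Longrightarrow> R x \<in> K"
      have "norm (\<nu> *\<^sub>R R x) \<le> 2 * M * norm x" for x
        using R(2)[of x] pos by (simp add: field_simps)
      then show ?thesis using R by blast
    qed
  qed
  then obtain R where "\<And>\<nu>. \<nu> \<ge> \<nu>0 \<Longrightarrow> ?P \<nu> (R \<nu>)"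
    by metis
  then show ?thesis using that[of "2 * M" \<nu>0 R] l0 M by auto
qed

text \<open>On the domain \<open>\<nu> R \<nu> z - z = R \<nu> y\<close> with \<open>(z, y)\<close> in the generator, which tends to
  \<open>0\<close>; the uniform bound extends this to the closure of the domain. The averages
  \<open>Q h x / h\<close> are the approximating elements \<open>z\<close>.\<close>

lemma (in c0) resolvent_tendsto_id:
  assumes R: "\<And>\<nu>. \<nu> \<ge> \<nu>0 \<Longrightarrow> is_resolvent A \<nu> (R \<nu>)" "\<nu>0 > 0"
    and M: "\<And>\<nu> x. \<nu> \<ge> \<nu>0 \<Longrightarrow> norm (\<nu> *\<^sub>R R \<nu> x) \<le> M * norm x" "M \<ge> 0"
  shows "((\<lambda>\<nu>. \<nu> *\<^sub>R R \<nu> x) \<longlongrightarrow> x) at_top"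
proof (rule tendstoI)
  fix e :: real assume e: "e > 0"
  have "\<forall>\<^sub>F h in at_right 0. dist (Q h x /\<^sub>R h) x < e / (2 * (M + 1))"
    by (rule tendstoD[OF Q_tendsto]) (use e M in auto)
  then obtain h where h: "h > 0" "dist (Q h x /\<^sub>R h) x < e / (2 * (M + 1))"
    unfolding eventually_at_right_field using dense by blast
  define z where "z = Q h x /\<^sub>R h"
  define y where "y = (T h x - x) /\<^sub>R h"
  have zy: "(z, y) \<in> A"
    unfolding z_def y_def by (intro generator_scaleR generator_Q) (use h in auto)
  have "\<forall>\<^sub>F l in at_top. M * norm y < e / 2 * l"
    using eventually_gt_at_top[of "M * norm y * 2 / e"]
    by eventually_elim (use e in \<open>simp add: field_simps\<close>)
  moreover have "\<forall>\<^sub>F l in at_top. l \<ge> \<nu>0" by (rule eventually_ge_at_top)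
  ultimately show "\<forall>\<^sub>F l in at_top. dist (l *\<^sub>R R l x) x < e"
  proof eventually_elim
    case (elim l)
    have l: "l > 0" using elim R(2) by simp
    have "R l (l *\<^sub>R z - y) = z" by (rule resolvent_left[OF R(1)[OF elim(2)] zy])
    then have eq: "l *\<^sub>R R l z - z = R l y" by (simp add: blinfun.diff_right blinfun.scaleR_right algebra_simps)
    have "l * norm (R l y) \<le> M * norm y" using M(1)[OF elim(2), of y] l by simp
    then have "l * norm (R l y) < l * (e / 2)" using elim(1) by (simp add: mult.commute)
    then have 1: "norm (l *\<^sub>R R l z - z) < e / 2" unfolding eq using l by simp
    have "norm (l *\<^sub>R R l (x - z)) \<le> M * norm (x - z)" by (rule M(1)[OF elim(2)])
    then have 2: "norm (l *\<^sub>R R l (x - z)) + norm (x - z) \<le> (M + 1) * norm (x - z)"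
      by (simp add: algebra_simps)
    have "norm (x - z) < e / (2 * (M + 1))" using h by (simp add: z_def dist_norm norm_minus_commute)
    then have 3: "(M + 1) * norm (x - z) < e / 2" using M(2) by (simp add: field_simps)
    have "l *\<^sub>R R l x - x = (l *\<^sub>R R l z - z) + l *\<^sub>R R l (x - z) - (x - z)"
      by (simp add: blinfun.diff_right algebra_simps)
    then have "norm (l *\<^sub>R R l x - x) \<le> norm (l *\<^sub>R R l z - z) + norm (l *\<^sub>R R l (x - z)) + norm (x - z)"
      using norm_triangle_ineq4[of "(l *\<^sub>R R l z - z) + l *\<^sub>R R l (x - z)" "x - z"]
        norm_triangle_ineq[of "l *\<^sub>R R l z - z" "l *\<^sub>R R l (x - z)"] by simp
    then show ?case using 1 2 3 by (simp add: dist_norm)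
  qed
qed

section \<open>The positive cone\<close>

text \<open>As \<open>- y \<le> 0\<close>, both \<open>sup x 0 - y\<close> and its negative are below the modulus of \<open>x - y\<close>. This yields
  both the closedness of the cone and the positivity of the approximants of a positive function.\<close>

lemma norm_positive_part_diff:
  fixes x y :: "'a::banach_lattice"
  assumes "0 \<le> y" shows "norm (sup x 0 - y) \<le> norm (x - y)"
proof (rule norm_mono_modulus)
  let ?m = "sup (x - y) (- (x - y))"
  have "0 \<le> ?m + ?m"
    using add_mono[of "x - y" ?m "- (x - y)" ?m] by simp
  then have "0 \<le> (1 / 2 :: real) *\<^sub>R (?m + ?m)" by (intro scaleR_nonneg_nonneg) auto
  then have m: "0 \<le> ?m" by (simp only: scaleR_half_double)
  have "x - y \<le> ?m" by simp
  then have "x \<le> ?m + y" by (simp only: diff_le_eq)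
  moreover have "0 \<le> ?m + y" using m assms by simp
  ultimately have "sup x 0 \<le> ?m + y" by simp
  then have 1: "sup x 0 - y \<le> ?m" by (simp only: diff_le_eq)
  have "y - x \<le> ?m" using sup_ge2[of "- (x - y)" "x - y"] by simp
  moreover have "y - sup x 0 \<le> y - x" by (intro diff_left_mono) simp
  ultimately have "y - sup x 0 \<le> ?m" by (rule order_trans[rotated])
  then have "- (sup x 0 - y) \<le> ?m" by (simp only: minus_diff_eq)
  with 1 show "sup (sup x 0 - y) (- (sup x 0 - y)) \<le> ?m" by simp
qed

lemma closed_nonneg: "closed {x::'a::banach_lattice. 0 \<le> x}"
  unfolding closed_sequential_limits
proof (intro allI impI, elim conjE)
  fix f :: "nat \<Rightarrow> 'a" and x
  assume f: "\<forall>n. f n \<in> {x. 0 \<le> x}" and lim: "f \<longlonglongrightarrow> x"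
  have "(\<lambda>n. sup x 0 - f n) \<longlonglongrightarrow> 0"
  proof (rule Lim_null_comparison)
    show "\<forall>\<^sub>F n in sequentially. norm (sup x 0 - f n) \<le> norm (x - f n)"
      using f by (auto intro!: always_eventually norm_positive_part_diff)
    have "(\<lambda>n. norm (x - f n)) \<longlonglongrightarrow> norm (x - x)" by (intro tendsto_intros lim)
    then show "(\<lambda>n. norm (x - f n)) \<longlonglongrightarrow> 0" by simp
  qed
  from tendsto_diff[OF tendsto_const[of "sup x 0"] this] have "f \<longlonglongrightarrow> sup x 0" by simp
  then have "sup x 0 = x" using lim by (rule LIMSEQ_unique)
  then show "x \<in> {x. 0 \<le> x}" by (metis mem_Collect_eq sup_ge2)
qed

lemma convex_cone_nonneg: "convex_cone {x::'a::ordered_real_vector. 0 \<le> x}"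
  by (auto simp: convex_cone_iff scaleR_nonneg_nonneg)

lemma nonneg_limit:
  fixes f :: "'b \<Rightarrow> 'a::banach_lattice"
  assumes "F \<noteq> bot" "(f \<longlongrightarrow> l) F" "\<forall>\<^sub>F t in F. 0 \<le> f t"
  shows "0 \<le> l"
  using Lim_in_closed_set[OF closed_nonneg, of f F l] assms by simp

section \<open>Convolutions with a semigroup\<close>

lemma integral_reflect_Icc:
  fixes f :: "real \<Rightarrow> 'a::banach"
  shows "integral {0..t} (\<lambda>s. f (t - s)) = integral {0..t} f"
proof -
  have "integral {0..t} (\<lambda>s. f (t - s)) = integral {0..t} ((\<lambda>r. f (- r)) \<circ> (+) (- t))"
    by (simp add: comp_def)
  also have "\<dots> = integral {- t..- 0} (\<lambda>r. f (- r))"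
    by (simp add: integral_shift_Icc_real)
  also have "\<dots> = integral {0..t} f"
    using Henstock_Kurzweil_Integration.integral_reflect_real[where a = 0 and b = t and f = f] by simp
  finally show ?thesis .
qed

context c0
begin

lemma continuous_reflected_orbit: "continuous_on {0..t} (\<lambda>s. T (t - s) w)"
  by (rule continuous_on_compose2[OF continuous_orbit]) (auto intro!: continuous_intros)

lemma continuous_convolution:
  fixes \<phi> :: "real \<Rightarrow> real"
  assumes "continuous_on {0..t} \<phi>" shows "continuous_on {0..t} (\<lambda>s. T (t - s) (\<phi> s *\<^sub>R w))"
  using assms by (simp add: blinfun.scaleR_right) (intro continuous_intros continuous_reflected_orbit)

text \<open>Integrating by parts with the primitive \<open>- Q (t - s) w\<close> of the orbit turns the convolution
  into \<open>\<integral> \<phi>' s Q (t - s) w\<close>, whose integrand lies in the range of the resolvent. For \<open>w = B u\<close>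
  the convolutions are the states \<open>z\<close> and \<open>z'\<close> under the inputs \<open>\<phi> u\<close> and \<open>\<phi>' u\<close>, and
  \<open>z = R (\<nu> z - z') + R (B (\<phi> t u))\<close> is the decomposition that defines \<open>Z\<close>.\<close>

lemma convolution_resolvent:
  assumes R: "is_resolvent A \<nu> R" and t: "t \<ge> 0"
    and \<phi>: "\<And>s. (\<phi> has_real_derivative \<phi>' s) (at s)" "continuous_on UNIV \<phi>'" "\<phi> 0 = 0"
  shows "integral {0..t} (\<lambda>s. T (t - s) (\<phi> s *\<^sub>R w)) =
    R (\<nu> *\<^sub>R integral {0..t} (\<lambda>s. T (t - s) (\<phi> s *\<^sub>R w)) -
       integral {0..t} (\<lambda>s. T (t - s) (\<phi>' s *\<^sub>R w)) + \<phi> t *\<^sub>R w)"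
proof -
  have cont': "continuous_on {0..t} \<phi>'" by (rule continuous_on_subset[OF \<phi>(2)]) auto
  have cont: "continuous_on {0..t} \<phi>"
    using \<phi>(1) by (meson DERIV_isCont continuous_at_imp_continuous_on)
  have dQ: "((\<lambda>s. Q (t - s) w) has_vector_derivative - T (t - s) w) (at s within {0..t})"
    if "s \<in> {0..t}" for s
  proof -
    have "((\<lambda>r. integral {0..r} (\<lambda>s. T s w)) has_vector_derivative T (t - s) w)
        (at (t - s) within {0..t})"
      by (rule integral_has_vector_derivative)
        (use that in \<open>auto intro: continuous_on_subset[OF continuous_orbit]\<close>)
    then have "(Q' has_vector_derivative T (t - s) w) (at (t - s) within (\<lambda>s. t - s) ` {0..t})"
      if "Q' = (\<lambda>r. integral {0..r} (\<lambda>s. T s w))" for Q'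
      using that by (auto intro: has_vector_derivative_within_subset)
    then have 1: "((\<lambda>r. Q r w) has_vector_derivative T (t - s) w) (at (t - s) within (\<lambda>s. t - s) ` {0..t})"
      by (simp add: Q_def[abs_def])
    have 2: "((\<lambda>s. t - s) has_vector_derivative - 1) (at s within {0..t})"
      by (auto intro!: derivative_eq_intros)
    show ?thesis using vector_diff_chain_within[OF 2 1] by (simp add: comp_def)
  qed
  have dF: "((\<lambda>s. \<phi> s *\<^sub>R Q (t - s) w) has_vector_derivative
      \<phi> s *\<^sub>R (- T (t - s) w) + \<phi>' s *\<^sub>R Q (t - s) w) (at s within {0..t})" if "s \<in> {0..t}" for s
    by (rule has_vector_derivative_scaleR[OF has_field_derivative_at_within[OF \<phi>(1)] dQ[OF that]])
  have "((\<lambda>s. \<phi> s *\<^sub>R (- T (t - s) w) + \<phi>' s *\<^sub>R Q (t - s) w) has_integral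
      \<phi> t *\<^sub>R Q (t - t) w - \<phi> 0 *\<^sub>R Q (t - 0) w) {0..t}"
    by (rule fundamental_theorem_of_calculus[OF t dF])
  then have ftc: "((\<lambda>s. \<phi>' s *\<^sub>R Q (t - s) w - \<phi> s *\<^sub>R T (t - s) w) has_integral 0) {0..t}"
    by (simp add: \<phi>(3) Q_def)
  have contQ: "continuous_on {0..t} (\<lambda>s. Q (t - s) w)"
    using dQ by (meson continuous_on_eq_continuous_within has_vector_derivative_continuous)
  have intT: "(\<lambda>s. \<psi> s *\<^sub>R T (t - s) w) integrable_on {0..t}" if "continuous_on {0..t} \<psi>" for \<psi>
    by (intro integrable_continuous_real continuous_intros that continuous_reflected_orbit)
  have intQ: "(\<lambda>s. \<phi>' s *\<^sub>R Q (t - s) w) integrable_on {0..t}"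
    by (intro integrable_continuous_real continuous_intros cont' contQ)
  define I where "I = integral {0..t} (\<lambda>s. \<phi> s *\<^sub>R T (t - s) w)"
  define I' where "I' = integral {0..t} (\<lambda>s. \<phi>' s *\<^sub>R T (t - s) w)"
  have "integral {0..t} (\<lambda>s. \<phi>' s *\<^sub>R Q (t - s) w) - I = 0"
    unfolding I_def using integral_unique[OF ftc] intQ intT[OF cont] by (simp add: integral_diff)
  then have I: "((\<lambda>s. \<phi>' s *\<^sub>R Q (t - s) w) has_integral I) {0..t}"
    using intQ by (simp add: has_integral_iff)
  have I': "((\<lambda>s. \<phi>' s *\<^sub>R T (t - s) w) has_integral I') {0..t}"
    unfolding I'_def by (rule integrable_integral[OF intT[OF cont']])
  have d: "((\<lambda>s. \<phi>' s *\<^sub>R w) has_integral \<phi> t *\<^sub>R w) {0..t}"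
    using fundamental_theorem_of_calculus[OF t, of \<phi> \<phi>'] \<phi>(1,3)
    by (intro has_integral_scaleR_left)
      (auto simp: has_real_derivative_iff_has_vector_derivative has_vector_derivative_at_within)
  have "((\<lambda>s. \<nu> *\<^sub>R \<phi>' s *\<^sub>R Q (t - s) w - \<phi>' s *\<^sub>R T (t - s) w + \<phi>' s *\<^sub>R w)
      has_integral (\<nu> *\<^sub>R I - I' + \<phi> t *\<^sub>R w)) {0..t}"
    by (intro has_integral_add has_integral_diff has_integral_cmul I I' d)
  then have "((\<lambda>s. R (\<nu> *\<^sub>R \<phi>' s *\<^sub>R Q (t - s) w - \<phi>' s *\<^sub>R T (t - s) w + \<phi>' s *\<^sub>R w))
      has_integral R (\<nu> *\<^sub>R I - I' + \<phi> t *\<^sub>R w)) {0..t}"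
    by (rule has_integral_linear[OF _ blinfun.bounded_linear_right, unfolded comp_def])
  moreover have "R (\<nu> *\<^sub>R \<phi>' s *\<^sub>R Q (t - s) w - \<phi>' s *\<^sub>R T (t - s) w + \<phi>' s *\<^sub>R w) = \<phi>' s *\<^sub>R Q (t - s) w"
    if "s \<in> {0..t}" for s
  proof -
    have "R (\<nu> *\<^sub>R Q (t - s) w - (T (t - s) w - w)) = Q (t - s) w"
      by (rule resolvent_left[OF R generator_Q]) (use that in simp)
    then have "\<phi>' s *\<^sub>R R (\<nu> *\<^sub>R Q (t - s) w - (T (t - s) w - w)) = \<phi>' s *\<^sub>R Q (t - s) w" by simp
    then show ?thesis
      by (simp add: blinfun.scaleR_right blinfun.add_right blinfun.diff_right algebra_simps)
  qed
  ultimately have "((\<lambda>s. \<phi>' s *\<^sub>R Q (t - s) w) has_integral R (\<nu> *\<^sub>R I - I' + \<phi> t *\<^sub>R w)) {0..t}"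
    by (rule has_integral_eq[rotated])
  then have "I = R (\<nu> *\<^sub>R I - I' + \<phi> t *\<^sub>R w)" using I has_integral_unique by blast
  then show ?thesis by (simp add: I_def I'_def blinfun.scaleR_right)
qed

text \<open>For \<open>\<phi> s = exp (\<nu> s) - 1\<close> the derivative is \<open>\<nu> (\<phi> + 1)\<close>, so the two convolutions in
  the general formula cancel up to \<open>\<nu> Q t w\<close>.\<close>

lemma exponential_convolution:
  assumes R: "is_resolvent A \<nu> R" and t: "t \<ge> 0"
  shows "integral {0..t} (\<lambda>s. T (t - s) ((exp (\<nu> * s) - 1) *\<^sub>R w)) =
    R ((exp (\<nu> * t) - 1) *\<^sub>R w - \<nu> *\<^sub>R Q t w)"
proof -
  define I where "I = integral {0..t} (\<lambda>s. T (t - s) ((exp (\<nu> * s) - 1) *\<^sub>R w))"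
  have int: "(\<lambda>s. T (t - s) ((exp (\<nu> * s) - 1) *\<^sub>R w)) integrable_on {0..t}"
    by (intro integrable_continuous_real continuous_convolution continuous_intros)
  have int1: "(\<lambda>s. T (t - s) w) integrable_on {0..t}"
    by (intro integrable_continuous_real continuous_reflected_orbit)
  have "integral {0..t} (\<lambda>s. T (t - s) ((\<nu> * exp (\<nu> * s)) *\<^sub>R w)) =
      integral {0..t} (\<lambda>s. \<nu> *\<^sub>R (T (t - s) ((exp (\<nu> * s) - 1) *\<^sub>R w) + T (t - s) w))"
    by (intro integral_cong)
      (simp add: blinfun.scaleR_right blinfun.add_right blinfun.diff_right algebra_simps)
  also have "\<dots> = \<nu> *\<^sub>R (I + integral {0..t} (\<lambda>s. T (t - s) w))"
    unfolding I_def using int int1 by (simp add: integral_add)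
  also have "integral {0..t} (\<lambda>s. T (t - s) w) = Q t w"
    unfolding Q_def by (rule integral_reflect_Icc)
  finally have I': "integral {0..t} (\<lambda>s. T (t - s) ((\<nu> * exp (\<nu> * s)) *\<^sub>R w)) = \<nu> *\<^sub>R (I + Q t w)" .
  have "I = R (\<nu> *\<^sub>R I - \<nu> *\<^sub>R (I + Q t w) + (exp (\<nu> * t) - 1) *\<^sub>R w)"
    unfolding I'[symmetric] unfolding I_def
    by (rule convolution_resolvent[OF R t]) (auto intro!: derivative_eq_intros continuous_intros)
  also have "\<nu> *\<^sub>R I - \<nu> *\<^sub>R (I + Q t w) + (exp (\<nu> * t) - 1) *\<^sub>R w =
      (exp (\<nu> * t) - 1) *\<^sub>R w - \<nu> *\<^sub>R Q t w"
    by (simp add: scaleR_add_right)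
  finally show ?thesis unfolding I_def .
qed

end

section \<open>The extrapolation space\<close>

lemma isometric_extension:
  fixes J :: "'x::real_vector \<Rightarrow> 'e::real_normed_vector" and R :: "'x \<Rightarrow> 'y::banach"
  assumes J: "linear J" and R: "linear R" and iso: "\<And>x. norm (J x) = norm (R x)"
    and dense: "closure (range J) = UNIV"
  shows "\<exists>S::'e \<Rightarrow>\<^sub>L 'y. (\<forall>x. S (J x) = R x) \<and> (\<forall>w. norm (S w) = norm w)"
proof -
  have seq: "\<exists>\<xi>. (\<lambda>n. J (\<xi> n)) \<longlonglongrightarrow> w" for w
  proof -
    have "w \<in> closure (range J)" using dense by simp
    then obtain f where f: "\<And>n. f n \<in> range J" "f \<longlonglongrightarrow> w" unfolding closure_sequential by blast
    then have "\<forall>n. \<exists>x. f n = J x" by blast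
    then obtain \<xi> where "\<And>n. f n = J (\<xi> n)" by metis
    then have "f = (\<lambda>n. J (\<xi> n))" by auto
    then show ?thesis using f by blast
  qed
  have dist: "norm (R x - R y) = norm (J x - J y)" for x y
    by (simp add: iso flip: linear_diff[OF J] linear_diff[OF R])
  have "\<exists>y. \<forall>\<xi>. (\<lambda>n. J (\<xi> n)) \<longlonglongrightarrow> w \<longrightarrow> (\<lambda>n. R (\<xi> n)) \<longlonglongrightarrow> y" for w
  proof -
    obtain \<xi> where \<xi>: "(\<lambda>n. J (\<xi> n)) \<longlonglongrightarrow> w" using seq by blast
    then have "Cauchy (\<lambda>n. J (\<xi> n))" by (rule LIMSEQ_imp_Cauchy)
    then have "Cauchy (\<lambda>n. R (\<xi> n))" unfolding Cauchy_def dist_norm dist .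
    then obtain y where y: "(\<lambda>n. R (\<xi> n)) \<longlonglongrightarrow> y" using Cauchy_convergent convergent_def by blast
    have "(\<lambda>n. R (\<eta> n)) \<longlonglongrightarrow> y" if "(\<lambda>n. J (\<eta> n)) \<longlonglongrightarrow> w" for \<eta>
    proof -
      have "(\<lambda>n. norm (J (\<eta> n) - J (\<xi> n))) \<longlonglongrightarrow> norm (w - w)"
        by (intro tendsto_intros that \<xi>)
      then have "(\<lambda>n. norm (R (\<eta> n) - R (\<xi> n))) \<longlonglongrightarrow> 0" by (simp add: dist)
      then have "(\<lambda>n. R (\<eta> n) - R (\<xi> n)) \<longlonglongrightarrow> 0" by (rule tendsto_norm_zero_cancel)
      from tendsto_add[OF this y] show ?thesis by simp
    qed
    then show ?thesis by blast
  qed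
  then obtain S where S: "\<And>w \<xi>. (\<lambda>n. J (\<xi> n)) \<longlonglongrightarrow> w \<Longrightarrow> (\<lambda>n. R (\<xi> n)) \<longlonglongrightarrow> S w" by metis
  have SJ: "S (J x) = R x" for x
    using S[of "\<lambda>_. x" "J x"] by (simp add: LIMSEQ_const_iff)
  have norm: "norm (S w) = norm w" for w
  proof -
    obtain \<xi> where \<xi>: "(\<lambda>n. J (\<xi> n)) \<longlonglongrightarrow> w" using seq by blast
    have "(\<lambda>n. norm (R (\<xi> n))) \<longlonglongrightarrow> norm (S w)" "(\<lambda>n. norm (R (\<xi> n))) \<longlonglongrightarrow> norm w"
      using tendsto_norm[OF S[OF \<xi>]] tendsto_norm[OF \<xi>] by (simp_all add: iso)
    then show ?thesis by (rule LIMSEQ_unique)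
  qed
  have "bounded_linear S"
  proof (rule bounded_linear_intro[where K = 1])
    fix v w :: 'e and c :: real
    obtain \<xi> \<eta> where \<xi>: "(\<lambda>n. J (\<xi> n)) \<longlonglongrightarrow> v" and \<eta>: "(\<lambda>n. J (\<eta> n)) \<longlonglongrightarrow> w" using seq by meson
    have "(\<lambda>n. J (\<xi> n + \<eta> n)) \<longlonglongrightarrow> v + w" "(\<lambda>n. J (c *\<^sub>R \<xi> n)) \<longlonglongrightarrow> c *\<^sub>R v"
      using tendsto_add[OF \<xi> \<eta>] tendsto_scaleR[OF tendsto_const \<xi>]
      by (simp_all add: linear_add[OF J] linear_scale[OF J])
    from this[THEN S] have "(\<lambda>n. R (\<xi> n) + R (\<eta> n)) \<longlonglongrightarrow> S (v + w)" "(\<lambda>n. c *\<^sub>R R (\<xi> n)) \<longlonglongrightarrow> S (c *\<^sub>R v)"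
      by (simp_all add: linear_add[OF R] linear_scale[OF R])
    moreover have "(\<lambda>n. R (\<xi> n) + R (\<eta> n)) \<longlonglongrightarrow> S v + S w" "(\<lambda>n. c *\<^sub>R R (\<xi> n)) \<longlonglongrightarrow> c *\<^sub>R S v"
      by (intro tendsto_intros S \<xi> \<eta>)+
    ultimately show "S (v + w) = S v + S w" "S (c *\<^sub>R v) = c *\<^sub>R S v"
      by (auto intro: LIMSEQ_unique)
    show "norm (S v) \<le> norm v * 1" by (simp add: norm)
  qed
  then show ?thesis
    using SJ norm by (intro exI[of _ "Blinfun S"]) (simp add: bounded_linear_Blinfun_apply)
qed

locale extrapolation = c0 T
  for T :: "real \<Rightarrow> 'x::banach \<Rightarrow>\<^sub>L 'x" +
  fixes \<mu> :: real and R :: "'x \<Rightarrow>\<^sub>L 'x" and J :: "'x \<Rightarrow> 'e::banach" and T\<^sub>e :: "real \<Rightarrow> 'e \<Rightarrow>\<^sub>L 'e"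
  assumes R: "is_resolvent (generator T) \<mu> R"
    and extrapolation_space: "is_extrapolation_space (generator T) \<mu> J"
    and extrapolated_semigroup: "is_extrapolated_semigroup J T T\<^sub>e"

sublocale extrapolation \<subseteq> e: c0 T\<^sub>e
  by standard (use extrapolated_semigroup in \<open>simp add: is_extrapolated_semigroup_def\<close>)

context extrapolation
begin

lemma linear_J: "linear J"
  using extrapolation_space by (simp add: is_extrapolation_space_def)

lemma norm_J: "norm (J x) = norm (R x)"
  using extrapolation_space by (simp add: is_extrapolation_space_def resolvent_eq[OF R])

lemma bounded_linear_J: "bounded_linear J"
  by (rule bounded_linear_intro[where K = "norm R"])
    (simp_all add: linear_add[OF linear_J] linear_scale[OF linear_J] norm_J norm_blinfun mult.commute[of _ "norm R"])

lemma inj_J: "J x = J y \<Longrightarrow> x = y"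
proof -
  assume "J x = J y"
  then have "norm (R (x - y)) = 0" by (simp add: linear_diff[OF linear_J] flip: norm_J)
  then have "R x = R y" by (simp add: blinfun.diff_right)
  then show ?thesis by (rule resolvent_inj[OF R])
qed

lemma Te_J: "t \<ge> 0 \<Longrightarrow> T\<^sub>e t (J x) = J (T t x)"
  using extrapolated_semigroup by (simp add: is_extrapolated_semigroup_def)

text \<open>The isometry of the extrapolation space into the state space that extends \<open>R\<close>. It
  intertwines \<open>T\<^sub>e\<close> with \<open>T\<close>, so every fact on \<open>T\<^sub>e\<close> and its resolvents is transported from the
  state space through it; \<open>J \<circ> S\<close> is the resolvent of \<open>T\<^sub>e\<close> at \<open>\<mu>\<close>.\<close>

definition S :: "'e \<Rightarrow>\<^sub>L 'x" where
  "S = (SOME S. (\<forall>x. blinfun_apply S (J x) = R x) \<and> (\<forall>w. norm (blinfun_apply S w) = norm w))"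

lemma S: "S (J x) = R x" "norm (S w) = norm w"
proof -
  have "\<exists>S::'e \<Rightarrow>\<^sub>L 'x. (\<forall>x. S (J x) = R x) \<and> (\<forall>w. norm (S w) = norm w)"
    using extrapolation_space
    by (intro isometric_extension linear_J bounded_linear.linear[OF blinfun.bounded_linear_right] norm_J)
      (simp add: is_extrapolation_space_def)
  from someI_ex[OF this] show "S (J x) = R x" "norm (S w) = norm w" unfolding S_def by auto
qed

lemma inj_S: "S v = S w \<Longrightarrow> v = w"
  using S(2)[of "v - w"] by (simp add: blinfun.diff_right)

lemma S_Te:
  assumes "t \<ge> 0" shows "S (T\<^sub>e t w) = T t (S w)"
proof -
  have "closed {w. S (T\<^sub>e t w) = T t (S w)}" by (intro closed_Collect_eq continuous_intros)
  moreover have "range J \<subseteq> {w. S (T\<^sub>e t w) = T t (S w)}"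
    using assms by (auto simp: Te_J S T_resolvent[OF R])
  ultimately have "closure (range J) \<subseteq> {w. S (T\<^sub>e t w) = T t (S w)}" by (rule closure_minimal[rotated])
  then show ?thesis using extrapolation_space by (auto simp: is_extrapolation_space_def)
qed

lemma generator_Te_iff: "(v, w) \<in> generator T\<^sub>e \<longleftrightarrow> (S v, S w) \<in> A"
proof -
  have "norm ((T\<^sub>e h v - v) /\<^sub>R h - w) = norm ((T h (S v) - S v) /\<^sub>R h - S w)" if "h > 0" for h
    using S(2)[of "(T\<^sub>e h v - v) /\<^sub>R h - w"] that
    by (simp add: blinfun.diff_right blinfun.scaleR_right S_Te)
  then have ev: "\<forall>\<^sub>F h in at_right 0. norm ((T\<^sub>e h v - v) /\<^sub>R h - w) = norm ((T h (S v) - S v) /\<^sub>R h - S w)"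
    by (auto simp: eventually_at_right_field intro!: exI[of _ 1])
  show ?thesis
    unfolding generator_def mem_Collect_eq prod.case
    by (subst (1 2) Lim_null, subst (1 2) tendsto_norm_zero_iff[symmetric])
      (rule tendsto_cong[OF ev])
qed

text \<open>The formula is the resolvent identity
  \<open>R(\<nu>) = R(\<mu>) (1 + (\<mu> - \<nu>) R(\<nu>))\<close>, read with \<open>J\<close> in place of the outer \<open>R(\<mu>)\<close>, so no inverse of
  \<open>S\<close> enters.\<close>

lemma resolvent_Te:
  assumes R': "is_resolvent A \<nu> R'"
  obtains R\<^sub>e where "is_resolvent (generator T\<^sub>e) \<nu> R\<^sub>e" "\<And>w. R\<^sub>e w = J (S w + (\<mu> - \<nu>) *\<^sub>R R' (S w))"
    "\<And>w. S (R\<^sub>e w) = R' (S w)"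
proof -
  have bl: "bounded_linear (\<lambda>w. J (S w + (\<mu> - \<nu>) *\<^sub>R R' (S w)))"
    by (intro bounded_linear_compose[OF bounded_linear_J] bounded_linear_add
        bounded_linear_scaleR_right[THEN bounded_linear_compose] blinfun.bounded_linear_right
        bounded_linear_compose[OF blinfun.bounded_linear_right blinfun.bounded_linear_right])
  define R\<^sub>e where "R\<^sub>e = Blinfun (\<lambda>w. J (S w + (\<mu> - \<nu>) *\<^sub>R R' (S w)))"
  have Re: "R\<^sub>e w = J (S w + (\<mu> - \<nu>) *\<^sub>R R' (S w))" for w
    by (simp add: R\<^sub>e_def bounded_linear_Blinfun_apply[OF bl])
  have SRe: "S (R\<^sub>e w) = R' (S w)" for w
    unfolding Re S(1) using resolvent_identity[OF R' R, of "S w"] by simp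
  have "is_resolvent (generator T\<^sub>e) \<nu> R\<^sub>e"
    unfolding is_resolvent_def
  proof (intro conjI allI ballI; clarify?)
    show "(R\<^sub>e w, \<nu> *\<^sub>R R\<^sub>e w - w) \<in> generator T\<^sub>e" for w
      using resolvent_in[OF R', of "S w"]
      by (simp add: generator_Te_iff blinfun.diff_right blinfun.scaleR_right SRe)
  next
    fix v w assume "(v, w) \<in> generator T\<^sub>e"
    then have "R' (\<nu> *\<^sub>R S v - S w) = S v"
      by (intro resolvent_left[OF R']) (simp add: generator_Te_iff)
    then show "R\<^sub>e (\<nu> *\<^sub>R v - w) = v"
      by (intro inj_S) (simp add: SRe blinfun.diff_right blinfun.scaleR_right)
  qed
  then show ?thesis using that Re SRe by blast
qed

lemma resolvent_Te_eq:
  assumes "is_resolvent A \<nu> R'"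
  shows "resolvent (generator T\<^sub>e) \<nu> w = J (S w + (\<mu> - \<nu>) *\<^sub>R R' (S w))"
    and "is_resolvent (generator T\<^sub>e) \<nu> (resolvent (generator T\<^sub>e) \<nu>)"
    and "resolvent (generator T\<^sub>e) \<nu> (J x) = J (R' x)"
proof -
  obtain R\<^sub>e where *: "is_resolvent (generator T\<^sub>e) \<nu> R\<^sub>e" "\<And>w. R\<^sub>e w = J (S w + (\<mu> - \<nu>) *\<^sub>R R' (S w))"
    "\<And>w. S (R\<^sub>e w) = R' (S w)" using resolvent_Te[OF assms] by blast
  show "resolvent (generator T\<^sub>e) \<nu> w = J (S w + (\<mu> - \<nu>) *\<^sub>R R' (S w))"
    "is_resolvent (generator T\<^sub>e) \<nu> (resolvent (generator T\<^sub>e) \<nu>)"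
    using * resolvent_eq[OF *(1)] by auto
  have "R\<^sub>e (J x) = J (R' x)"
    by (rule inj_S) (simp add: *(3) S(1) resolvent_commute[OF assms R])
  then show "resolvent (generator T\<^sub>e) \<nu> (J x) = J (R' x)" using resolvent_eq[OF *(1)] by simp
qed

lemma resolvent_Te_mu: "resolvent (generator T\<^sub>e) \<mu> w = J (S w)"
  using resolvent_Te_eq(1)[OF R] by simp

lemmas is_resolvent_Te_mu = resolvent_Te_eq(2)[OF R]

text \<open>The right-hand side depends continuously on \<open>R x\<close>, that is, on \<open>x\<close> in the norm of the
  extrapolation space.\<close>

lemma Q_in_terms_of_R: "t \<ge> 0 \<Longrightarrow> Q t x = \<mu> *\<^sub>R Q t (R x) - T t (R x) + R x"
proof -
  assume t: "t \<ge> 0"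
  have "Q t (\<mu> *\<^sub>R R x - x) = T t (R x) - R x" by (rule Q_generator[OF resolvent_in[OF R] t])
  then have "\<mu> *\<^sub>R Q t (R x) - Q t x = T t (R x) - R x"
    by (simp add: linear_diff linear_scale bounded_linear.linear[OF bounded_linear_Q])
  then show ?thesis by (simp add: algebra_simps)
qed

lemma Q_Te_range_J: "t \<ge> 0 \<Longrightarrow> e.Q t w \<in> range J"
  using resolvent_left[OF is_resolvent_Te_mu e.generator_Q, of t w]
  unfolding resolvent_Te_mu by (metis rangeI)

end

section \<open>Strong measurability and Lebesgue spaces\<close>

lemma AE_lebesgue_on_iff:
  assumes "S \<in> sets lebesgue"
  shows "(AE t in lebesgue_on S. P t) \<longleftrightarrow> (\<exists>N. negligible N \<and> (\<forall>t\<in>S - N. P t))"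
proof -
  have "(AE t in lebesgue_on S. P t) \<longleftrightarrow> (AE t in lebesgue. t \<in> S \<longrightarrow> P t)"
    using assms by (intro AE_restrict_space_iff) simp
  also have "\<dots> \<longleftrightarrow> (\<exists>N\<in>null_sets lebesgue. {t \<in> space lebesgue. \<not> (t \<in> S \<longrightarrow> P t)} \<subseteq> N)"
    by (rule eventually_ae_filter)
  also have "\<dots> \<longleftrightarrow> (\<exists>N. negligible N \<and> (\<forall>t\<in>S - N. P t))"
    unfolding negligible_iff_null_sets by auto
  finally show ?thesis .
qed

lemma ae_nonneg_iff:
  "ae_nonneg f \<longleftrightarrow> (\<forall>\<tau>>0. AE t in lebesgue_on {0..\<tau>}. 0 \<le> f t)"
proof
  assume "ae_nonneg f"
  then show "\<forall>\<tau>>0. AE t in lebesgue_on {0..\<tau>}. 0 \<le> f t"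
    by (fastforce simp: ae_nonneg_def AE_lebesgue_on_iff)
next
  assume *: "\<forall>\<tau>>0. AE t in lebesgue_on {0..\<tau>}. 0 \<le> f t"
  then have "\<forall>n. \<exists>N. negligible N \<and> (\<forall>t\<in>{0..real (Suc n)} - N. 0 \<le> f t)"
    by (simp add: AE_lebesgue_on_iff)
  then obtain N where N: "\<And>n. negligible (N n)" "\<And>n t. t \<in> {0..real (Suc n)} - N n \<Longrightarrow> 0 \<le> f t"
    by metis
  have "negligible (\<Union>n. N n)" using N(1) by (intro negligible_countable_Union) auto
  moreover have "0 \<le> f t" if "t \<in> {0..} - (\<Union>n. N n)" for t
  proof -
    obtain n :: nat where "t < real n" using reals_Archimedean2 by blast
    then show ?thesis using that by (intro N(2)[of t n]) auto
  qed
  ultimately show "ae_nonneg f" unfolding ae_nonneg_def by (subst AE_lebesgue_on_iff) auto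
qed

lemma strongly_measurable_combine:
  assumes f: "strongly_measurable M f" and g: "strongly_measurable M g"
    and h: "\<And>a b. isCont (\<lambda>(x, y). h x y) (a, b)"
  shows "strongly_measurable M (\<lambda>t. h (f t) (g t))"
proof -
  obtain s r where s: "\<And>n. simple_function M (s n)" "AE t in M. (\<lambda>n::nat. s n t) \<longlonglongrightarrow> f t"
    and r: "\<And>n. simple_function M (r n)" "AE t in M. (\<lambda>n::nat. r n t) \<longlonglongrightarrow> g t"
    using f g unfolding strongly_measurable_def by blast
  have "AE t in M. (\<lambda>n. h (s n t) (r n t)) \<longlonglongrightarrow> h (f t) (g t)"
    using s(2) r(2)
  proof eventually_elim
    case (elim t)
    have "(\<lambda>n. (s n t, r n t)) \<longlonglongrightarrow> (f t, g t)" by (intro tendsto_Pair elim)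
    from isCont_tendsto_compose[OF h this] show ?case by simp
  qed
  then show ?thesis
    unfolding strongly_measurable_def using s(1) r(1)
    by (intro exI[of _ "\<lambda>n t. h (s n t) (r n t)"]) (simp add: simple_function_compose2)
qed

text \<open>A real function of a simple function is again simple, and the exceptional null set is
  harmless because Lebesgue measure is complete.\<close>

lemma strongly_measurable_imp_borel:
  fixes f :: "real \<Rightarrow> 'b::banach" and h :: "'b \<Rightarrow> real"
  assumes f: "strongly_measurable (lebesgue_on S) f" and S: "S \<in> sets lebesgue"
    and h: "continuous_on UNIV h"
  shows "(\<lambda>t. h (f t)) \<in> borel_measurable (lebesgue_on S)"
proof -
  obtain s where s: "\<And>n. simple_function (lebesgue_on S) (s n)"
    "AE t in lebesgue_on S. (\<lambda>n::nat. s n t) \<longlonglongrightarrow> f t"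
    using f unfolding strongly_measurable_def by blast
  then obtain N where N: "N \<in> null_sets (lebesgue_on S)"
    "{t \<in> space (lebesgue_on S). \<not> (\<lambda>n. s n t) \<longlonglongrightarrow> f t} \<subseteq> N"
    unfolding eventually_ae_filter by blast
  have "(\<lambda>t. h (f t)) \<in> borel_measurable (lebesgue_on (S - N))"
  proof (rule borel_measurable_LIMSEQ_real)
    fix n
    have "simple_function (lebesgue_on S) (h \<circ> s n)" using s(1) by (rule simple_function_compose)
    then have "(\<lambda>t. h (s n t)) \<in> borel_measurable (lebesgue_on S)"
      by (simp add: borel_measurable_simple_function comp_def)
    then show "(\<lambda>t. h (s n t)) \<in> borel_measurable (lebesgue_on (S - N))"
      by (rule measurable_restrict_mono) auto
  next
    fix t assume "t \<in> space (lebesgue_on (S - N))"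
    then have "(\<lambda>n. s n t) \<longlonglongrightarrow> f t" using N(2) by auto
    moreover have "isCont h (f t)" using h by (simp add: continuous_on_eq_continuous_at)
    ultimately show "(\<lambda>n. h (s n t)) \<longlonglongrightarrow> h (f t)" by (rule isCont_tendsto_compose[rotated])
  qed
  then show ?thesis using borel_measurable_diff_null[OF N(1) S] by blast
qed

lemma powr_add_bound:
  fixes a b p :: real
  assumes "a \<ge> 0" "b \<ge> 0" "p \<ge> 0"
  shows "(a + b) powr p \<le> 2 powr p * (a powr p + b powr p)"
proof -
  have "(a + b) powr p \<le> (2 * max a b) powr p" using assms by (intro powr_mono2) auto
  also have "\<dots> = 2 powr p * max a b powr p" using assms by (simp add: powr_mult)
  also have "max a b powr p \<le> a powr p + b powr p" by (simp add: max_def)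
  finally show ?thesis by simp
qed

lemma Lp_add_diff:
  assumes "f \<in> Lp p S" "g \<in> Lp p S" "S \<in> sets lebesgue" "p \<ge> 0"
  shows "(\<lambda>t. f t + g t) \<in> Lp p S" "(\<lambda>t. f t - g t) \<in> Lp p S"
proof -
  have *: "(\<lambda>t. h (f t) (g t)) \<in> Lp p S"
    if h: "\<And>a b. isCont (\<lambda>(x, y). h x y) (a, b)" "\<And>x y. norm (h x y) \<le> norm x + norm y" for h
  proof -
    have sm: "strongly_measurable (lebesgue_on S) (\<lambda>t. h (f t) (g t))"
      by (rule strongly_measurable_combine[OF _ _ h(1)]) (use assms in \<open>simp_all add: Lp_def\<close>)
    have "integrable (lebesgue_on S) (\<lambda>t. norm (h (f t) (g t)) powr p)"
    proof (rule Bochner_Integration.integrable_bound)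
      show "integrable (lebesgue_on S) (\<lambda>t. 2 powr p * (norm (f t) powr p + norm (g t) powr p))"
        using assms by (simp add: Lp_def)
      show "(\<lambda>t. norm (h (f t) (g t)) powr p) \<in> borel_measurable (lebesgue_on S)"
        using strongly_measurable_imp_borel[OF sm assms(3), of norm]
        by (intro powr_real_measurable) (auto intro: continuous_intros)
      have "norm (h x y) powr p \<le> 2 powr p * (norm x powr p + norm y powr p)" for x y
        by (rule order_trans[OF powr_mono2[OF assms(4) _ h(2)] powr_add_bound]) (use assms in auto)
      then show "AE t in lebesgue_on S. norm (norm (h (f t) (g t)) powr p)
          \<le> norm (2 powr p * (norm (f t) powr p + norm (g t) powr p))"
        by (intro AE_I2) (simp add: abs_of_nonneg)
    qed
    then show ?thesis using sm by (simp add: Lp_def)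
  qed
  show "(\<lambda>t. f t + g t) \<in> Lp p S"
  proof (rule *)
    show "isCont (\<lambda>(x, y). x + y) (a, b)" for a b :: 'a
      unfolding split_beta by (intro continuous_intros)
  qed (rule norm_triangle_ineq)
  show "(\<lambda>t. f t - g t) \<in> Lp p S"
  proof (rule *)
    show "isCont (\<lambda>(x, y). x - y) (a, b)" for a b :: 'a
      unfolding split_beta by (intro continuous_intros)
  qed (rule norm_triangle_ineq4)
qed

lemma Lp_scaleR_continuous:
  fixes \<phi> :: "real \<Rightarrow> real" and a :: "'b::banach"
  assumes \<phi>: "continuous_on UNIV \<phi>" and p: "p \<ge> 0"
  shows "(\<lambda>t. \<phi> t *\<^sub>R a) \<in> Lp p {0..\<tau>}"
proof -
  have "\<phi> \<in> borel_measurable (lebesgue_on {0..\<tau>})"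
    by (intro continuous_imp_measurable_on_sets_lebesgue continuous_on_subset[OF \<phi>]) auto
  then obtain F where F: "\<And>i. simple_function (lebesgue_on {0..\<tau>}) (F i)"
    "\<And>t. t \<in> {0..\<tau>} \<Longrightarrow> (\<lambda>i. F i t) \<longlonglongrightarrow> \<phi> t"
    using borel_measurable_implies_sequence_metric[of \<phi> _ 0] by (metis space_lebesgue_on)
  have sm: "strongly_measurable (lebesgue_on {0..\<tau>}) (\<lambda>t. \<phi> t *\<^sub>R a)"
    unfolding strongly_measurable_def
  proof (intro exI[of _ "\<lambda>i t. F i t *\<^sub>R a"] conjI allI AE_I2)
    show "simple_function (lebesgue_on {0..\<tau>}) (\<lambda>t. F i t *\<^sub>R a)" for i
      using simple_function_compose[OF F(1), of "\<lambda>x. x *\<^sub>R a"] by (simp add: comp_def)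
  qed (auto intro!: tendsto_intros F(2))
  have "compact (\<phi> ` {0..\<tau>})"
    by (intro compact_continuous_image continuous_on_subset[OF \<phi>]) auto
  then obtain B where "\<forall>x\<in>\<phi> ` {0..\<tau>}. norm x \<le> B"
    using compact_imp_bounded bounded_iff by metis
  then have B: "\<bar>\<phi> t\<bar> \<le> B" if "t \<in> {0..\<tau>}" for t using that by auto
  interpret finite_measure "lebesgue_on {0..\<tau>}" by (rule finite_measure_lebesgue_on) simp
  have "integrable (lebesgue_on {0..\<tau>}) (\<lambda>t. norm (\<phi> t *\<^sub>R a) powr p)"
  proof (rule integrable_const_bound[where B = "(B * norm a) powr p"])
    show "AE t in lebesgue_on {0..\<tau>}. norm (norm (\<phi> t *\<^sub>R a) powr p) \<le> (B * norm a) powr p"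
      using B p by (intro AE_I2) (auto intro!: powr_mono2 mult_right_mono)
    show "(\<lambda>t. norm (\<phi> t *\<^sub>R a) powr p) \<in> borel_measurable (lebesgue_on {0..\<tau>})"
      using strongly_measurable_imp_borel[OF sm _ continuous_on_norm_id]
      by (intro powr_real_measurable) auto
  qed
  then show ?thesis using sm by (simp add: Lp_def)
qed

lemma Lp_loc_scaleR_continuous:
  "continuous_on UNIV \<phi> \<Longrightarrow> p \<ge> 0 \<Longrightarrow> (\<lambda>t. \<phi> t *\<^sub>R a) \<in> Lp_loc p"
  unfolding Lp_loc_def using Lp_scaleR_continuous by auto

lemma Lp_loc_const: "p \<ge> 0 \<Longrightarrow> (\<lambda>t. a) \<in> Lp_loc p"
  using Lp_loc_scaleR_continuous[of "\<lambda>_. 1" p a] by simp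

lemma simple_function_shift:
  fixes a b c :: real and s :: "real \<Rightarrow> 'b::zero"
  assumes s: "simple_function (lebesgue_on {a..b}) s" and ac: "a - c \<ge> 0"
  shows "simple_function (lebesgue_on {0..}) (\<lambda>t. if t \<in> {a - c..b - c} then s (t + c) else 0)"
    (is "simple_function _ ?r")
  unfolding simple_function_def
proof (intro conjI ballI)
  have "?r t \<in> insert 0 (s ` {a..b})" for t
  proof (cases "t \<in> {a - c..b - c}")
    case True
    then have "t + c \<in> {a..b}" by auto
    then show ?thesis by simp
  qed auto
  then have "?r ` space (lebesgue_on {0..}) \<subseteq> insert 0 (s ` {a..b})" by blast
  moreover have "finite (s ` {a..b})" using simple_functionD(1)[OF s] by simp
  ultimately show "finite (?r ` space (lebesgue_on {0..}))" by (meson finite.insertI finite_subset)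
  fix y
  have "s -` {y} \<inter> {a..b} \<in> sets (lebesgue_on {a..b})" using simple_functionD(2)[OF s, of "{y}"] by simp
  then have "s -` {y} \<inter> {a..b} \<in> sets lebesgue" by (simp add: sets_restrict_space_iff)
  then have 1: "(\<lambda>x. - c + x) ` (s -` {y} \<inter> {a..b}) \<in> sets lebesgue" by (rule lebesgue_sets_translation)
  have "?r -` {y} \<inter> {0..} = (\<lambda>x. - c + x) ` (s -` {y} \<inter> {a..b}) \<union> (if y = 0 then {0..} - {a - c..b - c} else {})"
  proof (rule set_eqI)
    fix t
    have "t \<in> (\<lambda>x. - c + x) ` (s -` {y} \<inter> {a..b}) \<longleftrightarrow> t \<in> {a - c..b - c} \<and> s (t + c) = y"
    proof
      assume "t \<in> {a - c..b - c} \<and> s (t + c) = y"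
      then show "t \<in> (\<lambda>x. - c + x) ` (s -` {y} \<inter> {a..b})" by (intro image_eqI[of _ _ "t + c"]) auto
    qed auto
    then show "t \<in> ?r -` {y} \<inter> {0..} \<longleftrightarrow>
        t \<in> (\<lambda>x. - c + x) ` (s -` {y} \<inter> {a..b}) \<union> (if y = 0 then {0..} - {a - c..b - c} else {})"
      using ac by auto
  qed
  then have "?r -` {y} \<inter> {0..} \<in> sets lebesgue" using 1 by auto
  then show "?r -` {y} \<inter> space (lebesgue_on {0..}) \<in> sets (lebesgue_on {0..})"
    by (simp add: sets_restrict_space_iff)
qed

text \<open>Integrability of the norm is a statement on real functions, for which the
  Henstock-Kurzweil integral with its translation rules can be used.\<close>

lemma Lp_shift:
  fixes u :: "real \<Rightarrow> 'b::banach"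
  assumes u: "u \<in> Lp p {a..b}" and ac: "a - c \<ge> 0"
  shows "(\<lambda>t. if t \<in> {a - c..b - c} then u (t + c) else 0) \<in> Lp p {0..}" (is "?v \<in> _")
proof -
  obtain s where s: "\<And>n. simple_function (lebesgue_on {a..b}) (s n)"
    and lim: "AE t in lebesgue_on {a..b}. (\<lambda>n::nat. s n t) \<longlonglongrightarrow> u t"
    using u unfolding Lp_def strongly_measurable_def by blast
  obtain N where N: "negligible N" "\<And>t. t \<in> {a..b} - N \<Longrightarrow> (\<lambda>n. s n t) \<longlonglongrightarrow> u t"
    using lim by (auto simp: AE_lebesgue_on_iff)
  define r where "r n t = (if t \<in> {a - c..b - c} then s n (t + c) else 0)" for n t
  have "negligible ((+) (- c) ` N)" using N(1) by (rule negligible_translation)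
  moreover have "(\<lambda>n. r n t) \<longlonglongrightarrow> ?v t" if "t \<in> {0..} - (+) (- c) ` N" for t
  proof -
    have "t + c \<notin> N" using that by (auto simp: image_iff)
    then show ?thesis unfolding r_def using N(2)[of "t + c"] by auto
  qed
  ultimately have "\<exists>N. negligible N \<and> (\<forall>t\<in>{0..} - N. (\<lambda>n. r n t) \<longlonglongrightarrow> ?v t)" by blast
  then have "AE t in lebesgue_on {0..}. (\<lambda>n. r n t) \<longlonglongrightarrow> ?v t"
    by (subst AE_lebesgue_on_iff) auto
  then have sm: "strongly_measurable (lebesgue_on {0..}) ?v"
    unfolding strongly_measurable_def using simple_function_shift[OF s ac]
    by (intro exI[of _ r] conjI allI) (simp_all add: r_def[abs_def])
  have iff: "integrable (lebesgue_on S) g \<longleftrightarrow> g integrable_on S"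
    if "\<And>t. 0 \<le> g t" "S \<in> sets lebesgue" for g :: "real \<Rightarrow> real" and S
  proof -
    have "integrable (lebesgue_on S) g \<longleftrightarrow> g absolutely_integrable_on S"
      unfolding set_integrable_def using that(2) by (intro integrable_restrict_space) simp
    then show ?thesis using absolutely_integrable_on_iff_nonneg[of S g] that(1) by blast
  qed
  have "(\<lambda>t. norm (u t) powr p) integrable_on {a..b}"
    using u by (subst iff[symmetric]) (auto simp: Lp_def)
  then have "((\<lambda>t. norm (u t) powr p) \<circ> (+) c) integrable_on {a - c..b - c}"
    by (subst integrable_on_shift_Icc_real) simp
  moreover have "{a - c..b - c} \<inter> {0..} = {a - c..b - c}" using ac by auto
  ultimately have "(\<lambda>t. if t \<in> {a - c..b - c} then ((\<lambda>t. norm (u t) powr p) \<circ> (+) c) t else 0) integrable_on {0..}"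
    by (subst integrable_restrict_Int, simp only:)
  also have "(\<lambda>t. if t \<in> {a - c..b - c} then ((\<lambda>t. norm (u t) powr p) \<circ> (+) c) t else 0)
      = (\<lambda>t. norm (?v t) powr p)" by (auto simp: add.commute)
  finally have "integrable (lebesgue_on {0..}) (\<lambda>t. norm (?v t) powr p)" by (subst iff) auto
  then show ?thesis using sm by (simp add: Lp_def)
qed

lemma Lp_subinterval:
  assumes "u \<in> Lp p {a..b}" "a \<le> a'" "b' \<le> b"
  shows "u \<in> Lp p {a'..b'}"
proof -
  have sub: "{a'..b'} \<subseteq> {a..b}" using assms by auto
  obtain s where s: "\<And>n. simple_function (lebesgue_on {a..b}) (s n)"
    and lim: "AE t in lebesgue_on {a..b}. (\<lambda>n::nat. s n t) \<longlonglongrightarrow> u t"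
    using assms unfolding Lp_def strongly_measurable_def by blast
  have "simple_function (lebesgue_on {a'..b'}) (s n)" for n
    unfolding simple_function_def
  proof (intro conjI ballI)
    show "finite (s n ` space (lebesgue_on {a'..b'}))"
      using simple_functionD(1)[OF s, of n] by (simp add: finite_subset[OF image_mono[OF sub]])
    fix y
    have "s n -` {y} \<inter> {a..b} \<in> sets lebesgue"
      using simple_functionD(2)[OF s, of n "{y}"] by (simp add: sets_restrict_space_iff)
    moreover have "s n -` {y} \<inter> {a'..b'} = s n -` {y} \<inter> {a..b} \<inter> {a'..b'}" using sub by auto
    ultimately show "s n -` {y} \<inter> space (lebesgue_on {a'..b'}) \<in> sets (lebesgue_on {a'..b'})"
      using sets.Int[of _ lebesgue "{a'..b'}"] by (simp add: sets_restrict_space_iff)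
  qed
  moreover have "AE t in lebesgue_on {a'..b'}. (\<lambda>n::nat. s n t) \<longlonglongrightarrow> u t"
    using lim sub by (fastforce simp: AE_lebesgue_on_iff)
  moreover have "integrable (lebesgue_on {a'..b'}) (\<lambda>t. norm (u t) powr p)"
  proof -
    have "set_integrable lebesgue {a..b} (\<lambda>t. norm (u t) powr p)"
      using assms(1) by (simp add: Lp_def integrable_restrict_space set_integrable_def)
    then have "set_integrable lebesgue {a'..b'} (\<lambda>t. norm (u t) powr p)"
      by (rule set_integrable_subset) (use sub in auto)
    then show ?thesis by (simp add: integrable_restrict_space set_integrable_def)
  qed
  ultimately show ?thesis unfolding Lp_def strongly_measurable_def by blast
qed

lemma Lp_norm_nonneg [simp]: "0 \<le> Lp_norm p S f"
  by (simp add: Lp_norm_def)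

lemma Lp_norm_powr:
  assumes "p > 0"
  shows "Lp_norm p S f powr p = (LINT t|lebesgue_on S. norm (f t) powr p)"
  using assms by (simp add: Lp_norm_def powr_powr)

text \<open>The distance to the positive cone is at most the distance to any positive function, so it
  vanishes almost everywhere for an \<open>L\<^sup>p\<close> limit of positive functions.\<close>

lemma Lp_loc_limit_nonneg:
  fixes f :: "nat \<Rightarrow> real \<Rightarrow> 'b::banach_lattice"
  assumes p: "1 \<le> p" and f: "\<And>n. f n \<in> Lp_loc p" and g: "g \<in> Lp_loc p"
    and lim: "Lp_loc_tendsto p f g"
    and nonneg: "\<And>\<tau>. \<tau> > 0 \<Longrightarrow> \<forall>\<^sub>F n in sequentially. AE t in lebesgue_on {0..\<tau>}. 0 \<le> f n t"
  shows "ae_nonneg g"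
  unfolding ae_nonneg_iff
proof (intro allI impI)
  fix \<tau> :: real assume \<tau>: "\<tau> > 0"
  let ?C = "{x::'b. 0 \<le> x}" and ?M = "lebesgue_on {0..\<tau>}"
  have gL: "g \<in> Lp p {0..\<tau>}" and fL: "f n \<in> Lp p {0..\<tau>}" for n
    using f g \<tau> by (auto simp: Lp_loc_def)
  define d where "d t = infdist (g t) ?C powr p" for t
  have d: "integrable ?M d"
  proof (rule Bochner_Integration.integrable_bound)
    show "integrable ?M (\<lambda>t. norm (g t) powr p)" using gL by (simp add: Lp_def)
    have "(\<lambda>t. infdist (g t) ?C) \<in> borel_measurable ?M"
      using gL by (intro strongly_measurable_imp_borel[where h = "\<lambda>x. infdist x ?C"])
        (auto simp: Lp_def intro!: continuous_intros)
    then show "d \<in> borel_measurable ?M" unfolding d_def by (intro powr_real_measurable) auto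
    have "infdist x ?C \<le> norm x" for x :: 'b using infdist_le[of 0 ?C x] by simp
    then have "d t \<le> norm (g t) powr p" for t
      unfolding d_def using p by (intro powr_mono2) (auto simp: infdist_nonneg)
    then show "AE t in ?M. norm (d t) \<le> norm (norm (g t) powr p)" by (simp add: d_def)
  qed
  have "(LINT t|?M. d t) \<le> 0"
  proof (rule tendsto_lowerbound)
    have "(\<lambda>n. Lp_norm p {0..\<tau>} (\<lambda>t. f n t - g t) powr p) \<longlonglongrightarrow> 0 powr p"
      using lim \<tau> p by (intro tendsto_powr') (auto simp: Lp_loc_tendsto_def)
    then show "(\<lambda>n. LINT t|?M. norm (f n t - g t) powr p) \<longlonglongrightarrow> 0"
      using p by (simp add: Lp_norm_powr)
    show "\<forall>\<^sub>F n in sequentially. (LINT t|?M. d t) \<le> (LINT t|?M. norm (f n t - g t) powr p)"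
      using nonneg[OF \<tau>]
    proof eventually_elim
      case (elim n)
      show ?case
      proof (rule integral_mono_AE[OF d])
        show "integrable ?M (\<lambda>t. norm (f n t - g t) powr p)"
          using Lp_add_diff(2)[OF fL gL] p by (simp add: Lp_def)
        show "AE t in ?M. d t \<le> norm (f n t - g t) powr p"
          using elim
        proof eventually_elim
          case (elim t)
          then have "infdist (g t) ?C \<le> norm (f n t - g t)"
            using infdist_le[of "f n t" ?C "g t"] by (simp add: dist_norm norm_minus_commute)
          then show ?case unfolding d_def using p by (intro powr_mono2) (auto simp: infdist_nonneg)
        qed
      qed
    qed
  qed simp
  moreover have "(LINT t|?M. d t) \<ge> 0" by (rule Bochner_Integration.integral_nonneg) (simp add: d_def)
  ultimately have "(LINT t|?M. d t) = 0" by simp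
  moreover have "AE t in ?M. 0 \<le> d t" by (simp add: d_def)
  ultimately have "AE t in ?M. d t = 0"
    using integral_nonneg_eq_0_iff_AE[OF d] by blast
  then show "AE t in ?M. 0 \<le> g t"
  proof eventually_elim
    case (elim t)
    then have "infdist (g t) ?C = 0" using p by (simp add: d_def)
    moreover have "?C \<noteq> {}" by (auto intro: exI[of _ 0])
    ultimately show ?case using in_closed_iff_infdist_zero[OF closed_nonneg, of "g t"] by simp
  qed
qed

section \<open>Density of smooth positive inputs\<close>

text \<open>A measurable function is an almost everywhere limit of continuous ones, which are
  approximated uniformly by polynomials. Adding \<open>1 / (n + 1)\<close> keeps these positive on \<open>[0, \<tau>]\<close>, and
  the factor \<open>1 - exp (- n t)\<close> enforces the value \<open>0\<close> at \<open>0\<close>.\<close>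

lemma indicator_approx_C1:
  fixes \<tau> \<delta> p :: real
  assumes E: "E \<in> sets lebesgue" and p: "p > 0" and \<delta>: "\<delta> > 0"
  obtains \<phi> \<phi>' where "\<And>t. (\<phi> has_real_derivative \<phi>' t) (at t)" "continuous_on UNIV \<phi>'" "\<phi> 0 = 0"
    "\<And>t. t \<in> {0..\<tau>} \<Longrightarrow> 0 \<le> \<phi> t" "(LINT t|lebesgue_on {0..\<tau>}. \<bar>\<phi> t - indicat_real E t\<bar> powr p) < \<delta>"
proof -
  let ?M = "lebesgue_on {0..\<tau>}"
  obtain N g where N: "negligible N" and g: "\<And>n. continuous_on UNIV (g n)"
    and lim: "\<And>t. t \<notin> N \<Longrightarrow> (\<lambda>n::nat. g n t) \<longlonglongrightarrow> indicat_real E t"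
    using indicator_measurable_on[OF E] unfolding measurable_on_def by auto
  define h where "h n t = max 0 (min 1 (g n t))" for n t
  have h: "continuous_on {0..\<tau>} (h n)" for n
    unfolding h_def by (intro continuous_intros continuous_on_subset[OF g]) auto
  have h01: "0 \<le> h n t" "h n t \<le> 1" for n t by (auto simp: h_def)
  have hlim: "(\<lambda>n. h n t) \<longlonglongrightarrow> indicat_real E t" if "t \<notin> N" for t
  proof -
    have "(\<lambda>n. h n t) \<longlonglongrightarrow> max 0 (min 1 (indicat_real E t))"
      unfolding h_def by (intro tendsto_intros lim that)
    then show ?thesis by (simp add: indicator_def split: if_splits)
  qed
  have "\<exists>q. real_polynomial_function q \<and> (\<forall>t\<in>{0..\<tau>}. \<bar>h n t - q t\<bar> < 1 / (real n + 1))" for n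
  proof (rule Stone_Weierstrass_real_polynomial_function[OF compact_Icc h])
    show "0 < 1 / (real n + 1)" by simp
    fix r assume "real_polynomial_function r" "\<And>t. t \<in> {0..\<tau>} \<Longrightarrow> \<bar>h n t - r t\<bar> < 1 / (real n + 1)"
    then show ?thesis by blast
  qed
  then obtain q where q: "\<And>n. real_polynomial_function (q n)"
    "\<And>n t. t \<in> {0..\<tau>} \<Longrightarrow> \<bar>h n t - q n t\<bar> < 1 / (real n + 1)" by metis
  have "\<exists>q'. real_polynomial_function q' \<and> (\<forall>t. (q n has_real_derivative q' t) (at t))" for n
    using has_real_derivative_polynomial_function[OF q(1)] by blast
  then obtain q' where q': "\<And>n. real_polynomial_function (q' n)"
    "\<And>n t. (q n has_real_derivative q' n t) (at t)" by metis
  define \<phi> where "\<phi> n t = (q n t + 1 / (real n + 1)) * (1 - exp (- (real n * t)))" for n t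
  define \<phi>' where "\<phi>' n t = q' n t * (1 - exp (- (real n * t))) +
    (q n t + 1 / (real n + 1)) * (real n * exp (- (real n * t)))" for n t
  have 1: "(\<phi> n has_real_derivative \<phi>' n t) (at t)" for n t
    unfolding \<phi>_def \<phi>'_def by (auto intro!: derivative_eq_intros q')
  have contq: "continuous_on UNIV (q n)" "continuous_on UNIV (q' n)" for n
    using q(1) q'(1) by (simp_all add: continuous_real_polymonial_function continuous_at_imp_continuous_on)
  have 2: "continuous_on UNIV (\<phi>' n)" for n
    unfolding \<phi>'_def by (intro continuous_intros contq)
  have q0: "0 \<le> q n t + 1 / (real n + 1)" "q n t + 1 / (real n + 1) \<le> 3" if "t \<in> {0..\<tau>}" for n t
  proof -
    have "1 / (real n + 1) \<le> 1" by simp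
    then show "0 \<le> q n t + 1 / (real n + 1)" "q n t + 1 / (real n + 1) \<le> 3"
      using q(2)[OF that, of n] h01[of n t] by linarith+
  qed
  have e0: "0 \<le> 1 - exp (- (real n * t))" "1 - exp (- (real n * t)) \<le> 1" if "t \<in> {0..\<tau>}" for n t
    using that by auto
  have 4: "0 \<le> \<phi> n t" "\<phi> n t \<le> 3" if "t \<in> {0..\<tau>}" for n t
    using q0[OF that, of n] e0[OF that, of n] mult_mono[of "q n t + 1 / (real n + 1)" 3 "1 - exp (- (real n * t))" 1]
    unfolding \<phi>_def by auto
  have plim: "(\<lambda>n. \<phi> n t) \<longlonglongrightarrow> indicat_real E t" if t: "t \<in> {0..\<tau>}" "t \<notin> N" "t \<noteq> 0" for t
  proof -
    have inv: "(\<lambda>n. 1 / (real n + 1)) \<longlonglongrightarrow> 0" by real_asymp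
    have "(\<lambda>n. h n t - q n t) \<longlonglongrightarrow> 0"
      by (rule Lim_null_comparison[OF _ inv]) (use q(2)[OF t(1)] in \<open>auto intro!: always_eventually less_imp_le\<close>)
    from tendsto_diff[OF hlim[OF t(2)] this] have "(\<lambda>n. q n t) \<longlonglongrightarrow> indicat_real E t" by simp
    moreover have "(\<lambda>n. exp (- (real n * t))) \<longlonglongrightarrow> 0" using t by real_asymp
    ultimately have "(\<lambda>n. (q n t + 1 / (real n + 1)) * (1 - exp (- (real n * t))))
        \<longlonglongrightarrow> (indicat_real E t + 0) * (1 - 0)"
      by (intro tendsto_intros inv)
    then show ?thesis by (simp add: \<phi>_def)
  qed
  interpret finite_measure ?M by (rule finite_measure_lebesgue_on) simp
  have Em: "indicat_real E \<in> borel_measurable ?M"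
    by (rule measurable_restrict_space1[OF borel_measurable_indicator[OF E]])
  have \<phi>m: "\<phi> n \<in> borel_measurable ?M" for n
    unfolding \<phi>_def
    by (intro continuous_imp_measurable_on_sets_lebesgue continuous_intros continuous_on_subset[OF contq(1)]) auto
  have "(\<lambda>n. LINT t|?M. \<bar>\<phi> n t - indicat_real E t\<bar> powr p) \<longlonglongrightarrow> (LINT t|?M. 0)"
  proof (rule integral_dominated_convergence[where w = "\<lambda>_. 4 powr p"])
    show "(\<lambda>t. \<bar>\<phi> n t - indicat_real E t\<bar> powr p) \<in> borel_measurable ?M" for n
      by (intro powr_real_measurable borel_measurable_abs borel_measurable_diff \<phi>m Em) auto
    have "AE t in ?M. t \<notin> insert 0 N"
      using N by (subst AE_lebesgue_on_iff) (auto intro!: exI[of _ "insert 0 N"])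
    then show "AE t in ?M. (\<lambda>n. \<bar>\<phi> n t - indicat_real E t\<bar> powr p) \<longlonglongrightarrow> 0"
    proof (rule AE_mp, intro AE_I2 impI)
      fix t assume t: "t \<in> space ?M" "t \<notin> insert 0 N"
      have "(\<lambda>n. \<bar>\<phi> n t - indicat_real E t\<bar>) \<longlonglongrightarrow> \<bar>indicat_real E t - indicat_real E t\<bar>"
        by (intro tendsto_intros plim) (use t in auto)
      then have "(\<lambda>n. \<bar>\<phi> n t - indicat_real E t\<bar> powr p) \<longlonglongrightarrow> 0 powr p"
        using p by (intro tendsto_powr') auto
      then show "(\<lambda>n. \<bar>\<phi> n t - indicat_real E t\<bar> powr p) \<longlonglongrightarrow> 0" by simp
    qed
    have "\<bar>\<phi> n t - indicat_real E t\<bar> \<le> 4" if "t \<in> {0..\<tau>}" for n t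
      using 4[OF that, of n] by (auto simp: indicator_def)
    then show "AE t in ?M. norm (\<bar>\<phi> n t - indicat_real E t\<bar> powr p) \<le> 4 powr p" for n
      using p by (intro AE_I2) (auto intro!: powr_mono2)
  qed auto
  then have "\<forall>\<^sub>F n in sequentially. (LINT t|?M. \<bar>\<phi> n t - indicat_real E t\<bar> powr p) < \<delta>"
    using \<delta> by (intro order_tendstoD) auto
  then obtain n where "(LINT t|?M. \<bar>\<phi> n t - indicat_real E t\<bar> powr p) < \<delta>"
    by (auto simp: eventually_sequentially)
  then show ?thesis using that[of "\<phi> n" "\<phi>' n"] 1 2 4 by (simp add: \<phi>_def)
qed

text \<open>Only the values on \<open>[0, \<tau>]\<close> are required to be positive: the approximants come from
  polynomials, which cannot be controlled on the whole half-line.\<close>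

inductive smooth_positive_input :: "real \<Rightarrow> (real \<Rightarrow> 'u::banach_lattice) \<Rightarrow> bool" for \<tau> where
  zero: "smooth_positive_input \<tau> (\<lambda>t. 0)"
| add: "smooth_positive_input \<tau> v \<Longrightarrow> 0 \<le> a \<Longrightarrow> (\<And>t. (\<phi> has_real_derivative \<phi>' t) (at t)) \<Longrightarrow>
    continuous_on UNIV \<phi>' \<Longrightarrow> \<phi> 0 = 0 \<Longrightarrow> (\<And>t. t \<in> {0..\<tau>} \<Longrightarrow> 0 \<le> \<phi> t) \<Longrightarrow>
    smooth_positive_input \<tau> (\<lambda>t. v t + \<phi> t *\<^sub>R a)"

lemma continuous_on_C1:
  fixes \<phi> :: "real \<Rightarrow> real"
  shows "(\<And>t. (\<phi> has_real_derivative \<phi>' t) (at t)) \<Longrightarrow> continuous_on S \<phi>"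
  by (meson DERIV_isCont continuous_at_imp_continuous_on)

lemma smooth_positive_input_Lp_loc:
  assumes "smooth_positive_input \<tau> v" "p \<ge> 0" shows "v \<in> Lp_loc p"
  using assms(1)
proof induction
  case zero
  then show ?case using Lp_loc_const assms(2) by blast
next
  case (add v a \<phi> \<phi>')
  have "(\<lambda>t. \<phi> t *\<^sub>R a) \<in> Lp_loc p"
    using assms(2) add by (intro Lp_loc_scaleR_continuous continuous_on_C1)
  then show ?case
    using add.IH assms(2) unfolding Lp_loc_def by (auto intro!: Lp_add_diff(1))
qed

lemma smooth_positive_input_nonneg:
  "smooth_positive_input \<tau> v \<Longrightarrow> t \<in> {0..\<tau>} \<Longrightarrow> 0 \<le> v t"
  by (induction rule: smooth_positive_input.induct) (auto intro!: add_nonneg_nonneg scaleR_nonneg_nonneg)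

lemma Lp_indicator:
  assumes "E \<in> sets lebesgue" "p > 0"
  shows "(\<lambda>t. indicat_real E t *\<^sub>R y) \<in> Lp p {0..\<tau>}"
proof -
  have E: "E \<inter> {0..\<tau>} \<in> sets (lebesgue_on {0..\<tau>})"
    using assms(1) by (auto simp: sets_restrict_space)
  have m: "indicat_real E \<in> borel_measurable (lebesgue_on {0..\<tau>})"
    by (rule measurable_restrict_space1[OF borel_measurable_indicator[OF assms(1)]])
  have "simple_function (lebesgue_on {0..\<tau>}) (indicat_real E)"
  proof (rule simple_function_borel_measurable[OF m])
    have "indicat_real E ` space (lebesgue_on {0..\<tau>}) \<subseteq> {0, 1}" by (auto simp: indicator_def)
    then show "finite (indicat_real E ` space (lebesgue_on {0..\<tau>}))" by (rule finite_subset) simp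
  qed
  then have "simple_function (lebesgue_on {0..\<tau>}) (\<lambda>t. indicat_real E t *\<^sub>R y)"
    using simple_function_compose[where g = "\<lambda>x. x *\<^sub>R y"] by (fastforce simp: comp_def)
  then have "strongly_measurable (lebesgue_on {0..\<tau>}) (\<lambda>t. indicat_real E t *\<^sub>R y)"
    unfolding strongly_measurable_def by (intro exI[of _ "\<lambda>n t. indicat_real E t *\<^sub>R y"]) simp
  moreover have "integrable (lebesgue_on {0..\<tau>}) (\<lambda>t. norm (indicat_real E t *\<^sub>R y) powr p)"
  proof -
    interpret finite_measure "lebesgue_on {0..\<tau>}" by (rule finite_measure_lebesgue_on) simp
    have "integrable (lebesgue_on {0..\<tau>}) (\<lambda>t. indicat_real E t * (norm y powr p))"
    proof (rule integrable_const_bound[where B = "norm y powr p"])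
      show "(\<lambda>t. indicat_real E t * (norm y powr p)) \<in> borel_measurable (lebesgue_on {0..\<tau>})"
        by (rule borel_measurable_times[OF m borel_measurable_const])
    qed (simp add: indicator_def)
    also have "(\<lambda>t. indicat_real E t * (norm y powr p)) = (\<lambda>t. norm (indicat_real E t *\<^sub>R y) powr p)"
      using assms(2) by (auto simp: indicator_def)
    finally show ?thesis .
  qed
  ultimately show ?thesis by (simp add: Lp_def)
qed

lemma Lp_integral_add_bound:
  assumes "f \<in> Lp p S" "g \<in> Lp p S" "S \<in> sets lebesgue" "p \<ge> 0"
  shows "(LINT t|lebesgue_on S. norm (f t + g t) powr p) \<le>
    2 powr p * ((LINT t|lebesgue_on S. norm (f t) powr p) + (LINT t|lebesgue_on S. norm (g t) powr p))"
proof -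
  have "(LINT t|lebesgue_on S. norm (f t + g t) powr p)
      \<le> (LINT t|lebesgue_on S. 2 powr p * (norm (f t) powr p + norm (g t) powr p))"
  proof (rule integral_mono)
    show "norm (f t + g t) powr p \<le> 2 powr p * (norm (f t) powr p + norm (g t) powr p)" for t
      by (rule order_trans[OF powr_mono2[OF assms(4) _ norm_triangle_ineq] powr_add_bound])
        (use assms in auto)
  qed (use Lp_add_diff(1)[OF assms] assms in \<open>auto simp: Lp_def\<close>)
  also have "\<dots> = 2 powr p * ((LINT t|lebesgue_on S. norm (f t) powr p) + (LINT t|lebesgue_on S. norm (g t) powr p))"
    using assms by (simp add: Lp_def Bochner_Integration.integral_add)
  finally show ?thesis .
qed

text \<open>A simple function is a finite sum of terms \<open>1\<^sub>E y\<close> with \<open>y \<ge> 0\<close>; each indicator is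
  replaced by a smooth function. The tolerance shrinks by the factor \<open>2 * 2 powr p\<close> with each term,
  as \<open>\<integral> \<parallel>f\<parallel>\<^sup>p\<close> is subadditive up to \<open>2 powr p\<close> only.\<close>

lemma simple_function_approx:
  fixes s :: "real \<Rightarrow> 'u::banach_lattice"
  assumes s: "simple_function (lebesgue_on {0..\<tau>}) s" and nonneg: "\<And>t. t \<in> {0..\<tau>} \<Longrightarrow> 0 \<le> s t"
    and p: "p > 0" and \<epsilon>: "\<epsilon> > 0"
  obtains v where "smooth_positive_input \<tau> v" "(\<lambda>t. v t - s t) \<in> Lp p {0..\<tau>}"
    "(LINT t|lebesgue_on {0..\<tau>}. norm (v t - s t) powr p) < \<epsilon>"
proof -
  let ?M = "lebesgue_on {0..\<tau>}"
  define E where "E y = s -` {y} \<inter> {0..\<tau>}" for y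
  let ?I = "\<lambda>F t. \<Sum>y\<in>F. indicat_real (E y) t *\<^sub>R y"
  have E: "E y \<in> sets lebesgue" for y
    using simple_functionD(2)[OF s, of "{y}"] by (simp add: E_def sets_restrict_space_iff)
  have "\<exists>v. smooth_positive_input \<tau> v \<and> (\<lambda>t. v t - ?I F t) \<in> Lp p {0..\<tau>} \<and>
      (LINT t|?M. norm (v t - ?I F t) powr p) < \<epsilon>"
    if "finite F" "F \<subseteq> s ` {0..\<tau>}" "\<epsilon> > 0" for F \<epsilon>
    using that
  proof (induction F arbitrary: \<epsilon> rule: finite_induct)
    case empty
    have "(\<lambda>t. 0::'u) \<in> Lp p {0..\<tau>}"
      using Lp_scaleR_continuous[of "\<lambda>_. 0" p] p by simp
    then show ?case using empty p by (intro exI[of _ "\<lambda>t. 0"]) (simp add: smooth_positive_input.zero)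
  next
    case (insert y F)
    define \<epsilon>' where "\<epsilon>' = \<epsilon> / (2 * 2 powr p)"
    have \<epsilon>': "\<epsilon>' > 0" using insert.prems by (simp add: \<epsilon>'_def)
    obtain v where v: "smooth_positive_input \<tau> v"
      "(\<lambda>t. v t - ?I F t) \<in> Lp p {0..\<tau>}"
      "(LINT t|?M. norm (v t - ?I F t) powr p) < \<epsilon>'"
      using insert.IH[OF _ \<epsilon>'] insert.prems by auto
    obtain \<phi> \<phi>' where \<phi>: "\<And>t. (\<phi> has_real_derivative \<phi>' t) (at t)" "continuous_on UNIV \<phi>'" "\<phi> 0 = 0"
      "\<And>t. t \<in> {0..\<tau>} \<Longrightarrow> 0 \<le> \<phi> t"
      "(LINT t|?M. \<bar>\<phi> t - indicat_real (E y) t\<bar> powr p) < \<epsilon>' / (norm y powr p + 1)"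
    proof (rule indicator_approx_C1[OF E p, of "\<epsilon>' / (norm y powr p + 1)" \<tau> y])
      show "\<epsilon>' / (norm y powr p + 1) > 0" using \<epsilon>' by (simp add: add_nonneg_pos)
    qed blast
    let ?d = "\<lambda>t. (\<phi> t - indicat_real (E y) t) *\<^sub>R y"
    have "0 \<le> y" using insert.prems nonneg by auto
    then have v': "smooth_positive_input \<tau> (\<lambda>t. v t + \<phi> t *\<^sub>R y)"
      using smooth_positive_input.add[OF v(1) _ \<phi>(1-4)] by blast
    have d: "?d \<in> Lp p {0..\<tau>}"
      unfolding scaleR_diff_left using p
      by (intro Lp_add_diff(2) Lp_indicator[OF E] Lp_scaleR_continuous continuous_on_C1[OF \<phi>(1)]) auto
    have "(LINT t|?M. norm (?d t) powr p) = norm y powr p * (LINT t|?M. \<bar>\<phi> t - indicat_real (E y) t\<bar> powr p)"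
      by (simp add: powr_mult mult.commute)
    also have "\<dots> \<le> norm y powr p * (\<epsilon>' / (norm y powr p + 1))"
      using \<phi>(5) by (intro mult_left_mono) auto
    also have "\<dots> \<le> \<epsilon>'"
    proof -
      have "norm y powr p / (norm y powr p + 1) \<le> 1" by (simp add: add_nonneg_pos)
      from mult_left_mono[OF this less_imp_le[OF \<epsilon>']] show ?thesis by (simp add: mult.commute)
    qed
    finally have dn: "(LINT t|?M. norm (?d t) powr p) \<le> \<epsilon>'" .
    have eq: "v t + \<phi> t *\<^sub>R y - ?I (insert y F) t =
        (v t - ?I F t) + ?d t" for t
      unfolding sum.insert[OF insert.hyps] scaleR_diff_left by (simp only: algebra_simps)
    have "(LINT t|?M. norm ((v t - ?I F t) + ?d t) powr p) \<le>
        2 powr p * ((LINT t|?M. norm (v t - ?I F t) powr p) +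
          (LINT t|?M. norm (?d t) powr p))"
      using p by (intro Lp_integral_add_bound v(2) d) auto
    also have "\<dots> < 2 powr p * (\<epsilon>' + \<epsilon>')"
      using v(3) dn by (intro mult_strict_left_mono) auto
    also have "\<dots> = \<epsilon>" by (simp add: \<epsilon>'_def)
    finally have "(LINT t|?M. norm ((v t - ?I F t) + ?d t) powr p) < \<epsilon>" .
    moreover have "(\<lambda>t. (v t - ?I F t) + ?d t) \<in> Lp p {0..\<tau>}"
      using p by (intro Lp_add_diff(1) v(2) d) auto
    ultimately show ?case
      using v' by (intro exI[of _ "\<lambda>t. v t + \<phi> t *\<^sub>R y"]) (simp only: eq simp_thms)
  qed
  from this[OF _ order_refl \<epsilon>] obtain v where v: "smooth_positive_input \<tau> v"
    "(\<lambda>t. v t - ?I (s ` {0..\<tau>}) t) \<in> Lp p {0..\<tau>}"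
    "(LINT t|?M. norm (v t - ?I (s ` {0..\<tau>}) t) powr p) < \<epsilon>"
    using simple_functionD(1)[OF s] by auto
  have rep: "?I (s ` {0..\<tau>}) t = s t" if "t \<in> {0..\<tau>}" for t
  proof -
    have "?I (s ` {0..\<tau>}) t = (\<Sum>y\<in>s ` {0..\<tau>}. if y = s t then y else 0)"
      using that by (intro sum.cong) (auto simp: E_def indicator_def)
    then show ?thesis using simple_functionD(1)[OF s] that by simp
  qed
  have "strongly_measurable ?M (\<lambda>t. v t - s t)"
  proof (rule strongly_measurable_combine[of ?M v s "\<lambda>x y. x - y"])
    show "strongly_measurable ?M v"
    proof (cases "\<tau> > 0")
      case True
      then show ?thesis using smooth_positive_input_Lp_loc[OF v(1), of p] p by (simp add: Lp_loc_def Lp_def)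
    next
      case False
      have "v 0 = 0" using v(1) by induction auto
      then have "\<forall>t\<in>{0..\<tau>}. v t = 0" using False by (metis antisym atLeastAtMost_iff not_less order_trans)
      then show ?thesis unfolding strongly_measurable_def by (intro exI[of _ "\<lambda>n t. 0"]) auto
    qed
    show "strongly_measurable ?M s" unfolding strongly_measurable_def using s by (intro exI[of _ "\<lambda>n. s"]) auto
    show "isCont (\<lambda>(x, y). x - y) (a, b)" for a b :: 'u
      unfolding split_beta by (intro continuous_intros)
  qed
  moreover have "integrable ?M (\<lambda>t. norm (v t - s t) powr p)"
    using v(2) by (subst Bochner_Integration.integrable_cong[OF refl, where g = "\<lambda>t. norm (v t - ?I (s ` {0..\<tau>}) t) powr p"])
      (auto simp: rep Lp_def)
  ultimately have "(\<lambda>t. v t - s t) \<in> Lp p {0..\<tau>}" by (simp add: Lp_def)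
  moreover have "(LINT t|?M. norm (v t - s t) powr p) = (LINT t|?M. norm (v t - ?I (s ` {0..\<tau>}) t) powr p)"
    by (rule Bochner_Integration.integral_cong) (auto simp: rep)
  ultimately show ?thesis using that v by simp
qed

lemma positive_approx_finite_time:
  fixes u :: "real \<Rightarrow> 'u::banach_lattice"
  assumes u: "u \<in> Lp p {0..\<tau>}" and nonneg: "AE t in lebesgue_on {0..\<tau>}. 0 \<le> u t"
    and p: "p > 0" and \<epsilon>: "\<epsilon> > 0"
  obtains v where "smooth_positive_input \<tau> v" "(\<lambda>t. v t - u t) \<in> Lp p {0..\<tau>}"
    "(LINT t|lebesgue_on {0..\<tau>}. norm (v t - u t) powr p) < \<epsilon>"
proof -
  let ?M = "lebesgue_on {0..\<tau>}"
  obtain s where s: "\<And>n. simple_function ?M (s n)" and lim: "AE t in ?M. (\<lambda>n::nat. s n t) \<longlonglongrightarrow> u t"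
    using u unfolding Lp_def strongly_measurable_def by blast
  \<comment> \<open>the truncation provides the majorant for dominated convergence\<close>
  define r where "r n t = (if norm (s n t) \<le> 2 * norm (u t) then sup (s n t) 0 else 0)" for n t
  have um: "(\<lambda>t. norm (u t)) \<in> borel_measurable ?M"
    using u by (intro strongly_measurable_imp_borel[where h = norm]) (auto simp: Lp_def intro: continuous_intros)
  have r: "simple_function ?M (r n)" for n
  proof -
    have "simple_function ?M (\<lambda>t. norm (s n t))"
      using simple_function_compose[OF s, where g = norm] by (simp add: comp_def)
    then have sm: "(\<lambda>t. norm (s n t)) \<in> borel_measurable ?M" by (rule borel_measurable_simple_function)
    have "simple_function ?M (\<lambda>t. sup (s n t) 0)"
      using simple_function_compose[OF s, where g = "\<lambda>x. sup x 0"] by (simp add: comp_def)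
    then have "simple_function ?M (\<lambda>t. if t \<in> {t \<in> space ?M. norm (s n t) \<le> 2 * norm (u t)} then sup (s n t) 0 else 0)"
      by (intro simple_function_If_set) (use sm um in measurable)
    then show ?thesis by (rule simple_function_cong[THEN iffD1, rotated]) (auto simp: r_def)
  qed
  have r0: "0 \<le> r n t" for n t by (simp add: r_def)
  have rbound: "norm (r n t) \<le> 2 * norm (u t)" for n t
    using norm_positive_part_diff[of 0 "s n t"] by (auto simp: r_def)
  have rlim: "AE t in ?M. (\<lambda>n. r n t) \<longlonglongrightarrow> u t"
    using lim nonneg
  proof eventually_elim
    case (elim t)
    have "(\<lambda>n. r n t - u t) \<longlonglongrightarrow> 0"
    proof (rule Lim_null_comparison)
      show "(\<lambda>n. norm (s n t - u t)) \<longlonglongrightarrow> 0"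
        using elim(1) by (simp add: LIM_zero_iff tendsto_norm_zero)
      show "\<forall>\<^sub>F n in sequentially. norm (r n t - u t) \<le> norm (s n t - u t)"
      proof (cases "u t = 0")
        case True
        then show ?thesis using norm_positive_part_diff[OF elim(2)]
          by (intro always_eventually) (auto simp: r_def)
      next
        case False
        have "(\<lambda>n. norm (s n t)) \<longlonglongrightarrow> norm (u t)" using elim(1) by (rule tendsto_norm)
        then have "\<forall>\<^sub>F n in sequentially. norm (s n t) < 2 * norm (u t)"
          using False by (intro order_tendstoD) auto
        then show ?thesis
          by eventually_elim (simp add: r_def norm_positive_part_diff[OF elim(2)])
      qed
    qed
    then show ?case by (simp add: LIM_zero_iff)
  qed
  have ru: "(\<lambda>t. r n t - u t) \<in> Lp p {0..\<tau>}" for n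
  proof -
    have rm: "strongly_measurable ?M (r n)"
      unfolding strongly_measurable_def using r by (intro exI[of _ "\<lambda>_. r n"]) auto
    have "integrable ?M (\<lambda>t. norm (r n t) powr p)"
    proof (rule Bochner_Integration.integrable_bound)
      show "integrable ?M (\<lambda>t. 2 powr p * norm (u t) powr p)" using u by (simp add: Lp_def)
      show "(\<lambda>t. norm (r n t) powr p) \<in> borel_measurable ?M"
        using strongly_measurable_imp_borel[OF rm _ continuous_on_norm_id]
        by (intro powr_real_measurable) auto
      have "norm (r n t) powr p \<le> 2 powr p * norm (u t) powr p" for t
        using powr_mono2[OF _ _ rbound, of p n t] p by (simp add: powr_mult)
      then show "AE t in ?M. norm (norm (r n t) powr p) \<le> norm (2 powr p * norm (u t) powr p)" by simp
    qed
    then have "r n \<in> Lp p {0..\<tau>}" using rm by (simp add: Lp_def)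
    then show ?thesis using Lp_add_diff(2)[OF _ u] p by auto
  qed
  have "(\<lambda>n. LINT t|?M. norm (r n t - u t) powr p) \<longlonglongrightarrow> (LINT t|?M. 0)"
  proof (rule integral_dominated_convergence[where w = "\<lambda>t. 3 powr p * norm (u t) powr p"])
    show "(\<lambda>t. norm (r n t - u t) powr p) \<in> borel_measurable ?M" for n
      using ru[of n] by (auto simp: Lp_def)
    show "integrable ?M (\<lambda>t. 3 powr p * norm (u t) powr p)" using u by (simp add: Lp_def)
    show "AE t in ?M. (\<lambda>n. norm (r n t - u t) powr p) \<longlonglongrightarrow> 0"
      using rlim
    proof eventually_elim
      case (elim t)
      then have "(\<lambda>n. norm (r n t - u t) powr p) \<longlonglongrightarrow> 0 powr p"
        using p by (intro tendsto_powr') (auto simp: LIM_zero_iff tendsto_norm_zero)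
      then show ?case by simp
    qed
    have "norm (r n t - u t) \<le> 3 * norm (u t)" for n t
      using norm_triangle_ineq4[of "r n t" "u t"] rbound[of n t] by simp
    then have "norm (r n t - u t) powr p \<le> 3 powr p * norm (u t) powr p" for n t
      using powr_mono2[of p "norm (r n t - u t)" "3 * norm (u t)"] p by (simp add: powr_mult)
    then show "AE t in ?M. norm (norm (r n t - u t) powr p) \<le> 3 powr p * norm (u t) powr p" for n
      by simp
  qed auto
  then have "\<forall>\<^sub>F n in sequentially. (LINT t|?M. norm (r n t - u t) powr p) < \<epsilon> / (2 * 2 powr p)"
    using \<epsilon> by (intro order_tendstoD) auto
  then obtain n where n: "(LINT t|?M. norm (r n t - u t) powr p) < \<epsilon> / (2 * 2 powr p)"
    by (auto simp: eventually_sequentially)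
  have "\<epsilon> / (2 * 2 powr p) > 0" using \<epsilon> by simp
  from simple_function_approx[OF r r0 p this]
  obtain v where v: "smooth_positive_input \<tau> v" "(\<lambda>t. v t - r n t) \<in> Lp p {0..\<tau>}"
    "(LINT t|?M. norm (v t - r n t) powr p) < \<epsilon> / (2 * 2 powr p)" .
  have eq: "(v t - r n t) + (r n t - u t) = v t - u t" for t by simp
  have "(\<lambda>t. (v t - r n t) + (r n t - u t)) \<in> Lp p {0..\<tau>}"
    using p by (intro Lp_add_diff(1) v(2) ru) auto
  moreover have "(LINT t|?M. norm ((v t - r n t) + (r n t - u t)) powr p) \<le>
      2 powr p * ((LINT t|?M. norm (v t - r n t) powr p) + (LINT t|?M. norm (r n t - u t) powr p))"
    using p by (intro Lp_integral_add_bound v(2) ru) auto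
  moreover have "\<dots> < 2 powr p * (\<epsilon> / (2 * 2 powr p) + \<epsilon> / (2 * 2 powr p))"
    using n v(3) by (intro mult_strict_left_mono) auto
  moreover have "2 powr p * (\<epsilon> / (2 * 2 powr p) + \<epsilon> / (2 * 2 powr p)) = \<epsilon>" by simp
  ultimately show ?thesis using that[OF v(1)] unfolding eq by linarith
qed

text \<open>Convergence in \<open>L\<^sup>p\<close>-loc asks for every bounded interval, whereas an approximant is good on
  one interval; the \<open>n\<close>-th approximant is taken on \<open>[0, n + 1]\<close>.\<close>

lemma smooth_positive_inputs_dense:
  fixes u :: "real \<Rightarrow> 'u::banach_lattice"
  assumes u: "u \<in> Lp_loc p" "ae_nonneg u" and p: "p > 0"
  obtains v where "\<And>n. smooth_positive_input (real (Suc n)) (v n)" "Lp_loc_tendsto p v u"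
proof -
  let ?M = "\<lambda>\<tau>. lebesgue_on {0..\<tau>::real}"
  have "\<forall>n. \<exists>v. smooth_positive_input (real (Suc n)) v \<and> (\<lambda>t. v t - u t) \<in> Lp p {0..real (Suc n)} \<and>
      (LINT t|?M (real (Suc n)). norm (v t - u t) powr p) < 1 / real (Suc n)"
  proof
    fix n
    have "u \<in> Lp p {0..real (Suc n)}" using u(1) by (simp add: Lp_loc_def)
    moreover have "AE t in ?M (real (Suc n)). 0 \<le> u t" using u(2) by (simp add: ae_nonneg_iff)
    moreover have "1 / real (Suc n) > 0" by simp
    ultimately obtain w where "smooth_positive_input (real (Suc n)) w" "(\<lambda>t. w t - u t) \<in> Lp p {0..real (Suc n)}"
      "(LINT t|?M (real (Suc n)). norm (w t - u t) powr p) < 1 / real (Suc n)"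
      using p by - (rule positive_approx_finite_time)
    then show "\<exists>v. smooth_positive_input (real (Suc n)) v \<and> (\<lambda>t. v t - u t) \<in> Lp p {0..real (Suc n)} \<and>
        (LINT t|?M (real (Suc n)). norm (v t - u t) powr p) < 1 / real (Suc n)" by blast
  qed
  from choice[OF this] obtain v where v: "\<And>n. smooth_positive_input (real (Suc n)) (v n)"
    "\<And>n. (\<lambda>t. v n t - u t) \<in> Lp p {0..real (Suc n)}"
    "\<And>n. (LINT t|?M (real (Suc n)). norm (v n t - u t) powr p) < 1 / real (Suc n)" by blast
  have "(\<lambda>n. Lp_norm p {0..\<tau>} (\<lambda>t. v n t - u t)) \<longlonglongrightarrow> 0" if \<tau>: "\<tau> > 0" for \<tau>
  proof -
    have "(\<lambda>n. LINT t|?M \<tau>. norm (v n t - u t) powr p) \<longlonglongrightarrow> 0"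
    proof (rule tendsto_sandwich)
      show "\<forall>\<^sub>F n in sequentially. 0 \<le> (LINT t|?M \<tau>. norm (v n t - u t) powr p)" by simp
      show "(\<lambda>n. 1 / real (Suc n)) \<longlonglongrightarrow> 0" by real_asymp
      show "\<forall>\<^sub>F n in sequentially. (LINT t|?M \<tau>. norm (v n t - u t) powr p) \<le> 1 / real (Suc n)"
        using eventually_ge_at_top[of "nat \<lceil>\<tau>\<rceil>"]
      proof eventually_elim
        case (elim n)
        then have n: "\<tau> \<le> real (Suc n)" by linarith
        have "(LINT t|?M \<tau>. norm (v n t - u t) powr p) \<le> (LINT t|?M (real (Suc n)). norm (v n t - u t) powr p)"
          by (rule integral_mono_lebesgue_on_AE) (use v(2)[of n] n in \<open>auto simp: Lp_def\<close>)
        then show ?case using v(3)[of n] by simp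
      qed
    qed simp
    then have "(\<lambda>n. (LINT t|?M \<tau>. norm (v n t - u t) powr p) powr (1 / p)) \<longlonglongrightarrow> 0 powr (1 / p)"
      using p by (intro tendsto_powr') auto
    then show ?thesis by (simp add: Lp_norm_def)
  qed
  then show ?thesis using that v(1) unfolding Lp_loc_tendsto_def by blast
qed

lemma smooth_positive_input_W1p_0:
  assumes "smooth_positive_input \<tau> v" "p \<ge> 0" shows "v \<in> W1p_0 p \<sigma>"
  using assms(1)
proof induction
  case zero
  have "(\<lambda>t. 0) \<in> Lp p {0..\<sigma>}" using Lp_scaleR_continuous[of "\<lambda>_. 0" p] assms(2) by simp
  then show ?case unfolding W1p_0_def by (auto intro!: bexI[of _ "\<lambda>t. 0"])
next
  case (add v a \<phi> \<phi>')
  obtain w where w: "w \<in> Lp p {0..\<sigma>}" "\<And>t. t \<in> {0..\<sigma>} \<Longrightarrow> (w has_integral v t - v 0) {0..t}"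
    and v0: "v 0 = 0" using add.IH unfolding W1p_0_def by auto
  have "((\<lambda>t. w t + \<phi>' t *\<^sub>R a) has_integral (v t - v 0) + (\<phi> t - \<phi> 0) *\<^sub>R a) {0..t}"
    if "t \<in> {0..\<sigma>}" for t
    using fundamental_theorem_of_calculus[of 0 t \<phi> \<phi>'] add.hyps(3) that
    by (intro has_integral_add w(2) has_integral_scaleR_left)
      (auto simp: has_real_derivative_iff_has_vector_derivative has_vector_derivative_at_within)
  then have "\<forall>t\<in>{0..\<sigma>}. ((\<lambda>t. w t + \<phi>' t *\<^sub>R a) has_integral
      (v t + \<phi> t *\<^sub>R a) - (v 0 + \<phi> 0 *\<^sub>R a)) {0..t}"
    by (simp add: algebra_simps)
  moreover have "(\<lambda>t. w t + \<phi>' t *\<^sub>R a) \<in> Lp p {0..\<sigma>}"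
    using assms(2) by (intro Lp_add_diff(1) w Lp_scaleR_continuous add.hyps) auto
  ultimately show ?case
    unfolding W1p_0_def using v0 add.hyps(5) by auto
qed

section \<open>Integrability of positive inputs\<close>

text \<open>The Cauchy criterion: the Riemann sums of \<open>f\<close> differ from those of \<open>g\<close> by at most the
  Riemann sums of \<open>h\<close>.\<close>

lemma integrable_L1_approx:
  fixes f :: "real \<Rightarrow> 'a::banach"
  assumes approx: "\<And>e. e > 0 \<Longrightarrow> \<exists>g h. g integrable_on {a..b} \<and> h integrable_on {a..b} \<and>
    (\<forall>s\<in>{a..b}. norm (f s - g s) \<le> h s) \<and> integral {a..b} h < e"
  shows "f integrable_on {a..b}"
proof -
  let ?c = "measure lborel :: real set \<Rightarrow> real"
  have "\<exists>\<gamma>. gauge \<gamma> \<and> (\<forall>D1 D2. D1 tagged_division_of cbox a b \<and> \<gamma> fine D1 \<and>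
      D2 tagged_division_of cbox a b \<and> \<gamma> fine D2 \<longrightarrow>
      norm ((\<Sum>(x, K)\<in>D1. ?c K *\<^sub>R f x) - (\<Sum>(x, K)\<in>D2. ?c K *\<^sub>R f x)) < e)"
    if e: "e > 0" for e
  proof -
    obtain g h where g: "g integrable_on {a..b}" and h: "h integrable_on {a..b}"
      and le: "\<And>s. s \<in> {a..b} \<Longrightarrow> norm (f s - g s) \<le> h s" and small: "integral {a..b} h < e / 5"
      using approx[of "e / 5"] e by auto
    obtain \<gamma>1 where \<gamma>1: "gauge \<gamma>1" "\<And>D1 D2. D1 tagged_division_of cbox a b \<Longrightarrow> \<gamma>1 fine D1 \<Longrightarrow>
        D2 tagged_division_of cbox a b \<Longrightarrow> \<gamma>1 fine D2 \<Longrightarrow>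
        norm ((\<Sum>(x, K)\<in>D1. ?c K *\<^sub>R g x) - (\<Sum>(x, K)\<in>D2. ?c K *\<^sub>R g x)) < e / 5"
      using g e unfolding box_real(2)[symmetric] integrable_Cauchy[of g]
      by (metis half_gt_zero divide_pos_pos zero_less_numeral)
    have "(h has_integral integral {a..b} h) (cbox a b)" using h by (simp add: integrable_integral)
    then obtain \<gamma>2 where \<gamma>2: "gauge \<gamma>2" "\<And>D. D tagged_division_of cbox a b \<Longrightarrow> \<gamma>2 fine D \<Longrightarrow>
        norm ((\<Sum>(x, K)\<in>D. ?c K *\<^sub>R h x) - integral {a..b} h) < e / 5"
      using e unfolding has_integral[of h] by (metis divide_pos_pos zero_less_numeral)
    have diff: "norm ((\<Sum>(x, K)\<in>D. ?c K *\<^sub>R f x) - (\<Sum>(x, K)\<in>D. ?c K *\<^sub>R g x)) < 2 * (e / 5)"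
      if D: "D tagged_division_of cbox a b" "\<gamma>2 fine D" for D
    proof -
      have "(\<Sum>(x, K)\<in>D. ?c K *\<^sub>R f x) - (\<Sum>(x, K)\<in>D. ?c K *\<^sub>R g x) = (\<Sum>(x, K)\<in>D. ?c K *\<^sub>R (f x - g x))"
        by (simp add: sum_subtractf[symmetric] split_beta scaleR_diff_right)
      also have "norm \<dots> \<le> (\<Sum>(x, K)\<in>D. ?c K *\<^sub>R h x)"
      proof (rule order_trans[OF norm_sum sum_mono])
        fix i assume i: "i \<in> D"
        obtain x K where xK: "i = (x, K)" by (cases i)
        then have "x \<in> {a..b}" using D(1) i by (auto dest: tag_in_interval)
        then show "norm (case i of (x, K) \<Rightarrow> ?c K *\<^sub>R (f x - g x)) \<le> (case i of (x, K) \<Rightarrow> ?c K *\<^sub>R h x)"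
          using le by (simp add: xK mult_left_mono)
      qed
      also have "\<dots> < 2 * (e / 5)"
        using \<gamma>2(2)[OF D] small unfolding real_norm_def abs_less_iff by linarith
      finally show ?thesis .
    qed
    show ?thesis
    proof (intro exI conjI allI impI)
      show "gauge (\<lambda>x. \<gamma>1 x \<inter> \<gamma>2 x)" using \<gamma>1(1) \<gamma>2(1) by (rule gauge_Int)
      fix D1 D2 assume D: "D1 tagged_division_of cbox a b \<and> (\<lambda>x. \<gamma>1 x \<inter> \<gamma>2 x) fine D1 \<and>
        D2 tagged_division_of cbox a b \<and> (\<lambda>x. \<gamma>1 x \<inter> \<gamma>2 x) fine D2"
      define F where "F D = (\<Sum>(x, K)\<in>D. ?c K *\<^sub>R f x)" for D :: "(real \<times> real set) set"
      define G where "G D = (\<Sum>(x, K)\<in>D. ?c K *\<^sub>R g x)" for D :: "(real \<times> real set) set"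
      have "norm (F D1 - G D1) < 2 * (e / 5)" "norm (F D2 - G D2) < 2 * (e / 5)"
        "norm (G D1 - G D2) < e / 5"
        using diff \<gamma>1(2) D unfolding F_def G_def by (auto simp: fine_Int)
      moreover have "F D1 - F D2 = (F D1 - G D1) + (G D1 - G D2) - (F D2 - G D2)" by simp
      then have "norm (F D1 - F D2) \<le> norm (F D1 - G D1) + norm (G D1 - G D2) + norm (F D2 - G D2)"
        using norm_triangle_ineq4[of "(F D1 - G D1) + (G D1 - G D2)" "F D2 - G D2"]
          norm_triangle_ineq[of "F D1 - G D1" "G D1 - G D2"] by simp
      ultimately have "norm (F D1 - F D2) < e" by simp
      then show "norm ((\<Sum>(x, K)\<in>D1. ?c K *\<^sub>R f x) - (\<Sum>(x, K)\<in>D2. ?c K *\<^sub>R f x)) < e"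
        by (simp add: F_def G_def)
    qed
  qed
  then have "f integrable_on cbox a b" unfolding integrable_Cauchy by blast
  then show ?thesis by simp
qed

lemma Lp_imp_L1:
  assumes "u \<in> Lp p {0..\<tau>}" "1 \<le> p" shows "u \<in> Lp 1 {0..\<tau>}"
proof -
  interpret finite_measure "lebesgue_on {0..\<tau>}" by (rule finite_measure_lebesgue_on) simp
  have "integrable (lebesgue_on {0..\<tau>}) (\<lambda>t. norm (u t) powr 1)"
  proof (rule Bochner_Integration.integrable_bound)
    show "integrable (lebesgue_on {0..\<tau>}) (\<lambda>t. 1 + norm (u t) powr p)"
      using assms by (simp add: Lp_def)
    show "(\<lambda>t. norm (u t) powr 1) \<in> borel_measurable (lebesgue_on {0..\<tau>})"
      using assms by (intro powr_real_measurable strongly_measurable_imp_borel[where h = norm])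
        (auto simp: Lp_def intro: continuous_intros)
    have "x powr 1 \<le> 1 + x powr p" if "x \<ge> 0" for x :: real
    proof (cases "x \<le> 1")
      case False
      then have "x powr 1 \<le> x powr p" using assms by (intro powr_mono) auto
      then show ?thesis by simp
    qed (use that in \<open>simp add: add_increasing2\<close>)
    then show "AE t in lebesgue_on {0..\<tau>}. norm (norm (u t) powr 1) \<le> norm (1 + norm (u t) powr p)"
      by (simp add: abs_of_nonneg add_nonneg_nonneg)
  qed
  then show ?thesis using assms by (simp add: Lp_def)
qed

context c0
begin

lemma integrable_smooth_input:
  assumes "smooth_positive_input \<tau> v"
  shows "(\<lambda>s. T (t - s) (blinfun_apply B (v s))) integrable_on {0..t}"
  using assms
proof induction
  case (add v a \<phi> \<phi>')
  have "(\<lambda>s. T (t - s) (\<phi> s *\<^sub>R B a)) integrable_on {0..t}"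
    by (intro integrable_continuous_real continuous_convolution continuous_on_C1[OF add.hyps(3)])
  from integrable_add[OF add.IH this] show ?case
    by (simp add: blinfun.add_right blinfun.scaleR_right)
qed (simp add: blinfun.zero_right integrable_0)

text \<open>For a smooth input the integrand is continuous, and \<open>L\<^sup>1\<close> approximation of the input is
  \<open>L\<^sup>1\<close> approximation of the integrand, by the uniform bound on the semigroup.\<close>

lemma integrable_positive_input:
  fixes B :: "'u::banach_lattice \<Rightarrow>\<^sub>L 'a"
  assumes u: "u \<in> Lp p {0..t}" "AE s in lebesgue_on {0..t}. 0 \<le> u s" and p: "1 \<le> p"
  shows "(\<lambda>s. T (t - s) (B (u s))) integrable_on {0..t}"
proof (rule integrable_L1_approx)
  fix e :: real assume e: "e > 0"
  obtain M where M: "M \<ge> 1" "\<And>s. s \<in> {0..t} \<Longrightarrow> norm (T s) \<le> M" using bounded_on_compact by blast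
  define c where "c = M * norm B + 1"
  have c: "c > 0" using M by (simp add: c_def add_nonneg_pos)
  obtain v where v: "smooth_positive_input t v" "(\<lambda>s. v s - u s) \<in> Lp 1 {0..t}"
    "(LINT s|lebesgue_on {0..t}. norm (v s - u s) powr 1) < e / c"
    using positive_approx_finite_time[OF Lp_imp_L1[OF u(1) p] u(2), of "e / c"] e c by auto
  have int: "integrable (lebesgue_on {0..t}) (\<lambda>s. norm (v s - u s))" using v(2) by (simp add: Lp_def)
  have le: "norm (T (t - s) (B (u s)) - T (t - s) (B (v s))) \<le> c * norm (v s - u s)" if "s \<in> {0..t}" for s
  proof -
    have "T (t - s) (B (u s)) - T (t - s) (B (v s)) = - T (t - s) (B (v s - u s))"
      by (simp add: blinfun.diff_right)
    then have "norm (T (t - s) (B (u s)) - T (t - s) (B (v s))) \<le> norm (T (t - s)) * (norm B * norm (v s - u s))"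
      using norm_blinfun[of "T (t - s)" "B (v s - u s)"]
        mult_left_mono[OF norm_blinfun[of B "v s - u s"] norm_ge_zero[of "T (t - s)"]] by simp
    also have "\<dots> \<le> M * (norm B * norm (v s - u s))" using M(2)[of "t - s"] that by (intro mult_right_mono) auto
    also have "\<dots> \<le> c * norm (v s - u s)" by (simp add: c_def algebra_simps)
    finally show ?thesis .
  qed
  have "integral {0..t} (\<lambda>s. c * norm (v s - u s)) = c * (LINT s|lebesgue_on {0..t}. norm (v s - u s))"
    by (simp add: lebesgue_integral_eq_integral[OF int])
  also have "\<dots> < e" using v(3) c by (simp add: field_simps)
  finally have "integral {0..t} (\<lambda>s. c * norm (v s - u s)) < e" .
  moreover have "(\<lambda>s. c * norm (v s - u s)) integrable_on {0..t}"
    using integrable_cmul[OF integrable_on_lebesgue_on[OF int], of c] by simp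
  ultimately show "\<exists>g h. g integrable_on {0..t} \<and> h integrable_on {0..t} \<and>
      (\<forall>s\<in>{0..t}. norm (T (t - s) (B (u s)) - g s) \<le> h s) \<and> integral {0..t} h < e"
    using integrable_smooth_input[OF v(1), where t = t] le
    by (intro exI[of _ "\<lambda>s. T (t - s) (B (v s))"] exI[of _ "\<lambda>s. c * norm (v s - u s)"]) auto
qed

end

section \<open>The reachable states lie in the state space\<close>

context extrapolation
begin

text \<open>An input on \<open>[a, b]\<close> is moved to the end of \<open>[0, \<tau>]\<close> and preceded by \<open>0\<close>.\<close>

lemma input_map_shift:
  fixes B :: "'u::banach \<Rightarrow>\<^sub>L 'e"
  assumes "0 \<le> a" "b - a \<le> \<tau>"
  shows "input_map T\<^sub>e B \<tau> (\<lambda>s. if s \<in> {a - (b - \<tau>)..b - (b - \<tau>)} then u (s + (b - \<tau>)) else 0) =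
    integral {a..b} (\<lambda>s. T\<^sub>e (b - s) (B (u s)))"
proof -
  define c where "c = b - \<tau>"
  let ?I = "{a - c..b - c}"
  have "input_map T\<^sub>e B \<tau> (\<lambda>s. if s \<in> ?I then u (s + c) else 0) =
      integral {0..\<tau>} (\<lambda>s. if s \<in> ?I then T\<^sub>e (b - (c + s)) (B (u (c + s))) else 0)"
    unfolding input_map_def
    by (intro integral_cong) (auto simp: c_def blinfun.zero_right algebra_simps)
  also have "\<dots> = integral (?I \<inter> {0..\<tau>}) (\<lambda>s. T\<^sub>e (b - (c + s)) (B (u (c + s))))"
    by (rule integral_restrict_Int)
  also have "?I \<inter> {0..\<tau>} = ?I" using assms by (auto simp: c_def)
  also have "integral ?I (\<lambda>s. T\<^sub>e (b - (c + s)) (B (u (c + s)))) =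
      integral ?I ((\<lambda>s. T\<^sub>e (b - s) (B (u s))) \<circ> (+) c)" by (simp add: comp_def)
  also have "\<dots> = integral {a..b} (\<lambda>s. T\<^sub>e (b - s) (B (u s)))" by (simp add: integral_shift_Icc_real)
  finally show ?thesis unfolding c_def .
qed

text \<open>Admissibility speaks of a single time \<open>\<tau>\<close>. The interval \<open>[0, t]\<close> is cut into pieces of
  length at most \<open>\<tau>\<close>: the contribution of the last piece is a translated instance of
  admissibility, and the earlier ones are moved on by \<open>T\<^sub>e\<close>, which preserves the range of \<open>J\<close>.\<close>

lemma reachable_in_state_space:
  fixes B :: "'u::banach \<Rightarrow>\<^sub>L 'e"
  assumes adm: "control_admissible p J T\<^sub>e B" and u: "u \<in> Lp_loc p"
    and int: "\<And>s. s \<ge> 0 \<Longrightarrow> (\<lambda>r. T\<^sub>e (s - r) (B (u r))) integrable_on {0..s}" and t: "t \<ge> 0"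
  shows "input_map T\<^sub>e B t u \<in> range J"
proof -
  obtain \<tau> where \<tau>: "\<tau> > 0" "\<And>u. u \<in> Lp p {0..} \<Longrightarrow> input_map T\<^sub>e B \<tau> u \<in> range J"
    using adm unfolding control_admissible_def by blast
  have piece: "integral {a..b} (\<lambda>s. T\<^sub>e (b - s) (B (u s))) \<in> range J"
    if "0 \<le> a" "0 < b" "b - a \<le> \<tau>" for a b
  proof -
    have "u \<in> Lp p {0..b}" using u that by (simp add: Lp_loc_def)
    then have "u \<in> Lp p {a..b}" by (rule Lp_subinterval) (use that in auto)
    then have "(\<lambda>s. if s \<in> {a - (b - \<tau>)..b - (b - \<tau>)} then u (s + (b - \<tau>)) else 0) \<in> Lp p {0..}"
      by (rule Lp_shift) (use that in simp)
    from \<tau>(2)[OF this] show ?thesis by (simp only: input_map_shift[OF that(1,3)])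
  qed
  have "input_map T\<^sub>e B t u \<in> range J" if "0 \<le> t" "t \<le> real n * \<tau>" for n t
    using that
  proof (induction n arbitrary: t)
    case 0
    then have "input_map T\<^sub>e B t u = J 0" by (simp add: input_map_def linear_0[OF linear_J])
    then show ?case by simp
  next
    case (Suc n)
    show ?case
    proof (cases "t \<le> \<tau>")
      case True
      show ?thesis
      proof (cases "t = 0")
        case True
        then have "input_map T\<^sub>e B t u = J 0" by (simp add: input_map_def linear_0[OF linear_J])
        then show ?thesis by simp
      next
        case False
        then show ?thesis using piece[of 0 t] Suc.prems \<open>t \<le> \<tau>\<close> by (simp add: input_map_def)
      qed
    next
      case False
      define s where "s = t - \<tau>"
      have s: "0 \<le> s" "s \<le> t" "t - s = \<tau>" using False \<tau>(1) by (auto simp: s_def)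
      have "input_map T\<^sub>e B s u \<in> range J"
        using Suc.IH[of s] Suc.prems s by (simp add: s_def algebra_simps)
      then obtain z where z: "input_map T\<^sub>e B s u = J z" by auto
      have "integral {0..s} (\<lambda>r. T\<^sub>e (t - r) (B (u r))) = integral {0..s} (T\<^sub>e \<tau> \<circ> (\<lambda>r. T\<^sub>e (s - r) (B (u r))))"
      proof (rule integral_cong)
        fix r assume "r \<in> {0..s}"
        then show "T\<^sub>e (t - r) (B (u r)) = (T\<^sub>e \<tau> \<circ> (\<lambda>r. T\<^sub>e (s - r) (B (u r)))) r"
          using e.T_add[of \<tau> "s - r" "B (u r)"] \<tau>(1) s by (simp add: s_def)
      qed
      also have "\<dots> = T\<^sub>e \<tau> (input_map T\<^sub>e B s u)"
        unfolding input_map_def by (rule integral_linear[OF int[OF s(1)] blinfun.bounded_linear_right])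
      also have "\<dots> = J (T \<tau> z)" using z \<tau>(1) by (simp add: Te_J)
      finally have 1: "integral {0..s} (\<lambda>r. T\<^sub>e (t - r) (B (u r))) = J (T \<tau> z)" .
      obtain y where 2: "integral {s..t} (\<lambda>r. T\<^sub>e (t - r) (B (u r))) = J y"
        using piece[of s t] s \<tau>(1) by auto
      have "input_map T\<^sub>e B t u = J (T \<tau> z) + J y"
        unfolding input_map_def 1[symmetric] 2[symmetric]
        by (rule Henstock_Kurzweil_Integration.integral_combine[symmetric, OF s(1,2) int]) (use Suc.prems in simp)
      then show ?thesis by (simp flip: linear_add[OF linear_J])
    qed
  qed
  moreover obtain n :: nat where "t / \<tau> < real n" using reals_Archimedean2 by blast
  then have "t \<le> real n * \<tau>" using \<tau>(1) by (simp add: field_simps)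
  ultimately show ?thesis using t by blast
qed

end

section \<open>The cone of the extrapolation space\<close>

locale positive_extrapolation = extrapolation T \<mu> R J T\<^sub>e
  for T :: "real \<Rightarrow> 'x::banach_lattice \<Rightarrow>\<^sub>L 'x" and \<mu> R and J :: "'x \<Rightarrow> 'e::banach" and T\<^sub>e +
  assumes positive: "positive_semigroup T"
begin

lemma T_nonneg: "t \<ge> 0 \<Longrightarrow> 0 \<le> x \<Longrightarrow> 0 \<le> T t x"
  using positive by (simp add: positive_semigroup_def)

lemma Q_nonneg: "0 \<le> x \<Longrightarrow> 0 \<le> Q t x"
  using integral_in_closed_cone[OF closed_nonneg convex_cone_nonneg
      integrable_integral[OF integrable_orbit[OF order_refl]] negligible_empty, of t x] T_nonneg
  unfolding Q_def by auto

lemma extrapolation_cone_Te: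
  assumes "w \<in> extrapolation_cone J" "t \<ge> 0" shows "T\<^sub>e t w \<in> extrapolation_cone J"
proof -
  have "T\<^sub>e t ` closure (J ` {x. 0 \<le> x}) \<subseteq> closure (J ` {x. 0 \<le> x})"
  proof (rule image_closure_subset)
    show "continuous_on (closure (J ` {x. 0 \<le> x})) (T\<^sub>e t)" by (intro continuous_intros)
    have "T\<^sub>e t ` J ` {x. 0 \<le> x} \<subseteq> J ` {x. 0 \<le> x}"
      using assms(2) by (auto simp: Te_J T_nonneg)
    then show "T\<^sub>e t ` J ` {x. 0 \<le> x} \<subseteq> closure (J ` {x. 0 \<le> x})" using closure_subset by blast
  qed simp
  then show ?thesis using assms(1) unfolding extrapolation_cone_def by blast
qed

text \<open>\<open>Q h\<close> is bounded for the norm of the extrapolation space, so \<open>Q h x\<close> is a limit of positive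
  elements of the state space, and \<open>Q h x / h \<rightarrow> x\<close>.\<close>

lemma extrapolation_cone_Int_state_space:
  assumes "J x \<in> extrapolation_cone J" shows "0 \<le> x"
proof -
  obtain f where f: "\<And>n. f n \<in> J ` {x. 0 \<le> x}" "f \<longlonglongrightarrow> J x"
    using assms unfolding extrapolation_cone_def closure_sequential by blast
  then have "\<forall>n. \<exists>\<xi>. 0 \<le> \<xi> \<and> f n = J \<xi>" by blast
  then obtain \<xi> where \<xi>: "\<And>n. 0 \<le> \<xi> n" "\<And>n. f n = J (\<xi> n)" by metis
  have "(\<lambda>n. S (f n)) \<longlonglongrightarrow> S (J x)" by (intro tendsto_intros f)
  then have R\<xi>: "(\<lambda>n. R (\<xi> n)) \<longlonglongrightarrow> R x" by (simp add: \<xi> S)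
  have "0 \<le> Q h x" if "h \<ge> 0" for h
  proof (rule nonneg_limit)
    have "(\<lambda>n. \<mu> *\<^sub>R Q h (R (\<xi> n)) - T h (R (\<xi> n)) + R (\<xi> n)) \<longlonglongrightarrow> \<mu> *\<^sub>R Q h (R x) - T h (R x) + R x"
      by (intro tendsto_intros R\<xi> bounded_linear.tendsto[OF bounded_linear_Q])
    then show "(\<lambda>n. Q h (\<xi> n)) \<longlonglongrightarrow> Q h x" using that by (simp flip: Q_in_terms_of_R)
  qed (use Q_nonneg \<xi> in auto)
  then show ?thesis
    by (intro nonneg_limit[OF _ Q_tendsto])
      (auto simp: eventually_at_right_field intro!: exI[of _ 1] scaleR_nonneg_nonneg)
qed

lemma convex_cone_extrapolation_cone: "convex_cone (extrapolation_cone J)"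
proof -
  have "convex_cone (J ` {x. 0 \<le> x})"
    using convex_cone_linear_image[of "{x::'x. 0 \<le> x}" J] convex_cone_nonneg linear_J by blast
  then have K: "convex (J ` {x. 0 \<le> x})" "conic (J ` {x. 0 \<le> x})" "J ` {x. 0 \<le> x} \<noteq> {}"
    unfolding convex_cone_def by blast+
  have "conic (closure (J ` {x. 0 \<le> x}))"
    unfolding conic_def
  proof (intro allI impI)
    fix w :: 'e and c :: real
    assume "w \<in> closure (J ` {x. 0 \<le> x})" "0 \<le> c"
    then have "c *\<^sub>R w \<in> closure ((*\<^sub>R) c ` J ` {x. 0 \<le> x})"
      unfolding closure_scaleR[symmetric] by blast
    moreover have "(*\<^sub>R) c ` J ` {x. 0 \<le> x} \<subseteq> J ` {x. 0 \<le> x}"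
      using K(2) \<open>0 \<le> c\<close> by (auto simp: conic_def)
    ultimately show "c *\<^sub>R w \<in> closure (J ` {x. 0 \<le> x})" using closure_mono by blast
  qed
  then show ?thesis
    unfolding extrapolation_cone_def convex_cone_def using K by (simp add: convex_closure)
qed

lemma input_map_in_cone:
  assumes B: "positive_control J B" and p: "1 \<le> p"
    and u: "u \<in> Lp p {0..t}" "AE s in lebesgue_on {0..t}. 0 \<le> u s"
  shows "input_map T\<^sub>e B t u \<in> extrapolation_cone J"
proof -
  obtain N where N: "negligible N" "\<And>s. s \<in> {0..t} - N \<Longrightarrow> 0 \<le> u s"
    using u(2) by (auto simp: AE_lebesgue_on_iff)
  show ?thesis
    unfolding input_map_def
  proof (rule integral_in_closed_cone[OF _ convex_cone_extrapolation_cone _ N(1)])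
    show "closed (extrapolation_cone J)" by (simp add: extrapolation_cone_def)
    show "((\<lambda>s. T\<^sub>e (t - s) (B (u s))) has_integral integral {0..t} (\<lambda>s. T\<^sub>e (t - s) (B (u s)))) {0..t}"
      by (rule integrable_integral[OF e.integrable_positive_input[OF u p]])
    show "T\<^sub>e (t - s) (B (u s)) \<in> extrapolation_cone J" if "s \<in> {0..t} - N" for s
      using that N(2)[OF that] B by (intro extrapolation_cone_Te) (auto simp: positive_control_def)
  qed
qed

end

section \<open>The observation operator on \<open>Z\<close>\<close>

locale boundary_system = extrapolation T \<mu> R J T\<^sub>e
  for T :: "real \<Rightarrow> 'x::banach_lattice \<Rightarrow>\<^sub>L 'x" and \<mu> R and J :: "'x \<Rightarrow> 'e::banach" and T\<^sub>e +
  fixes B :: "'u::banach_lattice \<Rightarrow>\<^sub>L 'e" and \<Gamma> :: "'e \<Rightarrow> 'y::banach_lattice" and D\<^sub>\<Sigma> :: "'u \<Rightarrow>\<^sub>L 'y" and p :: real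
  assumes \<Gamma>: "bounded_linear_on_Z (generator T) \<mu> J T\<^sub>e B \<Gamma>"
    and admissible: "control_admissible p J T\<^sub>e B"
    and p: "1 \<le> p"
begin

text \<open>The operator \<open>\<Gamma>\<close> in the coordinates \<open>(x, u)\<close> of \<open>Z\<close>, with \<open>x\<close> standing for the element
  \<open>R x\<close> of the domain.\<close>

definition G :: "'x \<Rightarrow> 'u \<Rightarrow> 'y" where
  "G x u = \<Gamma> (J (R x + S (B u)))"

abbreviation C where "C \<equiv> observation_operator J \<Gamma>"

abbreviation \<Phi> where "\<Phi> \<equiv> input_map T\<^sub>e B"

abbreviation H where "H \<equiv> transfer_function T\<^sub>e B \<Gamma> D\<^sub>\<Sigma>"

abbreviation F\<^sub>0 where "F\<^sub>0 \<equiv> input_output_formula T\<^sub>e B \<Gamma> D\<^sub>\<Sigma>"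

abbreviation regular where "regular \<equiv> strongly_regular T\<^sub>e B \<Gamma> D\<^sub>\<Sigma>"

abbreviation Z where "Z \<equiv> Z_space A \<mu> J T\<^sub>e B"

lemma in_Z: "J (R x + S (B u)) \<in> Z"
  unfolding Z_space_def resolvent_Te_mu using DomainI[OF resolvent_in[OF R, of x]]
  by (auto simp: linear_add[OF linear_J])

lemma G_add: "G (x + x') (u + u') = G x u + G x' u'"
proof -
  have "\<Gamma> (J (R x + S (B u)) + J (R x' + S (B u'))) = G x u + G x' u'"
    unfolding G_def using \<Gamma> in_Z by (simp add: bounded_linear_on_Z_def)
  moreover have "J (R x + S (B u)) + J (R x' + S (B u')) = J (R (x + x') + S (B (u + u')))"
    by (simp add: blinfun.add_right linear_add[OF linear_J] algebra_simps)
  ultimately show ?thesis by (simp add: G_def)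
qed

lemma G_scaleR: "G (c *\<^sub>R x) (c *\<^sub>R u) = c *\<^sub>R G x u"
proof -
  have "\<Gamma> (c *\<^sub>R J (R x + S (B u))) = c *\<^sub>R G x u"
    unfolding G_def using \<Gamma> in_Z by (simp add: bounded_linear_on_Z_def)
  moreover have "c *\<^sub>R J (R x + S (B u)) = J (R (c *\<^sub>R x) + S (B (c *\<^sub>R u)))"
    by (simp add: blinfun.scaleR_right linear_scale[OF linear_J, symmetric] scaleR_add_right)
  ultimately show ?thesis by (simp add: G_def)
qed

lemma G_zero [simp]: "G 0 0 = 0"
  using G_scaleR[of 0 0 0] by simp

lemma G_split: "G x u = G x 0 + G 0 u"
  using G_add[of x 0 0 u] by simp

text \<open>The pair \<open>(x, 0)\<close> is one of the competitors in the infimum that defines the norm of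
  \<open>Z\<close>.\<close>

lemma bounded_linear_G: "bounded_linear (\<lambda>x. G x 0)"
proof -
  obtain K where K: "\<And>z. z \<in> Z \<Longrightarrow> norm (\<Gamma> z) \<le> K * Z_norm A \<mu> J T\<^sub>e B z"
    using \<Gamma> unfolding bounded_linear_on_Z_def by blast
  have "norm (G x 0) \<le> norm x * \<bar>K\<bar>" for x
  proof -
    define z where "z = J (R x + S (B 0))"
    let ?N = "{(norm (\<mu> *\<^sub>R x - y))\<^sup>2 + (norm u)\<^sup>2 | x y u.
      (x, y) \<in> A \<and> z = J x + resolvent (generator T\<^sub>e) \<mu> (B u)}"
    have "(norm (\<mu> *\<^sub>R R x - (\<mu> *\<^sub>R R x - x)))\<^sup>2 + (norm (0::'u))\<^sup>2 \<in> ?N"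
      unfolding mem_Collect_eq
      by (intro exI[of _ "R x"] exI[of _ "\<mu> *\<^sub>R R x - x"] exI[of _ 0] conjI refl resolvent_in[OF R])
        (simp add: z_def resolvent_Te_mu linear_add[OF linear_J])
    then have "(norm x)\<^sup>2 \<in> ?N" by simp
    moreover have "bdd_below ?N" by (intro bdd_belowI[of _ 0]) auto
    ultimately have "Inf ?N \<le> (norm x)\<^sup>2" by (rule cInf_lower)
    then have "Z_norm A \<mu> J T\<^sub>e B z \<le> norm x"
      unfolding Z_norm_def using real_sqrt_le_mono by fastforce
    moreover have "0 \<le> Z_norm A \<mu> J T\<^sub>e B z"
    proof -
      have "0 \<le> Inf ?N" using \<open>(norm x)\<^sup>2 \<in> ?N\<close> by (intro cInf_greatest) auto
      then show ?thesis unfolding Z_norm_def by simp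
    qed
    moreover have "norm (\<Gamma> z) \<le> K * Z_norm A \<mu> J T\<^sub>e B z"
      unfolding z_def by (rule K[OF in_Z])
    ultimately have "norm (\<Gamma> z) \<le> \<bar>K\<bar> * norm x"
      by (meson abs_ge_self mult_mono norm_ge_zero order_trans abs_ge_zero)
    then show ?thesis by (simp add: G_def z_def mult.commute)
  qed
  then show ?thesis
    using G_add[of _ _ 0 0] G_scaleR[of _ _ 0] by (intro bounded_linear_intro[where K = "\<bar>K\<bar>"]) auto
qed

lemma observation_R: "C (R x) = G x 0"
  by (simp add: observation_operator_def G_def blinfun.zero_right)

lemma observation_zero: "C 0 = 0"
  using observation_R[of 0] by (simp add: blinfun.zero_right)

text \<open>The resolvent identity moves \<open>R(\<nu>) B u\<close> to the coordinates of \<open>Z\<close>, which are defined with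
  the fixed \<open>\<mu>\<close>.\<close>

lemma transfer_function_eq:
  assumes "is_resolvent A \<nu> R'"
  shows "H \<nu> u = G ((\<mu> - \<nu>) *\<^sub>R (S (B u) + (\<mu> - \<nu>) *\<^sub>R R' (S (B u)))) u + D\<^sub>\<Sigma> u"
    and "resolvent (generator T\<^sub>e) \<nu> (B u) =
      J (R ((\<mu> - \<nu>) *\<^sub>R (S (B u) + (\<mu> - \<nu>) *\<^sub>R R' (S (B u)))) + S (B u))"
proof -
  let ?b = "S (B u)"
  let ?x = "(\<mu> - \<nu>) *\<^sub>R (?b + (\<mu> - \<nu>) *\<^sub>R R' ?b)"
  have "R' ?b = R (?b + (\<mu> - \<nu>) *\<^sub>R R' ?b)" by (rule resolvent_identity[OF assms R])
  then have "(\<mu> - \<nu>) *\<^sub>R R' ?b = R ?x"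
    by (simp only: blinfun.scaleR_right)
  then show "resolvent (generator T\<^sub>e) \<nu> (B u) = J (R ?x + ?b)"
    by (simp only: resolvent_Te_eq(1)[OF assms] add.commute)
  then show "H \<nu> u = G ?x u + D\<^sub>\<Sigma> u"
    by (simp only: transfer_function_def G_def)
qed

text \<open>The limit \<open>C\<^sub>\<Lambda> z = lim C \<nu> R(\<nu>) z\<close> is the extension of \<open>C\<close> by which a regular system reads
  \<open>y = C\<^sub>\<Lambda> z + D u\<close>. On the domain \<open>\<nu> R(\<nu>)\<close> converges in the graph norm; on \<open>R(\<mu>) B u\<close> the
  resolvent identity gives
  \<open>\<nu> R(\<nu>) R(\<mu>) B u = \<nu> / (\<nu> - \<mu>) (R(\<mu>) B u - R(\<nu>) B u)\<close>, and \<open>\<Gamma> R(\<nu>) B u\<close> converges by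
  regularity.\<close>

lemma yosida_limit:
  assumes R': "\<And>\<nu>. \<nu> \<ge> \<nu>0 \<Longrightarrow> is_resolvent A \<nu> (R' \<nu>)" "\<nu>0 > 0"
    and M: "\<And>\<nu> x. \<nu> \<ge> \<nu>0 \<Longrightarrow> norm (\<nu> *\<^sub>R R' \<nu> x) \<le> M * norm x" "M \<ge> 0"
    and D: "((\<lambda>\<nu>. H \<nu> u) \<longlongrightarrow> d) at_top"
  shows "((\<lambda>\<nu>. C (\<nu> *\<^sub>R R' \<nu> (R x + S (B u)))) \<longlongrightarrow> G x u + D\<^sub>\<Sigma> u - d) at_top"
proof -
  let ?b = "S (B u)" and ?f = "\<lambda>\<nu>. G (\<nu> *\<^sub>R R' \<nu> x) 0 + (\<nu> / (\<nu> - \<mu>)) *\<^sub>R (G 0 u + D\<^sub>\<Sigma> u - H \<nu> u)"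
  have eq: "C (\<nu> *\<^sub>R R' \<nu> (R x + ?b)) =
      ?f \<nu>"
    if \<nu>: "\<nu> \<ge> \<nu>0" "\<nu> > \<mu>" for \<nu>
  proof -
    note r = R'(1)[OF \<nu>(1)]
    define y where "y = ?b + (\<mu> - \<nu>) *\<^sub>R R' \<nu> ?b"
    have "\<nu> *\<^sub>R R' \<nu> (R x + ?b) = R (\<nu> *\<^sub>R R' \<nu> x + \<nu> *\<^sub>R y)"
      using resolvent_identity[OF r R, of ?b] unfolding y_def[symmetric]
      by (simp add: blinfun.add_right blinfun.scaleR_right scaleR_add_right resolvent_commute[OF r R])
    then have 1: "C (\<nu> *\<^sub>R R' \<nu> (R x + ?b)) = G (\<nu> *\<^sub>R R' \<nu> x) 0 + G (\<nu> *\<^sub>R y) 0"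
      using G_add[of _ _ 0 0] by (simp add: observation_R)
    have "H \<nu> u = G ((\<mu> - \<nu>) *\<^sub>R y) 0 + G 0 u + D\<^sub>\<Sigma> u"
      unfolding y_def transfer_function_eq(1)[OF r] by (subst G_split) simp
    then have "G ((\<nu> - \<mu>) *\<^sub>R y) 0 = G 0 u + D\<^sub>\<Sigma> u - H \<nu> u"
      using G_scaleR[of "- 1" "(\<mu> - \<nu>) *\<^sub>R y" 0] by (simp add: algebra_simps)
    moreover have "G (\<nu> *\<^sub>R y) 0 = (\<nu> / (\<nu> - \<mu>)) *\<^sub>R G ((\<nu> - \<mu>) *\<^sub>R y) 0"
      using G_scaleR[of "\<nu> / (\<nu> - \<mu>)" "(\<nu> - \<mu>) *\<^sub>R y" 0] \<nu>(2) by simp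
    ultimately show ?thesis using 1 by simp
  qed
  have "((\<lambda>\<nu>. \<nu> / (\<nu> - \<mu>)) \<longlongrightarrow> 1) at_top" by real_asymp
  then have "((\<lambda>\<nu>. ?f \<nu>)
      \<longlongrightarrow> G x 0 + 1 *\<^sub>R (G 0 u + D\<^sub>\<Sigma> u - d)) at_top"
    by (intro tendsto_intros D bounded_linear.tendsto[OF bounded_linear_G] resolvent_tendsto_id[OF R' M])
  moreover have "\<forall>\<^sub>F \<nu> in at_top. ?f \<nu>
      = C (\<nu> *\<^sub>R R' \<nu> (R x + ?b))"
    using eventually_ge_at_top[of \<nu>0] eventually_gt_at_top[of \<mu>]
    by eventually_elim (simp only: eq)
  ultimately have "((\<lambda>\<nu>. C (\<nu> *\<^sub>R R' \<nu> (R x + ?b))) \<longlongrightarrow>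
      G x 0 + 1 *\<^sub>R (G 0 u + D\<^sub>\<Sigma> u - d)) at_top"
    by (rule Lim_transform_eventually)
  then show ?thesis using G_split[of x u] by (simp add: add_diff_eq add.assoc)
qed

lemma input_map_C1_range:
  assumes "continuous_on UNIV \<phi>" "t \<ge> 0"
  shows "\<Phi> t (\<lambda>s. \<phi> s *\<^sub>R a) \<in> range J"
proof (rule reachable_in_state_space[OF admissible _ _ assms(2)])
  show "(\<lambda>s. \<phi> s *\<^sub>R a) \<in> Lp_loc p" using assms p by (intro Lp_loc_scaleR_continuous) auto
  show "(\<lambda>r. T\<^sub>e (s - r) (B (\<phi> r *\<^sub>R a))) integrable_on {0..s}" for s
    unfolding blinfun.scaleR_right[of B]
    by (intro integrable_continuous_real e.continuous_convolution continuous_on_subset[OF assms(1)]) auto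
qed

lemma input_map_smooth:
  assumes "smooth_positive_input \<tau> v" "t \<ge> 0"
  shows "\<exists>x. \<Phi> t v = J (R x + S (B (v t)))"
  using assms(1)
proof induction
  case zero
  show ?case by (intro exI[of _ 0]) (simp add: input_map_def blinfun.zero_right linear_0[OF linear_J])
next
  case (add v a \<phi> \<phi>')
  then obtain x where x: "\<Phi> t v = J (R x + S (B (v t)))" by blast
  note cont = continuous_on_C1[OF add.hyps(3), where S = UNIV]
  obtain z where z: "\<Phi> t (\<lambda>s. \<phi> s *\<^sub>R a) = J z"
    using input_map_C1_range[OF cont assms(2)] by blast
  obtain z' where z': "\<Phi> t (\<lambda>s. \<phi>' s *\<^sub>R a) = J z'"
    using input_map_C1_range[OF add.hyps(4) assms(2)] by blast
  have "J z = J (S (\<mu> *\<^sub>R J z - J z' + \<phi> t *\<^sub>R B a))"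
    using e.convolution_resolvent[OF is_resolvent_Te_mu assms(2) add.hyps(3,4,5), of "B a"]
    unfolding resolvent_Te_mu by (simp add: z[symmetric] z'[symmetric] input_map_def blinfun.scaleR_right)
  also have "S (\<mu> *\<^sub>R J z - J z' + \<phi> t *\<^sub>R B a) = R (\<mu> *\<^sub>R z - z') + S (B (\<phi> t *\<^sub>R a))"
    by (simp add: blinfun.add_right blinfun.diff_right blinfun.scaleR_right S(1))
  finally have *: "\<Phi> t (\<lambda>s. \<phi> s *\<^sub>R a) = J (R (\<mu> *\<^sub>R z - z') + S (B (\<phi> t *\<^sub>R a)))"
    by (simp add: z)
  have "(\<lambda>s. T\<^sub>e (t - s) (B (\<phi> s *\<^sub>R a))) integrable_on {0..t}"
    unfolding blinfun.scaleR_right[of B]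
    by (intro integrable_continuous_real e.continuous_convolution continuous_on_subset[OF cont]) auto
  then have "\<Phi> t (\<lambda>s. v s + \<phi> s *\<^sub>R a) = \<Phi> t v + \<Phi> t (\<lambda>s. \<phi> s *\<^sub>R a)"
    using e.integrable_smooth_input[OF add.hyps(1), of t B]
    by (simp add: input_map_def blinfun.add_right integral_add)
  also have "\<dots> = J (R (x + (\<mu> *\<^sub>R z - z')) + S (B (v t + \<phi> t *\<^sub>R a)))"
    unfolding x * by (simp only: linear_add[OF linear_J, symmetric] blinfun.add_right add_ac)
  finally show ?case by blast
qed

end

lemma interval_not_negligible:
  fixes c :: real
  assumes "negligible N" "c > 0" shows "\<exists>t. t \<in> {0<..<c} - N"
proof (rule ccontr)
  assume "\<not> ?thesis"
  then have "negligible (box 0 c)" using assms(1) by (auto intro: negligible_subset)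
  then have "box 0 c = {}" using negligible_interval(2) by blast
  then show False using assms(2) by simp
qed

context boundary_system
begin

abbreviation D where "D \<equiv> feedthrough T\<^sub>e B \<Gamma> D\<^sub>\<Sigma>"

lemma feedthrough_limit:
  assumes "regular"
  shows "((\<lambda>\<nu>. H \<nu> u) \<longlongrightarrow> D u) at_top"
proof -
  obtain l where l: "((\<lambda>\<nu>. H \<nu> u) \<longlongrightarrow> l) at_top"
    using assms unfolding strongly_regular_def by blast
  then show ?thesis unfolding feedthrough_def using tendsto_Lim[OF _ l] by simp
qed

section \<open>Positivity of the output map\<close>

text \<open>The averages \<open>\<xi> n\<close> of the orbit of \<open>x\<close> are positive elements of the domain, for which the
  output is \<open>C T(t) \<xi> n\<close>.\<close>

lemma output_map_nonneg:
  assumes T: "positive_semigroup T" and C: "positive_observation A C"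
    and \<Psi>: "is_output_map p A T C \<Psi>" and x: "0 \<le> x"
  shows "ae_nonneg (\<Psi> x)"
proof -
  interpret positive_extrapolation T \<mu> R J T\<^sub>e by unfold_locales (rule T)
  define \<xi> where "\<xi> n = Q (1 / real (Suc n)) x /\<^sub>R (1 / real (Suc n))" for n
  have dom: "\<xi> n \<in> Domain A" for n
    unfolding \<xi>_def by (rule DomainI[OF generator_scaleR[OF generator_Q]]) simp
  have pos: "0 \<le> \<xi> n" for n
    unfolding \<xi>_def using Q_nonneg[OF x] by (intro scaleR_nonneg_nonneg) auto
  have "filterlim (\<lambda>n. 1 / real (Suc n)) (at_right 0) sequentially" by real_asymp
  from filterlim_compose[OF Q_tendsto this] have lim: "\<xi> \<longlonglongrightarrow> x" by (simp add: \<xi>_def[abs_def])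
  show ?thesis
  proof (rule Lp_loc_limit_nonneg[OF p])
    show "Lp_loc_tendsto p (\<lambda>n. \<Psi> (\<xi> n)) (\<Psi> x)" "\<Psi> (\<xi> n) \<in> Lp_loc p" "\<Psi> x \<in> Lp_loc p" for n
      using \<Psi> lim unfolding is_output_map_def by blast+
    fix \<tau> :: real assume \<tau>: "\<tau> > 0"
    have "ae_nonneg (\<Psi> (\<xi> n))" for n
      unfolding ae_nonneg_def
    proof (rule AE_mp)
      show "AE t in lebesgue_on {0..}. \<Psi> (\<xi> n) t = C (T t (\<xi> n))"
        using \<Psi> dom unfolding is_output_map_def by blast
      show "AE t in lebesgue_on {0..}. \<Psi> (\<xi> n) t = C (T t (\<xi> n)) \<longrightarrow> 0 \<le> \<Psi> (\<xi> n) t"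
      proof (intro AE_I2 impI)
        fix t assume t: "t \<in> space (lebesgue_on {0..})" and eq: "\<Psi> (\<xi> n) t = C (T t (\<xi> n))"
        have "T t (\<xi> n) \<in> Domain A" using dom[of n] generator_T t by (auto simp: Domain_iff)
        then show "0 \<le> \<Psi> (\<xi> n) t"
          unfolding eq using C T_nonneg[OF _ pos] t by (auto simp: positive_observation_def)
      qed
    qed
    then show "\<forall>\<^sub>F n in sequentially. AE t in lebesgue_on {0..\<tau>}. 0 \<le> \<Psi> (\<xi> n) t"
      using \<tau> by (simp add: ae_nonneg_iff)
  qed
qed

text \<open>For \<open>x\<close> in the domain \<open>C T(t) x\<close> is continuous at \<open>t = 0\<close>, so positivity for almost every
  \<open>t\<close> passes to \<open>C x\<close>.\<close>

lemma observation_nonneg: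
  assumes \<Psi>: "is_output_map p A T C \<Psi>" and pos: "\<And>x. 0 \<le> x \<Longrightarrow> ae_nonneg (\<Psi> x)"
  shows "positive_observation A C"
  unfolding positive_observation_def
proof (intro ballI impI)
  fix x assume x: "x \<in> Domain A" "0 \<le> x"
  obtain y where y: "x = R y"
    using x(1) resolvent_left[OF R] by (metis DomainE)
  have "AE t in lebesgue_on {0..}. 0 \<le> C (T t x)"
  proof -
    have "AE t in lebesgue_on {0..}. \<Psi> x t = C (T t x)" using \<Psi> x unfolding is_output_map_def by blast
    moreover have "AE t in lebesgue_on {0..}. 0 \<le> \<Psi> x t" using pos[OF x(2)] by (simp add: ae_nonneg_def)
    ultimately show ?thesis by eventually_elim simp
  qed
  then obtain N where N: "negligible N" "\<And>t. t \<in> {0..} - N \<Longrightarrow> 0 \<le> C (T t x)"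
    by (auto simp: AE_lebesgue_on_iff)
  have "\<exists>t. t \<in> {0<..<1 / real (Suc n)} - N" for n
    by (rule interval_not_negligible[OF N(1)]) simp
  then obtain t where t: "\<And>n. t n \<in> {0<..<1 / real (Suc n)} - N" by metis
  have "t \<longlonglongrightarrow> 0"
  proof (rule tendsto_sandwich[of "\<lambda>_. 0" _ _ "\<lambda>n. 1 / real (Suc n)"])
    show "\<forall>\<^sub>F n in sequentially. 0 \<le> t n" "\<forall>\<^sub>F n in sequentially. t n \<le> 1 / real (Suc n)"
      using t by (auto intro!: always_eventually less_imp_le)
    show "(\<lambda>n. 1 / real (Suc n)) \<longlonglongrightarrow> 0" by real_asymp
  qed simp
  then have t0: "filterlim t (at_right 0) sequentially"
    using t by (auto simp: filterlim_at less_imp_neq[THEN not_sym] intro!: always_eventually)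
  have "(\<lambda>n. G (T (t n) y) 0) \<longlonglongrightarrow> G y 0"
    by (rule bounded_linear.tendsto[OF bounded_linear_G filterlim_compose[OF T_tendsto_0 t0]])
  moreover have "G (T (t n) y) 0 = C (T (t n) x)" for n
    using t[of n] by (simp add: y T_resolvent[OF R] observation_R)
  ultimately have "(\<lambda>n. C (T (t n) x)) \<longlonglongrightarrow> C x" by (simp add: y observation_R)
  moreover have "0 \<le> C (T (t n) x)" for n by (rule N(2)) (use t[of n] in auto)
  ultimately show "0 \<le> C x" by (intro nonneg_limit[OF sequentially_bot]) auto
qed

section \<open>Positivity of the state\<close>

text \<open>The state is an integral over the cone of the extrapolation space, belongs to the state
  space by admissibility, and the two cones agree there.\<close>

lemma state_nonneg:
  assumes T: "positive_semigroup T" and B: "positive_control J B"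
    and u: "u \<in> Lp_loc p" "ae_nonneg u" and t: "t \<ge> 0"
  shows "\<Phi> t u \<in> J ` {z. 0 \<le> z}"
proof (cases "t = 0")
  case True
  then have "\<Phi> t u = J 0" by (simp add: input_map_def linear_0[OF linear_J])
  then show ?thesis by auto
next
  case False
  interpret positive_extrapolation T \<mu> R J T\<^sub>e by unfold_locales (rule T)
  have int: "(\<lambda>r. T\<^sub>e (s - r) (B (u r))) integrable_on {0..s}" if "s \<ge> 0" for s
  proof (cases "s = 0")
    case True
    then show ?thesis using integrable_on_refl[of _ "0::real"] by (simp add: box_real)
  next
    case False
    then show ?thesis
      using that u p by (intro e.integrable_positive_input[of u p]) (auto simp: Lp_loc_def ae_nonneg_iff)
  qed
  obtain z where z: "\<Phi> t u = J z"
    using reachable_in_state_space[OF admissible u(1) int t] by auto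
  have "\<Phi> t u \<in> extrapolation_cone J"
    using u t False p by (intro input_map_in_cone[OF B p]) (auto simp: Lp_loc_def ae_nonneg_iff)
  then have "0 \<le> z" unfolding z by (rule extrapolation_cone_Int_state_space)
  then show ?thesis by (simp add: z)
qed

text \<open>The constant input \<open>u\<close> produces the state \<open>\<integral>\<^sub>0\<^sup>t T\<^sub>e s (B u)\<close>, whose average tends to
  \<open>B u\<close>.\<close>

lemma control_nonneg:
  assumes pos: "\<And>u t. 0 \<le> u \<Longrightarrow> t > 0 \<Longrightarrow> \<Phi> t (\<lambda>_. u) \<in> J ` {z. 0 \<le> z}"
  shows "positive_control J B"
  unfolding positive_control_def
proof (intro allI impI)
  fix u :: 'u assume u: "0 \<le> u"
  have "e.Q t (B u) /\<^sub>R t \<in> extrapolation_cone J" if t: "t > 0" for t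
  proof -
    have "\<Phi> t (\<lambda>_. u) = e.Q t (B u)"
      unfolding input_map_def e.Q_def by (rule integral_reflect_Icc)
    then obtain z where "e.Q t (B u) = J z" "0 \<le> z" using pos[OF u t] by auto
    then have "e.Q t (B u) /\<^sub>R t = J (z /\<^sub>R t)" "0 \<le> z /\<^sub>R t"
      using t by (auto simp: linear_scale[OF linear_J] intro!: scaleR_nonneg_nonneg)
    then show ?thesis unfolding extrapolation_cone_def using closure_subset by fastforce
  qed
  then show "B u \<in> extrapolation_cone J"
    by (intro Lim_in_closed_set[OF _ _ _ e.Q_tendsto])
      (auto simp: extrapolation_cone_def eventually_at_right_field intro!: exI[of _ 1])
qed

section \<open>Positivity of the input-output map\<close>

text \<open>For a smooth input the output at time \<open>t\<close> is \<open>C\<^sub>\<Lambda> z + D (v t)\<close> with the state \<open>z \<ge> 0\<close>, and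
  \<open>C\<^sub>\<Lambda> z\<close> is a limit of positive vectors because \<open>R(\<nu>)\<close> is positive for large \<open>\<nu>\<close>.\<close>

lemma input_output_nonneg_smooth:
  assumes reg: "regular"
    and T: "positive_semigroup T" and C: "positive_observation A C"
    and B: "positive_control J B" and D: "positive_feedthrough D"
    and v: "smooth_positive_input \<tau> v" and t: "t \<in> {0..\<tau>}"
  shows "0 \<le> F\<^sub>0 v t"
proof -
  interpret positive_extrapolation T \<mu> R J T\<^sub>e by unfold_locales (rule T)
  obtain x where x: "\<Phi> t v = J (R x + S (B (v t)))"
    using input_map_smooth[OF v] t by auto
  have z: "0 \<le> R x + S (B (v t))"
  proof (cases "t = 0")
    case True
    then have "J (R x + S (B (v t))) = J 0" using x by (simp add: input_map_def linear_0[OF linear_J])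
    then show ?thesis using inj_J by fastforce
  next
    case False
    have "v \<in> Lp p {0..t}"
      using smooth_positive_input_Lp_loc[OF v, of p] p t False by (simp add: Lp_loc_def)
    moreover have "AE s in lebesgue_on {0..t}. 0 \<le> v s"
      using smooth_positive_input_nonneg[OF v] t by (intro AE_I2) auto
    ultimately have "J (R x + S (B (v t))) \<in> extrapolation_cone J"
      unfolding x[symmetric] by (rule input_map_in_cone[OF B p])
    then show ?thesis by (rule extrapolation_cone_Int_state_space)
  qed
  obtain M \<nu>0 R' where M: "M \<ge> 0" "\<nu>0 > 0" and R': "\<And>\<nu>. \<nu> \<ge> \<nu>0 \<Longrightarrow> is_resolvent A \<nu> (R' \<nu>)"
    and bound: "\<And>\<nu> x. \<nu> \<ge> \<nu>0 \<Longrightarrow> norm (\<nu> *\<^sub>R R' \<nu> x) \<le> M * norm x"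
    and R'_cone: "\<And>\<nu> K x. \<nu> \<ge> \<nu>0 \<Longrightarrow> closed K \<Longrightarrow> convex_cone K \<Longrightarrow>
      (\<And>t x. t \<ge> 0 \<Longrightarrow> x \<in> K \<Longrightarrow> T t x \<in> K) \<Longrightarrow> x \<in> K \<Longrightarrow> R' \<nu> x \<in> K"
    by (rule resolvent_at_infinity) blast
  have "0 \<le> C (\<nu> *\<^sub>R R' \<nu> (R x + S (B (v t))))" if \<nu>: "\<nu> \<ge> \<nu>0" for \<nu>
  proof -
    have "0 \<le> R' \<nu> (R x + S (B (v t)))"
      using R'_cone[OF \<nu> closed_nonneg convex_cone_nonneg, of "R x + S (B (v t))"] T_nonneg z by simp
    then have "0 \<le> \<nu> *\<^sub>R R' \<nu> (R x + S (B (v t)))"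
      using \<nu> M by (intro scaleR_nonneg_nonneg) auto
    moreover have "\<nu> *\<^sub>R R' \<nu> (R x + S (B (v t))) \<in> Domain A"
      by (rule DomainI[OF generator_scaleR[OF resolvent_in[OF R'[OF \<nu>]]]])
    ultimately show ?thesis using C by (simp add: positive_observation_def)
  qed
  then have ev: "\<forall>\<^sub>F \<nu> in at_top. 0 \<le> C (\<nu> *\<^sub>R R' \<nu> (R x + S (B (v t))))"
    by (intro eventually_mono[OF eventually_ge_at_top[of \<nu>0]])
  have "0 \<le> G x (v t) + D\<^sub>\<Sigma> (v t) - D (v t)"
    by (rule nonneg_limit[OF _ yosida_limit[OF R' M(2) bound M(1) feedthrough_limit[OF reg]] ev]) simp
  moreover have "0 \<le> D (v t)"
    using D smooth_positive_input_nonneg[OF v t] by (simp add: positive_feedthrough_def)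
  ultimately have "0 \<le> (G x (v t) + D\<^sub>\<Sigma> (v t) - D (v t)) + D (v t)" by (rule add_nonneg_nonneg)
  then show ?thesis by (simp add: input_output_formula_def x G_def)
qed

lemma input_output_nonneg:
  assumes reg: "regular"
    and T: "positive_semigroup T" and C: "positive_observation A C"
    and B: "positive_control J B" and D: "positive_feedthrough D"
    and \<F>: "is_input_output_map p T\<^sub>e B \<Gamma> D\<^sub>\<Sigma> \<F>"
  shows "positive_input_output p \<F>"
  unfolding positive_input_output_def
proof (intro ballI impI)
  fix u :: "real \<Rightarrow> 'u" assume u: "u \<in> Lp_loc p" "ae_nonneg u"
  obtain v where v: "\<And>n. smooth_positive_input (real (Suc n)) (v n)" and lim: "Lp_loc_tendsto p v u"
    using smooth_positive_inputs_dense[OF u] p by auto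
  have vL: "v n \<in> Lp_loc p" for n using smooth_positive_input_Lp_loc[OF v] p by simp
  show "ae_nonneg (\<F> u)"
  proof (rule Lp_loc_limit_nonneg[OF p])
    show "\<F> (v n) \<in> Lp_loc p" "\<F> u \<in> Lp_loc p" for n
      using \<F> vL u(1) unfolding is_input_output_map_def by blast+
    show "Lp_loc_tendsto p (\<lambda>n. \<F> (v n)) (\<F> u)"
      using \<F> vL u(1) lim unfolding is_input_output_map_def by blast
    fix \<tau> :: real assume "\<tau> > 0"
    show "\<forall>\<^sub>F n in sequentially. AE t in lebesgue_on {0..\<tau>}. 0 \<le> \<F> (v n) t"
      using eventually_ge_at_top[of "nat \<lceil>\<tau>\<rceil>"]
    proof eventually_elim
      case (elim n)
      then have n: "\<tau> \<le> real (Suc n)" by linarith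
      have "v n \<in> (\<Inter>\<tau>\<in>{0<..}. W1p_0 p \<tau>)"
        using smooth_positive_input_W1p_0[OF v[of n]] p by auto
      then have "AE t in lebesgue_on {0..}. \<F> (v n) t = F\<^sub>0 (v n) t"
        using \<F> unfolding is_input_output_map_def by blast
      then obtain N where N: "negligible N"
        "\<And>t. t \<in> {0..} - N \<Longrightarrow> \<F> (v n) t = F\<^sub>0 (v n) t"
        by (auto simp: AE_lebesgue_on_iff)
      have "0 \<le> \<F> (v n) t" if "t \<in> {0..\<tau>} - N" for t
        using N(2)[of t] input_output_nonneg_smooth[OF reg T C B D v, of t] that n by auto
      then show ?case using N(1) by (subst AE_lebesgue_on_iff) auto
    qed
  qed
qed

text \<open>At a fixed time the first term grows exponentially in \<open>\<nu>\<close>, the second one only linearly,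
  because \<open>\<nu> R(\<nu>)\<close> is bounded and \<open>k\<close> does not depend on \<open>\<nu>\<close>.\<close>

lemma input_output_exponential:
  assumes R': "is_resolvent A \<nu> R'" and t: "t \<ge> 0" and k: "e.Q t (B u) = J k"
  shows "F\<^sub>0 (\<lambda>s. (exp (\<nu> * s) - 1) *\<^sub>R u) t =
    (exp (\<nu> * t) - 1) *\<^sub>R H \<nu> u - \<nu> *\<^sub>R G (k + (\<mu> - \<nu>) *\<^sub>R R' k) 0"
proof -
  define E where "E = exp (\<nu> * t) - 1"
  define x where "x = (\<mu> - \<nu>) *\<^sub>R (S (B u) + (\<mu> - \<nu>) *\<^sub>R R' (S (B u)))"
  define y where "y = k + (\<mu> - \<nu>) *\<^sub>R R' k"
  have "\<Phi> t (\<lambda>s. (exp (\<nu> * s) - 1) *\<^sub>R u) =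
      integral {0..t} (\<lambda>s. T\<^sub>e (t - s) ((exp (\<nu> * s) - 1) *\<^sub>R B u))"
    by (simp only: input_map_def blinfun.scaleR_right[of B])
  also have "\<dots> = resolvent (generator T\<^sub>e) \<nu> (E *\<^sub>R B u - \<nu> *\<^sub>R J k)"
    unfolding E_def k[symmetric]
    by (rule e.exponential_convolution[OF resolvent_Te_eq(2)[OF R'] t])
  also have "\<dots> = E *\<^sub>R J (R x + S (B u)) - \<nu> *\<^sub>R J (R' k)"
    by (simp only: blinfun.diff_right blinfun.scaleR_right resolvent_Te_eq(3)[OF R']
        transfer_function_eq(2)[OF R'] x_def)
  also have "R' k = R y" unfolding y_def by (rule resolvent_identity[OF R' R])
  also have "E *\<^sub>R J (R x + S (B u)) - \<nu> *\<^sub>R J (R y) = J (R (E *\<^sub>R x - \<nu> *\<^sub>R y) + S (B (E *\<^sub>R u)))"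
    by (simp add: blinfun.diff_right blinfun.scaleR_right linear_diff[OF linear_J]
        linear_add[OF linear_J] linear_scale[OF linear_J] algebra_simps)
  finally have "\<Gamma> (\<Phi> t (\<lambda>s. (exp (\<nu> * s) - 1) *\<^sub>R u)) = G (E *\<^sub>R x - \<nu> *\<^sub>R y) (E *\<^sub>R u)"
    by (simp only: G_def)
  also have "\<dots> = E *\<^sub>R G x u + (- \<nu>) *\<^sub>R G y 0"
    using G_add[of "E *\<^sub>R x" "(- \<nu>) *\<^sub>R y" "E *\<^sub>R u" 0] G_scaleR[of E x u] G_scaleR[of "- \<nu>" y 0]
    by simp
  finally have \<Gamma>: "\<Gamma> (\<Phi> t (\<lambda>s. (exp (\<nu> * s) - 1) *\<^sub>R u)) = E *\<^sub>R G x u + (- \<nu>) *\<^sub>R G y 0" .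
  have H: "H \<nu> u = G x u + D\<^sub>\<Sigma> u"
    unfolding x_def by (rule transfer_function_eq(1)[OF R'])
  show ?thesis
    unfolding H input_output_formula_def \<Gamma> E_def[symmetric] y_def[symmetric]
    by (simp add: blinfun.scaleR_right scaleR_add_right)
qed

text \<open>The outputs for the positive inputs \<open>(exp (n s) - 1) u\<close> are positive at almost every
  time, so one time \<open>t > 0\<close> serves for all \<open>n\<close>. Divided by \<open>exp (n t) - 1\<close>, they differ from
  the values \<open>H(n) u\<close> of the transfer function by a null sequence, and \<open>H(n) u \<longrightarrow> D u\<close>.\<close>

lemma feedthrough_nonneg:
  assumes reg: "regular"
    and \<F>: "is_input_output_map p T\<^sub>e B \<Gamma> D\<^sub>\<Sigma> \<F>" and pos: "positive_input_output p \<F>"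
  shows "positive_feedthrough D"
  unfolding positive_feedthrough_def
proof (intro allI impI)
  fix u :: 'u assume u: "0 \<le> u"
  define v where "v n s = (exp (real n * s) - 1) *\<^sub>R u" for n :: nat and s
  have v: "smooth_positive_input \<tau> (v n)" for n \<tau>
  proof -
    have "smooth_positive_input \<tau> (\<lambda>s. 0 + (exp (real n * s) - 1) *\<^sub>R u)"
      by (rule smooth_positive_input.add[where \<phi>' = "\<lambda>s. real n * exp (real n * s)"])
        (auto intro!: smooth_positive_input.zero u derivative_eq_intros continuous_intros)
    then show ?thesis by (simp add: v_def[abs_def])
  qed
  have "AE t in lebesgue_on {0..}. \<forall>n. 0 \<le> F\<^sub>0 (v n) t"
    unfolding AE_all_countable
  proof
    fix n
    have "v n \<in> (\<Inter>\<tau>\<in>{0<..}. W1p_0 p \<tau>)"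
      using smooth_positive_input_W1p_0[OF v] p by auto
    then have "AE t in lebesgue_on {0..}. \<F> (v n) t = F\<^sub>0 (v n) t"
      using \<F> unfolding is_input_output_map_def by blast
    moreover have "ae_nonneg (v n)"
      unfolding ae_nonneg_def v_def using u by (intro AE_I2 scaleR_nonneg_nonneg) auto
    then have "ae_nonneg (\<F> (v n))"
      using pos smooth_positive_input_Lp_loc[OF v, of p] p unfolding positive_input_output_def by auto
    then have "AE t in lebesgue_on {0..}. 0 \<le> \<F> (v n) t" by (simp add: ae_nonneg_def)
    ultimately show "AE t in lebesgue_on {0..}. 0 \<le> F\<^sub>0 (v n) t"
      by eventually_elim simp
  qed
  then obtain N where N: "negligible N"
    "\<And>t n. t \<in> {0..} - N \<Longrightarrow> 0 \<le> F\<^sub>0 (v n) t"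
    by (auto simp: AE_lebesgue_on_iff)
  obtain t where t: "t > 0" "t \<notin> N" using interval_not_negligible[OF N(1), of 1] by auto
  obtain k where k: "e.Q t (B u) = J k" using Q_Te_range_J[of t "B u"] t by auto
  obtain M \<nu>0 R' where M: "M \<ge> 0" "\<nu>0 > 0" and R': "\<And>\<nu>. \<nu> \<ge> \<nu>0 \<Longrightarrow> is_resolvent A \<nu> (R' \<nu>)"
    and bound: "\<And>\<nu> x. \<nu> \<ge> \<nu>0 \<Longrightarrow> norm (\<nu> *\<^sub>R R' \<nu> x) \<le> M * norm x"
    by (rule resolvent_at_infinity) blast
  define y where "y \<nu> = k + (\<mu> - \<nu>) *\<^sub>R R' \<nu> k" for \<nu>
  let ?K = "norm k + (\<bar>\<mu>\<bar> / \<nu>0 + 1) * (M * norm k)"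
  define c where "c n = real n / (exp (real n * t) - 1)" for n :: nat
  have c: "c \<longlonglongrightarrow> 0" unfolding c_def using t(1) by real_asymp
  have "(\<lambda>n. c n *\<^sub>R y (real n)) \<longlonglongrightarrow> 0"
  proof (rule Lim_null_comparison)
    show "(\<lambda>n. c n * ?K) \<longlonglongrightarrow> 0"
      using tendsto_mult_left_zero[OF c] by blast
    show "\<forall>\<^sub>F n in sequentially. norm (c n *\<^sub>R y (real n)) \<le> c n * ?K"
      using eventually_ge_at_top[of "nat \<lceil>\<nu>0\<rceil>"]
    proof eventually_elim
      case (elim n)
      then have n: "real n \<ge> \<nu>0" by linarith
      have n0: "real n > 0" using n M by simp
      have "(\<mu> - real n) *\<^sub>R R' (real n) k = (\<mu> / real n - 1) *\<^sub>R (real n *\<^sub>R R' (real n) k)"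
        using n0 by (simp add: algebra_simps)
      then have "norm ((\<mu> - real n) *\<^sub>R R' (real n) k) = \<bar>\<mu> / real n - 1\<bar> * norm (real n *\<^sub>R R' (real n) k)"
        by (metis norm_scaleR)
      also have "\<dots> \<le> (\<bar>\<mu>\<bar> / \<nu>0 + 1) * (M * norm k)"
      proof (rule mult_mono)
        have "\<bar>\<mu>\<bar> / real n \<le> \<bar>\<mu>\<bar> / \<nu>0" using n M n0 by (intro divide_left_mono) auto
        moreover have "\<bar>\<mu> / real n - 1\<bar> \<le> \<bar>\<mu>\<bar> / real n + 1"
          using abs_triangle_ineq4[of "\<mu> / real n" 1] n0 by simp
        ultimately show "\<bar>\<mu> / real n - 1\<bar> \<le> \<bar>\<mu>\<bar> / \<nu>0 + 1" by simp
        show "norm (real n *\<^sub>R R' (real n) k) \<le> M * norm k" by (rule bound[OF n])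
      qed (use M in auto)
      finally have "norm (y (real n)) \<le> ?K"
        unfolding y_def by (rule order_trans[OF norm_triangle_ineq add_left_mono])
      moreover have "c n \<ge> 0" using n0 t(1) by (simp add: c_def)
      ultimately show ?case by (simp add: mult_left_mono)
    qed
  qed
  then have "(\<lambda>n. G (c n *\<^sub>R y (real n)) 0) \<longlonglongrightarrow> G 0 0"
    by (rule bounded_linear.tendsto[OF bounded_linear_G])
  moreover have "(\<lambda>n. H (real n) u) \<longlonglongrightarrow> D u"
    by (rule filterlim_compose[OF feedthrough_limit[OF reg] filterlim_real_sequentially])
  ultimately have "(\<lambda>n. H (real n) u - G (c n *\<^sub>R y (real n)) 0) \<longlonglongrightarrow> D u - G 0 0"
    by (intro tendsto_diff)
  then have lim: "(\<lambda>n. H (real n) u - G (c n *\<^sub>R y (real n)) 0) \<longlonglongrightarrow> D u"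
    by simp
  show "0 \<le> D u"
  proof (rule nonneg_limit[OF sequentially_bot lim])
    show "\<forall>\<^sub>F n in sequentially. 0 \<le> H (real n) u - G (c n *\<^sub>R y (real n)) 0"
      using eventually_ge_at_top[of "nat \<lceil>\<nu>0\<rceil>"]
    proof eventually_elim
      case (elim n)
      then have n: "real n \<ge> \<nu>0" by linarith
      define E where "E = exp (real n * t) - 1"
      have E: "E > 0" using n M t(1) by (simp add: E_def)
      have "0 \<le> E *\<^sub>R H (real n) u - real n *\<^sub>R G (y (real n)) 0"
        using N(2)[of t n] t
        unfolding v_def input_output_exponential[OF R'[OF n] less_imp_le[OF t(1)] k] E_def y_def by simp
      then have "0 \<le> (1 / E) *\<^sub>R (E *\<^sub>R H (real n) u - real n *\<^sub>R G (y (real n)) 0)"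
        using E by (intro scaleR_nonneg_nonneg) auto
      also have "\<dots> = H (real n) u - (real n / E) *\<^sub>R G (y (real n)) 0"
        using E by (simp add: scaleR_diff_right)
      also have "(real n / E) *\<^sub>R G (y (real n)) 0 = G (c n *\<^sub>R y (real n)) 0"
        using G_scaleR[of "c n" "y (real n)" 0] by (simp add: c_def E_def)
      finally show ?case .
    qed
  qed
qed

section \<open>Internal positivity\<close>

text \<open>The zero input and the zero initial state have zero response, which isolates the two
  contributions to the state and to the output.\<close>

lemma internally_positive_imp:
  assumes \<Psi>: "is_output_map p A T C \<Psi>" and \<F>: "is_input_output_map p T\<^sub>e B \<Gamma> D\<^sub>\<Sigma> \<F>"
    and pos: "internally_positive p T J T\<^sub>e B \<Psi> \<F>"
  shows "positive_semigroup T" "positive_observation A C" "positive_control J B"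
    "positive_input_output p \<F>"
proof -
  have zero: "(\<lambda>_. 0) \<in> Lp_loc p" "ae_nonneg (\<lambda>_. 0::'u)"
    using Lp_loc_const[of p 0] p by (auto simp: ae_nonneg_def)
  have in0: "\<Phi> t (\<lambda>_. 0) = 0" for t by (simp add: input_map_def blinfun.zero_right)
  have state: "J (T t x) + \<Phi> t u \<in> J ` {z. 0 \<le> z}"
    and output_ge: "AE t in lebesgue_on {0..}. 0 \<le> \<Psi> x t + \<F> u t"
    if "0 \<le> x" "u \<in> Lp_loc p" "ae_nonneg u" "t \<ge> 0" for x u t
    using pos that unfolding internally_positive_def ae_nonneg_def by blast+
  show "positive_semigroup T"
    unfolding positive_semigroup_def
  proof (intro allI impI)
    fix t :: real and x :: 'x assume "0 \<le> t" "0 \<le> x"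
    then obtain z where "J (T t x) = J z" "0 \<le> z" using state[OF _ zero] by (auto simp: in0)
    then show "0 \<le> T t x" using inj_J by blast
  qed
  have "(\<lambda>_. 0::'u) \<in> (\<Inter>\<tau>\<in>{0<..}. W1p_0 p \<tau>)"
    using p by (intro INT_I smooth_positive_input_W1p_0[OF smooth_positive_input.zero]) auto
  then have "AE t in lebesgue_on {0..}. \<F> (\<lambda>_. 0) t = F\<^sub>0 (\<lambda>_. 0) t"
    using \<F> unfolding is_input_output_map_def by blast
  then have F0: "AE t in lebesgue_on {0..}. \<F> (\<lambda>_. 0) t = 0"
    using observation_zero
    by (simp add: input_output_formula_def in0 blinfun.zero_right observation_operator_def linear_0[OF linear_J])
  have "0 \<in> Domain A"
    using DomainI[OF generator_Q[of 0 0]] by (simp add: Q_def)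
  then have "AE t in lebesgue_on {0..}. \<Psi> 0 t = C (T t 0)"
    using \<Psi> unfolding is_output_map_def by blast
  then have \<Psi>0: "AE t in lebesgue_on {0..}. \<Psi> 0 t = 0" by (simp add: blinfun.zero_right observation_zero)
  show "positive_observation A C"
  proof (rule observation_nonneg[OF \<Psi>])
    fix x :: 'x assume "0 \<le> x"
    from output_ge[OF this zero order_refl] F0 show "ae_nonneg (\<Psi> x)"
      unfolding ae_nonneg_def by eventually_elim simp
  qed
  show "positive_input_output p \<F>"
    unfolding positive_input_output_def
  proof (intro ballI impI)
    fix u :: "real \<Rightarrow> 'u" assume "u \<in> Lp_loc p" "ae_nonneg u"
    from output_ge[OF order_refl this order_refl] \<Psi>0 show "ae_nonneg (\<F> u)"
      unfolding ae_nonneg_def by eventually_elim simp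
  qed
  show "positive_control J B"
  proof (rule control_nonneg)
    fix u :: 'u and t :: real assume "0 \<le> u" "t > 0"
    then show "\<Phi> t (\<lambda>_. u) \<in> J ` {z. 0 \<le> z}"
      using state[of 0 "\<lambda>_. u" t] Lp_loc_const[of p u] p
      by (simp add: ae_nonneg_def blinfun.zero_right linear_0[OF linear_J])
  qed
qed

lemma internally_positiveI:
  assumes \<Psi>: "is_output_map p A T C \<Psi>"
    and T: "positive_semigroup T" and C: "positive_observation A C"
    and B: "positive_control J B" and \<F>: "positive_input_output p \<F>"
  shows "internally_positive p T J T\<^sub>e B \<Psi> \<F>"
  unfolding internally_positive_def
proof (intro allI impI ballI conjI)
  fix x :: 'x and u :: "real \<Rightarrow> 'u"
  assume x: "0 \<le> x" and u: "u \<in> Lp_loc p" "ae_nonneg u"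
  show "J (T t x) + \<Phi> t u \<in> J ` {z. 0 \<le> z}" if t: "0 \<le> t" for t
  proof -
    obtain z where "\<Phi> t u = J z" "0 \<le> z" using state_nonneg[OF T B u t] by auto
    moreover have "0 \<le> T t x" using T t x by (simp add: positive_semigroup_def)
    ultimately have "J (T t x) + \<Phi> t u = J (T t x + z)" "0 \<le> T t x + z"
      by (simp_all add: linear_add[OF linear_J])
    then show ?thesis by auto
  qed
  have "ae_nonneg (\<Psi> x)" by (rule output_map_nonneg[OF T C \<Psi> x])
  moreover have "ae_nonneg (\<F> u)" using \<F> u by (simp add: positive_input_output_def)
  ultimately show "ae_nonneg (\<lambda>t. \<Psi> x t + \<F> u t)"
    unfolding ae_nonneg_def by eventually_elim (rule add_nonneg_nonneg)
qed

end

theorem proposition4p2: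
  fixes p \<mu> :: real
    and A :: "('x::banach_lattice \<times> 'x) set"
    and T :: "real \<Rightarrow> 'x \<Rightarrow>\<^sub>L 'x"
    and J :: "'x \<Rightarrow> 'e::banach"
    and T\<^sub>e :: "real \<Rightarrow> 'e \<Rightarrow>\<^sub>L 'e"
    and B :: "'u::banach_lattice \<Rightarrow>\<^sub>L 'e"
    and \<Gamma> :: "'e \<Rightarrow> 'y::banach_lattice"
    and D\<^sub>\<Sigma> :: "'u \<Rightarrow>\<^sub>L 'y"
    and C :: "'x \<Rightarrow> 'y"
    and \<Psi> :: "'x \<Rightarrow> real \<Rightarrow> 'y"
    and \<F> :: "(real \<Rightarrow> 'u) \<Rightarrow> real \<Rightarrow> 'y"
  assumes "1 \<le> p"
    and "generates A T"
    and "\<mu> \<in> resolvent_set A"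
    and "is_extrapolation_space A \<mu> J"
    and "is_extrapolated_semigroup J T T\<^sub>e"
    and "bounded_linear_on_Z A \<mu> J T\<^sub>e B \<Gamma>"
    and "C = observation_operator J \<Gamma>"
    and "well_posed p A T J T\<^sub>e B \<Gamma> D\<^sub>\<Sigma>"
    and "is_output_map p A T C \<Psi>"
    and "is_input_output_map p T\<^sub>e B \<Gamma> D\<^sub>\<Sigma> \<F>"
  shows "(internally_positive p T J T\<^sub>e B \<Psi> \<F> \<longleftrightarrow>
            (generates A T \<and> positive_semigroup T) \<and> positive_observation A C \<and>
            positive_control J B \<and> positive_input_output p \<F>) \<and>
         (strongly_regular T\<^sub>e B \<Gamma> D\<^sub>\<Sigma> \<longrightarrow>
           (internally_positive p T J T\<^sub>e B \<Psi> \<F> \<longleftrightarrow>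
              positive_feedthrough (feedthrough T\<^sub>e B \<Gamma> D\<^sub>\<Sigma>) \<and> positive_observation A C \<and>
              positive_control J B \<and> positive_semigroup T))"
proof -
  have A: "A = generator T" and c0: "c0_semigroup T" using assms(2) by (simp_all add: generates_def)
  obtain R where R: "is_resolvent A \<mu> R" using assms(3) by (auto simp: resolvent_set_def)
  interpret boundary_system T \<mu> R J T\<^sub>e B \<Gamma> D\<^sub>\<Sigma> p
    by unfold_locales (use assms R c0 in \<open>simp_all add: A well_posed_def\<close>)
  note C = assms(7) and \<Psi> = assms(9)[unfolded A assms(7)] and \<F> = assms(10)
  have 1: "internally_positive p T J T\<^sub>e B \<Psi> \<F> \<longleftrightarrow>
      positive_semigroup T \<and> positive_observation A C \<and> positive_control J B \<and> positive_input_output p \<F>"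
    unfolding A C using internally_positive_imp[OF \<Psi> \<F>] internally_positiveI[OF \<Psi>] by blast
  moreover have "positive_feedthrough (feedthrough T\<^sub>e B \<Gamma> D\<^sub>\<Sigma>)"
    if "strongly_regular T\<^sub>e B \<Gamma> D\<^sub>\<Sigma>" "positive_input_output p \<F>"
    using feedthrough_nonneg[OF that(1) \<F> that(2)] .
  moreover have "positive_input_output p \<F>"
    if "strongly_regular T\<^sub>e B \<Gamma> D\<^sub>\<Sigma>" "positive_semigroup T" "positive_observation A C"
      "positive_control J B" "positive_feedthrough (feedthrough T\<^sub>e B \<Gamma> D\<^sub>\<Sigma>)"
    using input_output_nonneg[OF that(1,2) _ that(4,5) \<F>] that(3) unfolding A C by blast
  ultimately show ?thesis using assms(2) by blast
qed

end
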